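(* Let $1<p<\infty$, let $(X,d,\mu)$ be a complete metric space equipped with a positive doubling Borel measure $\mu$ and supporting a weak $(1,p)$-Poincaré inequality, let $\Omega\subset X$ be open and bounded, let $0<T<\infty$, and write $\Omega_T=\Omega\times(0,T)$ and $d\nu=d\mu\,dt$. Let $\alpha>0$ and $K\ge1$. A function $u\in L^p_{\mathrm{loc}}(0,T;N^{1,p}_{\mathrm{loc}}(\Omega))\cap L^2_{\mathrm{loc}}(\Omega_T)$ is a parabolic $K$-quasisuperminimizer (with constant $\alpha$) if and only if for every nonnegative $\phi\in\mathrm{Lip}(\Omega_T)$ such that $\operatorname{supp}\phi\subset\Omega_T$, we have $$\alpha\int_{\operatorname{supp}\phi} u\,\frac{\partial\phi}{\partial t}\,d\nu+\int_{\operatorname{supp}\phi} g_u^p\,d\nu\le K\int_{\operatorname{supp}\phi} g_{u+\phi}^p\,d\nu.$$ Here $\operatorname{supp}\phi$ denotes the closure of $\{\phi\neq0\}$ in $X\times\mathbb{R}$ (so that $\operatorname{supp}\phi\subset\Omega_T$ means that $\phi$ has compact support in $\Omega_T$).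
   Context: Doubling: there is $C_\mu\ge1$ with $\mu(B(x,2r))\le C_\mu\,\mu(B(x,r))$ for all $x\in X$, $r>0$; moreover $0<\mu(B(x,r))<\infty$ for all $x\in X$, $r>0$. A complete metric space with a doubling measure is proper (closed bounded sets are compact). Upper gradients: a nonnegative Borel function $g:\Omega\to[0,\infty]$ is an upper gradient of $u:\Omega\to[-\infty,\infty]$ if $|u(x)-u(y)|\le\int_\gamma g\,ds$ for all compact rectifiable paths $\gamma$ in $\Omega$ joining $x$ and $y$ (the left side is taken to be $\infty$ if $u(x)=u(y)=\infty$ or $u(x)=u(y)=-\infty$). If the inequality holds for all paths outside a family of zero $p$-modulus, $g$ is a $p$-weak upper gradient. If a measurable $u$ has an upper gradient in $L^p(\Omega)$, then $g_u$ denotes its minimal $p$-weak upper gradient: $g_u$ is a $p$-weak upper gradient and $g_u\le g$ $\mu$-a.e. for every $p$-weak upper gradient $g$ of $u$. Newtonian spaces: for $u\in L^p(\Omega)$, $\|u\|_{1,p,\Omega}=\|u\|_{L^p(\Omega,\mu)}+\|g_u\|_{L^p(\Omega,\mu)}$; $N^{1,p}(\Omega)$ is the space of $u$ with $\|u\|_{1,p,\Omega}<\infty$, modulo $u\sim v$ iff $\|u-v\|_{1,p,\Omega}=0$. The notation $A\Subset B$ means that $\overline{A}$ is a compact subset of $B$. $N^{1,p}_{\mathrm{loc}}(\Omega)$ consists of functions in $N^{1,p}(\Omega')$ for every $\Omega'\Subset\Omega$. Weak $(1,p)$-Poincaré inequality: there are $P_0>0$, $\tau\ge1$ such that for every $u\in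 N^{1,p}(X)$, $x\in X$, $r>0$, $$\frac1{\mu(B(x,r))}\int_{B(x,r)}|u-u_{B(x,r)}|\,d\mu\le P_0\, r\Big(\frac1{\mu(B(x,\tau r))}\int_{B(x,\tau r)}g_u^p\,d\mu\Big)^{1/p},$$ where $u_{B(x,r)}$ is the mean value of $u$ over $B(x,r)$. Parabolic spaces: for $u=u(x,t)$, $g_u(x,t)=g_{u(\cdot,t)}(x)$ (upper gradient in the space variable only). $L^p(t_1,t_2;N^{1,p}(\Omega'))$ is the space of functions $u(x,t)$ with $u(\cdot,t)\in N^{1,p}(\Omega')$ for a.e. $t_1<t<t_2$ and $\int_{t_1}^{t_2}\|u(\cdot,t)\|_{1,p,\Omega'}^p\,dt<\infty$. $u\in L^p_{\mathrm{loc}}(0,T;N^{1,p}_{\mathrm{loc}}(\Omega))$ means $u\in L^p(t_1,t_2;N^{1,p}(\Omega'))$ for all $0<t_1<t_2<T$ and $\Omega'\Subset\Omega$. $\mathrm{Lip}(\Omega_T)$ is the set of Lipschitz continuous functions on $\Omega_T$. Parabolic $K$-quasisuperminimizer (with constant $\alpha>0$): a function $u\in L^p_{\mathrm{loc}}(0,T;N^{1,p}_{\mathrm{loc}}(\Omega))\cap L^2_{\mathrm{loc}}(\Omega_T)$ such that for every open $U\Subset\Omega_T$ and every nonnegative $\phi\in\mathrm{Lip}(\Omega_T)$ with $\{\phi>0\}\subset U$, $$\alpha\int_U u\,\frac{\partial\phi}{\partial t}\,d\nu+\int_U g_u^p\,d\nu\le K\int_U g_{u+\phi}^p\,d\nu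.$$
   Formalization: The minimal p-weak upper gradient g_u is taken minimal among p-weak upper gradients that are locally in L^p; minimality among all p-weak upper gradients, as literally written, is unattainable already for u(x)=x on an interval. *)

theory Defs
  imports "HOL-Analysis.Analysis"
begin

section \<open>Compact containment and Lebesgue spaces\<close>

definition compactly_in :: "'a::topological_space set \<Rightarrow> 'a set \<Rightarrow> bool" where
  "compactly_in A B \<longleftrightarrow> compact (closure A) \<and> closure A \<subseteq> B"

text \<open>Powers of extended nonnegative numbers, used for exponents \<open>q > 0\<close> only.\<close>

definition epow :: "ennreal \<Rightarrow> real \<Rightarrow> ennreal" where
  "epow a q = (if a = \<infinity> then \<infinity> else ennreal (enn2real a powr q))"

definition Lp_norm :: "real \<Rightarrow> 'a measure \<Rightarrow> 'a set \<Rightarrow> ('a \<Rightarrow> ereal) \<Rightarrow> ennreal" where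
  "Lp_norm q M A u = epow (\<integral>\<^sup>+x\<in>A. epow (e2ennreal \<bar>u x\<bar>) q \<partial>M) (1 / q)"

text \<open>Measurability of functions is understood with respect to the completed measure.
  The functions are not identified when they agree almost everywhere: for upper gradients
  the pointwise values matter.\<close>

definition in_Lp :: "real \<Rightarrow> 'a measure \<Rightarrow> 'a set \<Rightarrow> ('a \<Rightarrow> ereal) \<Rightarrow> bool" where
  "in_Lp q M A u \<longleftrightarrow>
     u \<in> borel_measurable (restrict_space (completion M) A) \<and> Lp_norm q M A u < \<infinity>"

definition in_Lp_loc ::
    "real \<Rightarrow> 'a::topological_space measure \<Rightarrow> 'a set \<Rightarrow> ('a \<Rightarrow> ereal) \<Rightarrow> bool" where
  "in_Lp_loc q M A u \<longleftrightarrow> (\<forall>B. open B \<and> compactly_in B A \<longrightarrow> in_Lp q M B u)"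

section \<open>Rectifiable paths and path integrals\<close>

definition path_len :: "(real \<Rightarrow> 'x::metric_space) \<Rightarrow> real \<Rightarrow> real \<Rightarrow> ennreal" where
  "path_len \<gamma> a b =
     (SUP ts\<in>{ts. sorted ts \<and> set ts \<subseteq> {a..b}}.
        \<Sum>i<length ts - 1. ennreal (dist (\<gamma> (ts ! i)) (\<gamma> (ts ! Suc i))))"

text \<open>Compact rectifiable paths, parametrized over \<open>[0,1]\<close>. As usual in this theory they are
  nonconstant; otherwise no function could take an infinite value and have an upper gradient.\<close>

definition rect_paths :: "'x::metric_space set \<Rightarrow> (real \<Rightarrow> 'x) set" where
  "rect_paths \<Omega> = {\<gamma>. path \<gamma> \<and> path_image \<gamma> \<subseteq> \<Omega> \<and> \<not> \<gamma> constant_on {0..1} \<and> path_len \<gamma> 0 1 < \<infinity>}"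

text \<open>The value of \<open>arc_param \<gamma> s\<close> does not depend on the choice, since a path is constant where
  its length function is.\<close>

definition arc_param :: "(real \<Rightarrow> 'x::metric_space) \<Rightarrow> real \<Rightarrow> 'x" where
  "arc_param \<gamma> s = \<gamma> (SOME t. t \<in> {0..1} \<and> path_len \<gamma> 0 t = ennreal s)"

definition path_integral :: "('x::metric_space \<Rightarrow> ennreal) \<Rightarrow> (real \<Rightarrow> 'x) \<Rightarrow> ennreal" where
  "path_integral g \<gamma> = (\<integral>\<^sup>+s\<in>{0..enn2real (path_len \<gamma> 0 1)}. g (arc_param \<gamma> s) \<partial>lborel)"

section \<open>Upper gradients\<close>

text \<open>With the conventions of type \<^typ>\<open>ereal\<close>, the difference of two equal infinite values has
  absolute value \<open>\<infinity>\<close>, as required.\<close>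

definition ug_ineq :: "('x::metric_space \<Rightarrow> ereal) \<Rightarrow> ('x \<Rightarrow> ennreal) \<Rightarrow> (real \<Rightarrow> 'x) \<Rightarrow> bool" where
  "ug_ineq u g \<gamma> \<longleftrightarrow> e2ennreal \<bar>u (pathstart \<gamma>) - u (pathfinish \<gamma>)\<bar> \<le> path_integral g \<gamma>"

definition upper_gradient ::
    "'x::metric_space set \<Rightarrow> ('x \<Rightarrow> ereal) \<Rightarrow> ('x \<Rightarrow> ennreal) \<Rightarrow> bool" where
  "upper_gradient \<Omega> u g \<longleftrightarrow>
     g \<in> borel_measurable (restrict_space borel \<Omega>) \<and> (\<forall>\<gamma>\<in>rect_paths \<Omega>. ug_ineq u g \<gamma>)"

definition p_modulus :: "real \<Rightarrow> 'x::metric_space measure \<Rightarrow> (real \<Rightarrow> 'x) set \<Rightarrow> ennreal" where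
  "p_modulus p M \<Gamma> =
     (INF \<rho>\<in>{\<rho> \<in> borel_measurable borel. \<forall>\<gamma>\<in>\<Gamma>. 1 \<le> path_integral \<rho> \<gamma>}. \<integral>\<^sup>+x. epow (\<rho> x) p \<partial>M)"

definition weak_upper_gradient ::
    "real \<Rightarrow> 'x::metric_space measure \<Rightarrow> 'x set \<Rightarrow> ('x \<Rightarrow> ereal) \<Rightarrow> ('x \<Rightarrow> ennreal) \<Rightarrow> bool" where
  "weak_upper_gradient p M \<Omega> u g \<longleftrightarrow>
     g \<in> borel_measurable (restrict_space borel \<Omega>) \<and>
     (\<exists>\<Gamma>. \<Gamma> \<subseteq> rect_paths \<Omega> \<and> p_modulus p M \<Gamma> = 0 \<and> (\<forall>\<gamma>\<in>rect_paths \<Omega> - \<Gamma>. ug_ineq u g \<gamma>))"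

text \<open>Minimality is among the \<open>p\<close>-weak upper gradients in \<open>L^p_loc(\<Omega>)\<close>. Some integrability is
  indispensable: on the real line there are Borel functions that vanish on a set of positive measure
  but have infinite integral over every interval, and these are upper gradients of every function.
  When \<open>u\<close> has an upper gradient in \<open>L^p(\<Omega>)\<close>, minimality among the \<open>p\<close>-weak upper gradients in
  \<open>L^p(\<Omega>)\<close> means the same; the local form also covers \<open>u\<close> in \<open>N^{1,p}_loc(\<Omega>)\<close>.\<close>

definition minimal_wug ::
    "real \<Rightarrow> 'x::metric_space measure \<Rightarrow> 'x set \<Rightarrow> ('x \<Rightarrow> ereal) \<Rightarrow> ('x \<Rightarrow> ennreal) \<Rightarrow> bool" where
  "minimal_wug p M \<Omega> u g \<longleftrightarrow>
     weak_upper_gradient p M \<Omega> u g \<and> in_Lp_loc p M \<Omega> (\<lambda>x. enn2ereal (g x)) \<and>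
     (\<forall>h. weak_upper_gradient p M \<Omega> u h \<and> in_Lp_loc p M \<Omega> (\<lambda>x. enn2ereal (h x)) \<longrightarrow>
        (AE x in M. x \<in> \<Omega> \<longrightarrow> g x \<le> h x))"

text \<open>The minimal \<open>p\<close>-weak upper gradient \<open>g_u\<close>, determined up to null sets; \<open>\<infinity>\<close> if there is
  none.\<close>

definition min_ugrad ::
    "real \<Rightarrow> 'x::metric_space measure \<Rightarrow> 'x set \<Rightarrow> ('x \<Rightarrow> ereal) \<Rightarrow> 'x \<Rightarrow> ennreal" where
  "min_ugrad p M \<Omega> u =
     (if \<exists>g. minimal_wug p M \<Omega> u g then SOME g. minimal_wug p M \<Omega> u g else (\<lambda>_. \<infinity>))"

section \<open>Newtonian spaces, doubling and Poincare inequality\<close>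

definition newton_norm ::
    "real \<Rightarrow> 'x::metric_space measure \<Rightarrow> 'x set \<Rightarrow> ('x \<Rightarrow> ereal) \<Rightarrow> ennreal" where
  "newton_norm p M \<Omega> u = Lp_norm p M \<Omega> u + Lp_norm p M \<Omega> (\<lambda>x. enn2ereal (min_ugrad p M \<Omega> u x))"

definition newtonian ::
    "real \<Rightarrow> 'x::metric_space measure \<Rightarrow> 'x set \<Rightarrow> ('x \<Rightarrow> ereal) \<Rightarrow> bool" where
  "newtonian p M \<Omega> u \<longleftrightarrow>
     in_Lp p M \<Omega> u \<and>
     (\<exists>g. upper_gradient \<Omega> u g \<and> in_Lp p M \<Omega> (\<lambda>x. enn2ereal (g x))) \<and>
     newton_norm p M \<Omega> u < \<infinity>"

definition doubling_measure :: "'x::metric_space measure \<Rightarrow> bool" where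
  "doubling_measure M \<longleftrightarrow>
     sets M = sets borel \<and>
     (\<forall>x r. 0 < r \<longrightarrow> 0 < emeasure M (ball x r) \<and> emeasure M (ball x r) < \<infinity>) \<and>
     (\<exists>C\<ge>1. \<forall>x r. 0 < r \<longrightarrow> emeasure M (ball x (2 * r)) \<le> ennreal C * emeasure M (ball x r))"

definition mean_value :: "'x measure \<Rightarrow> 'x set \<Rightarrow> ('x \<Rightarrow> ereal) \<Rightarrow> real" where
  "mean_value M B u = (LINT x:B|completion M. real_of_ereal (u x)) / measure M B"

definition weak_poincare :: "real \<Rightarrow> 'x::metric_space measure \<Rightarrow> bool" where
  "weak_poincare p M \<longleftrightarrow>
     (\<exists>P0>0. \<exists>\<tau>\<ge>1. \<forall>u x r. newtonian p M UNIV u \<and> 0 < r \<longrightarrow>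
        (\<integral>\<^sup>+y\<in>ball x r. e2ennreal \<bar>u y - ereal (mean_value M (ball x r) u)\<bar> \<partial>M)
            / emeasure M (ball x r)
        \<le> ennreal (P0 * r) *
           epow ((\<integral>\<^sup>+y\<in>ball x (\<tau> * r). epow (min_ugrad p M UNIV u y) p \<partial>M)
                  / emeasure M (ball x (\<tau> * r))) (1 / p))"

section \<open>Parabolic spaces\<close>

abbreviation cylinder :: "'x set \<Rightarrow> real \<Rightarrow> ('x \<times> real) set" where
  "cylinder \<Omega> T \<equiv> \<Omega> \<times> {0<..<T}"

abbreviation spacetime :: "'x measure \<Rightarrow> ('x \<times> real) measure" where
  "spacetime M \<equiv> M \<Otimes>\<^sub>M lborel"

text \<open>\<open>L^p(t1,t2;N^{1,p}(\<Omega>))\<close>. Finiteness of the time integral includes that the norm is a measurable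
  function of time.\<close>

definition in_Lp_newtonian ::
    "real \<Rightarrow> 'x::metric_space measure \<Rightarrow> 'x set \<Rightarrow> real \<Rightarrow> real \<Rightarrow> ('x \<times> real \<Rightarrow> ereal) \<Rightarrow> bool" where
  "in_Lp_newtonian p M \<Omega> t1 t2 u \<longleftrightarrow>
     (AE t in lborel. t \<in> {t1<..<t2} \<longrightarrow> newtonian p M \<Omega> (\<lambda>x. u (x, t))) \<and>
     (\<lambda>t. newton_norm p M \<Omega> (\<lambda>x. u (x, t))) \<in> borel_measurable (lebesgue_on {t1<..<t2}) \<and>
     (\<integral>\<^sup>+t\<in>{t1<..<t2}. epow (newton_norm p M \<Omega> (\<lambda>x. u (x, t))) p \<partial>lborel) < \<infinity>"

definition in_Lp_newtonian_loc ::
    "real \<Rightarrow> 'x::metric_space measure \<Rightarrow> 'x set \<Rightarrow> real \<Rightarrow> ('x \<times> real \<Rightarrow> ereal) \<Rightarrow> bool" where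
  "in_Lp_newtonian_loc p M \<Omega> T u \<longleftrightarrow>
     (\<forall>t1 t2 \<Omega>'. 0 < t1 \<and> t1 < t2 \<and> t2 < T \<and> open \<Omega>' \<and> compactly_in \<Omega>' \<Omega> \<longrightarrow>
        in_Lp_newtonian p M \<Omega>' t1 t2 u)"

text \<open>The relation \<open>g_u(x,t) = g_{u(\<cdot>,t)}(x)\<close> fixes the values only up to a null set on each time slice.
  As \<open>g_u\<close> is integrated over space-time sets, a jointly measurable representative is taken; it is
  unique almost everywhere with respect to the product measure
  (and \<open>\<infinity>\<close> by convention if there is none).\<close>

definition is_par_ugrad ::
    "real \<Rightarrow> 'x::metric_space measure \<Rightarrow> 'x set \<Rightarrow> real \<Rightarrow> ('x \<times> real \<Rightarrow> ereal)
      \<Rightarrow> ('x \<times> real \<Rightarrow> ennreal) \<Rightarrow> bool" where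
  "is_par_ugrad p M \<Omega> T u G \<longleftrightarrow>
     G \<in> borel_measurable (restrict_space (completion (spacetime M)) (cylinder \<Omega> T)) \<and>
     (AE t in lborel. t \<in> {0<..<T} \<longrightarrow>
        (AE x in M. x \<in> \<Omega> \<longrightarrow> G (x, t) = min_ugrad p M \<Omega> (\<lambda>y. u (y, t)) x))"

definition par_ugrad ::
    "real \<Rightarrow> 'x::metric_space measure \<Rightarrow> 'x set \<Rightarrow> real \<Rightarrow> ('x \<times> real \<Rightarrow> ereal)
      \<Rightarrow> 'x \<times> real \<Rightarrow> ennreal" where
  "par_ugrad p M \<Omega> T u =
     (if \<exists>G. is_par_ugrad p M \<Omega> T u G then SOME G. is_par_ugrad p M \<Omega> T u G else (\<lambda>_. \<infinity>))"

section \<open>Quasisuperminimizers\<close>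

definition nonneg_Lip :: "'a::metric_space set \<Rightarrow> ('a \<Rightarrow> real) \<Rightarrow> bool" where
  "nonneg_Lip A \<phi> \<longleftrightarrow> (\<exists>L. L-lipschitz_on A \<phi>) \<and> (\<forall>z\<in>A. 0 \<le> \<phi> z)"

text \<open>For Lipschitz \<open>\<phi>\<close> the derivative exists almost everywhere.\<close>

definition time_deriv :: "('x \<times> real \<Rightarrow> real) \<Rightarrow> 'x \<times> real \<Rightarrow> real" where
  "time_deriv \<phi> z = deriv (\<lambda>s. \<phi> (fst z, s)) (snd z)"

text \<open>Only values in \<open>A\<close> matter, so that \<open>\<phi>\<close> represents a function defined on \<open>A\<close>; the closure
  is nevertheless taken in the whole space.\<close>

definition supp :: "'a::topological_space set \<Rightarrow> ('a \<Rightarrow> real) \<Rightarrow> 'a set" where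
  "supp A \<phi> = closure (support_on A \<phi>)"

definition quasisuperminimizer ::
    "real \<Rightarrow> 'x::metric_space measure \<Rightarrow> 'x set \<Rightarrow> real \<Rightarrow> real \<Rightarrow> real
      \<Rightarrow> ('x \<times> real \<Rightarrow> ereal) \<Rightarrow> bool" where
  "quasisuperminimizer p M \<Omega> T \<alpha> K u \<longleftrightarrow>
     in_Lp_newtonian_loc p M \<Omega> T u \<and> in_Lp_loc 2 (spacetime M) (cylinder \<Omega> T) u \<and>
     (\<forall>U \<phi>. open U \<and> compactly_in U (cylinder \<Omega> T) \<and> nonneg_Lip (cylinder \<Omega> T) \<phi> \<and>
        {z \<in> cylinder \<Omega> T. 0 < \<phi> z} \<subseteq> U \<longrightarrow>
        ereal (\<alpha> * (LINT z:U|completion (spacetime M). real_of_ereal (u z) * time_deriv \<phi> z))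
          + enn2ereal (\<integral>\<^sup>+z\<in>U. epow (par_ugrad p M \<Omega> T u z) p \<partial>spacetime M)
        \<le> ereal K *
          enn2ereal (\<integral>\<^sup>+z\<in>U. epow (par_ugrad p M \<Omega> T (\<lambda>z. u z + ereal (\<phi> z)) z) p \<partial>spacetime M))"

end

theory Submission
  imports Defs "HOL-Probability.Giry_Monad"
begin

text \<open>
  If \<open>u + \<phi>\<close> has no jointly measurable minimal upper gradient, the right-hand sides are infinite.
  Otherwise all energies over compactly contained sets are finite, and both implications are limit
  arguments. Inequalities on open sets \<open>U\<^sub>n\<close> shrinking to \<open>supp \<phi>\<close> give the inequality on the
  support. Conversely, given \<open>{\<phi> > 0} \<subseteq> U\<close>, one tests with \<open>\<phi>\<^sub>\<epsilon> = max (\<phi> - \<epsilon>) 0\<close>, whose support lies in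
  \<open>{\<phi> \<ge> \<epsilon>} \<subseteq> U\<close>, and lets \<open>\<epsilon>\<close> tend to \<open>0\<close>; on \<open>U \<inter> {\<phi> = 0}\<close>, whose part in \<open>supp \<phi>\<close> may have positive
  measure, \<open>\<partial>\<phi>/\<partial>t = 0\<close> and \<open>g\<^sub>u = g\<^sub>u\<^sub>+\<^sub>\<phi>\<close> almost everywhere.

  The latter is the locality of minimal weak upper gradients. On a path \<open>\<gamma>\<close> parametrized by arc length,
  an upper gradient \<open>h\<close> of \<open>v\<close> may replace an upper gradient \<open>g\<close> of \<open>u\<close> on a compact set \<open>Z\<close> of
  parameters at which \<open>u \<circ> \<gamma> = v \<circ> \<gamma>\<close>: near a point of \<open>Z\<close> one moves with \<open>g\<close> to the first point of
  \<open>Z\<close>, with \<open>h\<close> to the last one, and again with \<open>g\<close> after that. Neither absolute continuity nor the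
  Poincare inequality is needed, and the same gluing yields the existence of minimal weak upper
  gradients and their compatibility with restriction to open subsets.
\<close>

section \<open>Length and arc-length parametrization of paths\<close>

text \<open>Three obstacles shape the proof. Exceptional path families are awkward under subpaths
  and countable unions, so each is represented by one L^p function with infinite integral along its
  paths (Fuglede): a path with finite integral passes this property on to its pieces, and countably
  many such functions are dominated, up to positive factors, by a single one. Next,
  \<open>par_ugrad\<close> takes the value \<infinity> unless a jointly measurable representative
  exists. For \<open>u\<close> existence is derived from the measurability in time of the Newtonian
  norms and the joint measurability of \<open>u\<close>; for truncated test functions it is patched
  together from \<open>u\<close> and \<open>u + \<phi>\<close>. For \<open>u + \<phi>\<close> itself
  it is not claimed, whence the case distinction. Finally, the hypotheses speak about open sets with
  compact closure in \<Omega>, with minimal gradients relative to the smaller set, while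
  \<open>par_ugrad\<close> refers to \<Omega>; therefore gluing and locality are stated for one
  function on \<Omega> and another on an open subset.\<close>

definition poly_len :: "(real \<Rightarrow> 'x::metric_space) \<Rightarrow> real list \<Rightarrow> ennreal" where
  "poly_len \<gamma> ts = (\<Sum>i<length ts - 1. ennreal (dist (\<gamma> (ts ! i)) (\<gamma> (ts ! Suc i))))"

lemma poly_len_simps [simp]:
  "poly_len \<gamma> [] = 0" "poly_len \<gamma> [x] = 0"
  "poly_len \<gamma> (x # y # ts) = ennreal (dist (\<gamma> x) (\<gamma> y)) + poly_len \<gamma> (y # ts)"
  by (simp_all add: poly_len_def sum.lessThan_Suc_shift del: sum.lessThan_Suc)

lemma poly_len_Cons_ge: "poly_len \<gamma> ts \<le> poly_len \<gamma> (x # ts)"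
  by (cases ts) auto

lemma poly_len_append_ge: "poly_len \<gamma> xs + poly_len \<gamma> ys \<le> poly_len \<gamma> (xs @ ys)"
proof (induction xs rule: induct_list012)
  case (2 x) then show ?case using poly_len_Cons_ge by simp
next
  case (3 x y zs) then show ?case by (simp add: add.assoc add_left_mono)
qed simp

lemma ennreal_dist_triangle:
  "ennreal (dist x z) \<le> ennreal (dist x y) + ennreal (dist y z)"
  by (metis dist_triangle ennreal_leI ennreal_plus zero_le_dist)

text \<open>By the triangle inequality an additional vertex \<open>b\<close> at the junction can
  only lengthen the polygon. With \<open>poly_len_append_ge\<close> this yields additivity of
  length.\<close>

lemma poly_len_append_le:
  "poly_len \<gamma> (xs @ ys) \<le> poly_len \<gamma> (xs @ [b]) + poly_len \<gamma> (b # ys)"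
proof (induction xs rule: induct_list012)
  case 1 then show ?case using poly_len_Cons_ge by simp
next
  case (2 x) show ?case
  proof (cases ys)
    case (Cons y zs)
    have "ennreal (dist (\<gamma> x) (\<gamma> y)) + poly_len \<gamma> (y # zs)
      \<le> ennreal (dist (\<gamma> x) (\<gamma> b)) + ennreal (dist (\<gamma> b) (\<gamma> y)) + poly_len \<gamma> (y # zs)"
      by (intro add_right_mono ennreal_dist_triangle)
    then show ?thesis using Cons by (simp add: add.assoc)
  qed simp
next
  case (3 x y zs) then show ?case by (simp add: add.assoc add_left_mono)
qed

lemma path_len_eq_SUP:
  "path_len \<gamma> a b = (SUP ts\<in>{ts. sorted ts \<and> set ts \<subseteq> {a..b}}. poly_len \<gamma> ts)"
  by (simp add: path_len_def poly_len_def)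

lemma poly_len_le_path_len: "sorted ts \<Longrightarrow> set ts \<subseteq> {a..b} \<Longrightarrow> poly_len \<gamma> ts \<le> path_len \<gamma> a b"
  unfolding path_len_eq_SUP by (rule SUP_upper) auto

lemma path_len_mono: "{a..b} \<subseteq> {c..d} \<Longrightarrow> path_len \<gamma> a b \<le> path_len \<gamma> c d"
  unfolding path_len_eq_SUP by (rule SUP_subset_mono) auto

lemma dist_le_path_len: "a \<le> b \<Longrightarrow> ennreal (dist (\<gamma> a) (\<gamma> b)) \<le> path_len \<gamma> a b"
  using poly_len_le_path_len[of "[a, b]" a b \<gamma>] by simp

lemma sorted_split:
  fixes ts :: "real list"
  assumes "sorted ts"
  shows "ts = filter (\<lambda>x. x \<le> b) ts @ filter (\<lambda>x. \<not> x \<le> b) ts"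
  using assms
proof (induction ts)
  case (Cons x ts)
  show ?case
  proof (cases "x \<le> b")
    case False
    with Cons.prems have "filter (\<lambda>x. x \<le> b) ts = []" "filter (\<lambda>x. \<not> x \<le> b) ts = ts"
      by (fastforce simp: filter_empty_conv filter_id_conv)+
    then show ?thesis using False by simp
  qed (use Cons in simp)
qed simp

lemma poly_len_split:
  assumes "sorted ts"
  shows "poly_len \<gamma> ts \<le> poly_len \<gamma> (filter (\<lambda>x. x \<le> b) ts @ [b]) + poly_len \<gamma> (b # filter (\<lambda>x. \<not> x \<le> b) ts)"
  using poly_len_append_le[of \<gamma> "filter (\<lambda>x. x \<le> b) ts" "filter (\<lambda>x. \<not> x \<le> b) ts" b]
    sorted_split[OF assms, of b] by simp

lemma poly_len_left_le:
  assumes "sorted ts" "set ts \<subseteq> {a..c}" "a \<le> b"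
  shows "poly_len \<gamma> (filter (\<lambda>x. x \<le> b) ts @ [b]) \<le> path_len \<gamma> a b"
  using assms by (intro poly_len_le_path_len) (auto simp: sorted_append sorted_wrt_filter)

lemma poly_len_right_le:
  assumes "sorted ts" "set ts \<subseteq> {a..c}" "b \<le> c"
  shows "poly_len \<gamma> (b # filter (\<lambda>x. \<not> x \<le> b) ts) \<le> path_len \<gamma> b c"
  using assms by (intro poly_len_le_path_len) (auto simp: sorted_wrt_filter)

lemma path_len_add:
  assumes "a \<le> b" "b \<le> c"
  shows "path_len \<gamma> a c = path_len \<gamma> a b + path_len \<gamma> b c"
proof (rule antisym)
  show "path_len \<gamma> a c \<le> path_len \<gamma> a b + path_len \<gamma> b c"
    unfolding path_len_eq_SUP[of \<gamma> a c]
  proof (rule SUP_least)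
    fix ts assume "ts \<in> {ts. sorted ts \<and> set ts \<subseteq> {a..c}}"
    then have ts: "sorted ts" "set ts \<subseteq> {a..c}" by auto
    show "poly_len \<gamma> ts \<le> path_len \<gamma> a b + path_len \<gamma> b c"
      by (rule order_trans[OF poly_len_split[OF ts(1), of \<gamma> b]])
        (intro add_mono poly_len_left_le[OF ts] poly_len_right_le[OF ts] assms)
  qed
  have *: "poly_len \<gamma> xs + poly_len \<gamma> ys \<le> path_len \<gamma> a c"
    if "sorted xs" "set xs \<subseteq> {a..b}" "sorted ys" "set ys \<subseteq> {b..c}" for xs ys
  proof -
    have "\<forall>x\<in>set xs. x \<le> b" "\<forall>y\<in>set ys. b \<le> y" using that by auto
    then have "sorted (xs @ ys)" using that(1,3) by (auto simp: sorted_append intro: order_trans)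
    moreover have "set (xs @ ys) \<subseteq> {a..c}"
      using that(2,4) assms by auto
    ultimately have "poly_len \<gamma> (xs @ ys) \<le> path_len \<gamma> a c"
      by (rule poly_len_le_path_len)
    with poly_len_append_ge show ?thesis by (rule order_trans)
  qed
  \<comment> \<open>A summand can be drawn into a supremum in \<open>ennreal\<close> over a nonempty
    index set; the empty list is a member.\<close>
  have ne: "{ts::real list. sorted ts \<and> set ts \<subseteq> {u..v}} \<noteq> {}" for u v
    by (auto intro: exI[of _ "[]"])
  have "path_len \<gamma> a b + poly_len \<gamma> ys \<le> path_len \<gamma> a c" if "sorted ys" "set ys \<subseteq> {b..c}" for ys
    unfolding path_len_eq_SUP[of \<gamma> a b] ennreal_SUP_add_left[symmetric, OF ne]
    using * that by (auto intro!: SUP_least)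
  then have "path_len \<gamma> b c + path_len \<gamma> a b \<le> path_len \<gamma> a c"
    unfolding path_len_eq_SUP[of \<gamma> b c] ennreal_SUP_add_left[symmetric, OF ne]
    by (auto intro!: SUP_least simp: add.commute)
  then show "path_len \<gamma> a b + path_len \<gamma> b c \<le> path_len \<gamma> a c"
    by (simp add: add.commute)
qed

section \<open>Continuity of length\<close>

lemma path_len_approx:
  assumes "path_len \<gamma> a b \<noteq> \<infinity>" "0 < e"
  obtains ts where "sorted ts" "set ts \<subseteq> {a..b}" "path_len \<gamma> a b < poly_len \<gamma> ts + ennreal e"
proof -
  have "{ts::real list. sorted ts \<and> set ts \<subseteq> {a..b}} \<noteq> {}"
    by (auto intro: exI[of _ "[]"])
  then show ?thesis
    using SUP_approx_ennreal[of e "{ts. sorted ts \<and> set ts \<subseteq> {a..b}}" "path_len \<gamma> a b" "poly_len \<gamma>"]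
      assms that by (auto simp: path_len_eq_SUP)
qed

text \<open>All vertices but the last (or the first) are the same parameter, so at most one edge has
  positive length. This applies to the vertices of a partition between \<open>t\<close> and a nearby
  \<open>s\<close>.\<close>

lemma poly_len_const:
  assumes "\<forall>x\<in>set xs. x = t"
  shows "poly_len \<gamma> (xs @ [s]) \<le> ennreal (dist (\<gamma> t) (\<gamma> s))" "poly_len \<gamma> (s # xs) \<le> ennreal (dist (\<gamma> s) (\<gamma> t))"
proof -
  have 0: "poly_len \<gamma> xs = 0" if "\<forall>x\<in>set xs. x = t" for xs
    using that by (induction xs rule: induct_list012) auto
  show "poly_len \<gamma> (xs @ [s]) \<le> ennreal (dist (\<gamma> t) (\<gamma> s))"
    using assms by (induction xs rule: induct_list012) auto
  show "poly_len \<gamma> (s # xs) \<le> ennreal (dist (\<gamma> s) (\<gamma> t))"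
    using assms 0[of xs] by (cases xs) auto
qed

text \<open>A partition of [t, b] within e/2 of the full length has no vertex other than
  \<open>t\<close> between \<open>t\<close> and a close \<open>s\<close>, so up to \<open>s\<close>
  it contributes at most one edge of length below e/2. Hence all but \<open>e\<close> of the length
  lies beyond \<open>s\<close>. The left side is symmetric.\<close>

lemma path_len_small:
  assumes \<gamma>: "continuous_on {a..b} \<gamma>" and fin: "path_len \<gamma> a b \<noteq> \<infinity>" and t: "t \<in> {a..b}" and "0 < e"
  obtains d where "0 < d" "\<And>s. s \<in> {a..b} \<Longrightarrow> t \<le> s \<Longrightarrow> s < t + d \<Longrightarrow> path_len \<gamma> t s \<le> ennreal e"
    "\<And>s. s \<in> {a..b} \<Longrightarrow> s \<le> t \<Longrightarrow> t - d < s \<Longrightarrow> path_len \<gamma> s t \<le> ennreal e"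
proof -
  obtain d0 where d0: "0 < d0" "\<And>s. s \<in> {a..b} \<Longrightarrow> \<bar>s - t\<bar> < d0 \<Longrightarrow> dist (\<gamma> s) (\<gamma> t) < e / 2"
    using \<gamma>[unfolded continuous_on_iff, rule_format, OF t, of "e/2"] \<open>0 < e\<close> by (auto simp: dist_real_def)
  have fin1: "path_len \<gamma> t b \<noteq> \<infinity>" "path_len \<gamma> a t \<noteq> \<infinity>"
    using fin path_len_add[of a t b \<gamma>] t by auto
  obtain ts where ts: "sorted ts" "set ts \<subseteq> {t..b}" "path_len \<gamma> t b < poly_len \<gamma> ts + ennreal (e/2)"
    using path_len_approx[OF fin1(1), of "e/2"] \<open>0 < e\<close> by auto
  obtain us where us: "sorted us" "set us \<subseteq> {a..t}" "path_len \<gamma> a t < poly_len \<gamma> us + ennreal (e/2)"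
    using path_len_approx[OF fin1(2), of "e/2"] \<open>0 < e\<close> by auto
  \<comment> \<open>A radius around \<open>t\<close> that is free of all other vertices of both
    partitions.\<close>
  have "\<exists>d>0. \<forall>x\<in>(set ts \<union> set us) - {t}. d \<le> dist t x"
    using finite_set_avoid[of "set ts \<union> set us" t] by auto
  then obtain d1 where d1: "0 < d1" "\<And>x. x \<in> set ts \<union> set us \<Longrightarrow> x \<noteq> t \<Longrightarrow> d1 \<le> \<bar>t - x\<bar>"
    by (auto simp: dist_real_def)
  show thesis
  proof
    show "0 < min d0 d1" using d0 d1 by simp
    fix s assume s: "s \<in> {a..b}" 
    have half: "ennreal (e/2) + ennreal (e/2) = ennreal e"
      using \<open>0 < e\<close> by (subst ennreal_plus[symmetric]) auto
    have right: "path_len \<gamma> t s \<le> ennreal e" if st: "t \<le> s" "s < t + min d0 d1"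
    proof -
      have "\<forall>x\<in>set (filter (\<lambda>x. x \<le> s) ts). x = t"
        using ts(2) d1(2) st by fastforce
      then have "poly_len \<gamma> ts \<le> ennreal (dist (\<gamma> t) (\<gamma> s)) + path_len \<gamma> s b"
        using poly_len_split[OF ts(1), of \<gamma> s] poly_len_const(1) 
          poly_len_right_le[OF ts(1,2), of s \<gamma>] s by (meson add_mono order_trans atLeastAtMost_iff)
      then have "poly_len \<gamma> ts + ennreal (e/2) \<le> ennreal (dist (\<gamma> t) (\<gamma> s)) + path_len \<gamma> s b + ennreal (e/2)"
        by (rule add_right_mono)
      with less_imp_le[OF ts(3)] have "path_len \<gamma> t b \<le> ennreal (dist (\<gamma> t) (\<gamma> s)) + path_len \<gamma> s b + ennreal (e/2)"
        by (rule order_trans)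
      also have "\<dots> \<le> ennreal (e/2) + path_len \<gamma> s b + ennreal (e/2)"
        using d0(2)[OF s] st by (intro add_right_mono ennreal_leI) (auto simp: dist_commute less_imp_le)
      also have "\<dots> = ennreal e + path_len \<gamma> s b"
        by (simp add: half[symmetric] ac_simps)
      \<comment> \<open>The term \<open>path_len \<gamma> s b\<close> is cancelled; in
        \<open>ennreal\<close> this rests on its finiteness, which comes from
        \<open>fin1\<close>.\<close>
      finally show ?thesis
        using fin1(1) path_len_add[of t s b \<gamma>] st s by (auto simp: ennreal_add_left_cancel_le add.commute)
    qed
    then show "t \<le> s \<Longrightarrow> s < t + min d0 d1 \<Longrightarrow> path_len \<gamma> t s \<le> ennreal e" .
    { assume st: "s \<le> t" "t - min d0 d1 < s"
      show "path_len \<gamma> s t \<le> ennreal e"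
      proof (cases "s = t")
        case True
        then show ?thesis using right st s d0(1) d1(1) by simp
      next
        case False
        have "\<forall>x\<in>set (filter (\<lambda>x. \<not> x \<le> s) us). x = t"
          using us(2) d1(2) st by fastforce
        then have "poly_len \<gamma> us \<le> path_len \<gamma> a s + ennreal (dist (\<gamma> s) (\<gamma> t))"
          using poly_len_split[OF us(1), of \<gamma> s] poly_len_const(2) 
            poly_len_left_le[OF us(1,2), of s \<gamma>] s by (meson add_mono order_trans atLeastAtMost_iff)
        then have "poly_len \<gamma> us + ennreal (e/2) \<le> path_len \<gamma> a s + ennreal (dist (\<gamma> s) (\<gamma> t)) + ennreal (e/2)"
          by (rule add_right_mono)
        with less_imp_le[OF us(3)] have "path_len \<gamma> a t \<le> path_len \<gamma> a s + ennreal (dist (\<gamma> s) (\<gamma> t)) + ennreal (e/2)"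
          by (rule order_trans)
        also have "\<dots> \<le> path_len \<gamma> a s + ennreal (e/2) + ennreal (e/2)"
          using d0(2)[OF s] st by (intro add_right_mono add_left_mono ennreal_leI) (auto simp: less_imp_le)
        also have "\<dots> = path_len \<gamma> a s + ennreal e"
          by (simp add: half[symmetric] ac_simps)
        finally show ?thesis
          using fin1(2) path_len_add[of a s t \<gamma>] st s by (auto simp: ennreal_add_left_cancel_le)
      qed }
  qed
qed

lemma path_len_affine:
  assumes "0 < (c::real)"
  shows "path_len (\<lambda>\<tau>. \<gamma> (c * \<tau> + a)) x y = path_len \<gamma> (c * x + a) (c * y + a)"
proof -
  have 1: "path_len (\<lambda>\<tau>. \<gamma> (c * \<tau> + a)) x y \<le> path_len \<gamma> (c * x + a) (c * y + a)"
    if "0 < c" for c a x y :: real and \<gamma> :: "real \<Rightarrow> 'a"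
    unfolding path_len_eq_SUP[of _ x y]
  proof (rule SUP_least)
    fix ts assume ts: "ts \<in> {ts. sorted ts \<and> set ts \<subseteq> {x..y}}"
    have "poly_len (\<lambda>\<tau>. \<gamma> (c * \<tau> + a)) ts = poly_len \<gamma> (map (\<lambda>\<tau>. c * \<tau> + a) ts)"
      by (induction ts rule: induct_list012) auto
    also have "\<dots> \<le> path_len \<gamma> (c * x + a) (c * y + a)"
      using ts that
      by (intro poly_len_le_path_len) (auto simp: sorted_map elim: sorted_wrt_mono_rel[rotated])
    finally show "poly_len (\<lambda>\<tau>. \<gamma> (c * \<tau> + a)) ts \<le> path_len \<gamma> (c * x + a) (c * y + a)" .
  qed
  \<comment> \<open>The reverse inequality is the first one for the inverse parameter
    change.\<close>
  have "path_len \<gamma> (c * x + a) (c * y + a) \<le> path_len (\<lambda>\<tau>. \<gamma> (c * \<tau> + a)) x y"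
    using 1[of "1/c" "\<lambda>\<tau>. \<gamma> (c * \<tau> + a)" "-a/c" "c * x + a" "c * y + a"] assms
    by (simp add: field_simps)
  then show ?thesis using 1[OF assms] by (intro antisym)
qed


text \<open>The library's \<open>subpath\<close> is restricted to normed vector spaces.\<close>

definition path_piece :: "real \<Rightarrow> real \<Rightarrow> (real \<Rightarrow> 'x) \<Rightarrow> real \<Rightarrow> 'x" where
  "path_piece a b \<gamma> = (\<lambda>\<tau>. \<gamma> ((b - a) * \<tau> + a))"

lemma path_piece_param:
  assumes "(a::real) \<le> b" "\<tau> \<in> {0..1}"
  shows "(b - a) * \<tau> + a \<in> {a..b}"
proof -
  have "(b - a) * \<tau> \<le> (b - a) * 1" using assms by (intro mult_left_mono) auto
  then show ?thesis using assms by simp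
qed

lemma path_path_piece:
  assumes "path \<gamma>" "0 \<le> a" "a \<le> b" "b \<le> 1"
  shows "path (path_piece a b \<gamma>)"
proof -
  have "continuous_on ((\<lambda>\<tau>. (b - a) * \<tau> + a) ` {0..1}) \<gamma>"
    using assms(1) unfolding path_def
    by (rule continuous_on_subset) (use path_piece_param[OF assms(3)] assms in fastforce)
  then show ?thesis
    unfolding path_def path_piece_def
    by (rule continuous_on_compose2[of _ \<gamma>]) (auto intro!: continuous_intros)
qed

section \<open>Parametrization by arc length\<close>

definition arc_len :: "(real \<Rightarrow> 'x::metric_space) \<Rightarrow> real \<Rightarrow> real" where
  "arc_len \<gamma> t = enn2real (path_len \<gamma> 0 t)"

context
  fixes \<gamma> :: "real \<Rightarrow> 'x::metric_space"
  assumes path: "path \<gamma>" and rect: "path_len \<gamma> 0 1 < \<infinity>"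
begin

lemma path_len_arc_len: "t \<in> {0..1} \<Longrightarrow> path_len \<gamma> 0 t = ennreal (arc_len \<gamma> t)"
proof -
  assume "t \<in> {0..1}"
  then have "path_len \<gamma> 0 t \<le> path_len \<gamma> 0 1" by (intro path_len_mono) auto
  with rect have "path_len \<gamma> 0 t < \<infinity>" by (rule order.strict_trans1[rotated])
  then show ?thesis by (simp add: arc_len_def)
qed

lemma arc_len_nonneg: "0 \<le> arc_len \<gamma> t"
  by (simp add: arc_len_def)

text \<open>Additivity on the degenerate interval gives \<open>l = l + l\<close> for the length
  \<open>l\<close>, which is finite.\<close>

lemma arc_len_0: "arc_len \<gamma> 0 = 0"
proof -
  have "ennreal (arc_len \<gamma> 0) = ennreal (arc_len \<gamma> 0) + ennreal (arc_len \<gamma> 0)"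
    using path_len_add[of 0 0 0 \<gamma>] path_len_arc_len[of 0] by simp
  also have "\<dots> = ennreal (arc_len \<gamma> 0 + arc_len \<gamma> 0)"
    using arc_len_nonneg by (intro ennreal_plus[symmetric]) auto
  finally show ?thesis using arc_len_nonneg[of 0] by (subst (asm) ennreal_inj) auto
qed

lemma arc_len_mono:
  assumes "0 \<le> a" "a \<le> b" "b \<le> 1"
  shows "arc_len \<gamma> a \<le> arc_len \<gamma> b"
proof -
  have "ennreal (arc_len \<gamma> a) \<le> ennreal (arc_len \<gamma> b)"
    using path_len_mono[of 0 a 0 b \<gamma>] path_len_arc_len[of a] path_len_arc_len[of b] assms by simp
  then show ?thesis using arc_len_nonneg by (simp add: ennreal_le_iff)
qed

lemma path_len_diff:
  assumes "0 \<le> a" "a \<le> b" "b \<le> 1"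
  shows "path_len \<gamma> a b = ennreal (arc_len \<gamma> b - arc_len \<gamma> a)"
proof -
  have nn: "0 \<le> arc_len \<gamma> a" by (simp add: arc_len_def)
  have "ennreal (arc_len \<gamma> b) = ennreal (arc_len \<gamma> a) + path_len \<gamma> a b"
    using path_len_add[of 0 a b \<gamma>] path_len_arc_len[of a] path_len_arc_len[of b] assms by simp
  then have "path_len \<gamma> a b = ennreal (arc_len \<gamma> b) - ennreal (arc_len \<gamma> a)"
    by simp
  then show ?thesis using nn by (simp add: ennreal_minus)
qed

lemma dist_le_arc_len:
  assumes "0 \<le> a" "a \<le> b" "b \<le> 1"
  shows "dist (\<gamma> a) (\<gamma> b) \<le> arc_len \<gamma> b - arc_len \<gamma> a"
  using dist_le_path_len[OF assms(2), of \<gamma>] path_len_diff[OF assms] arc_len_mono[OF assms]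
  by (simp add: ennreal_le_iff)

lemma continuous_on_arc_len: "continuous_on {0..1} (arc_len \<gamma>)"
  unfolding continuous_on_iff
proof (intro ballI allI impI)
  fix t e :: real assume t: "t \<in> {0..1}" and "0 < e"
  obtain d where d: "0 < d" "\<And>s. s \<in> {0..1} \<Longrightarrow> t \<le> s \<Longrightarrow> s < t + d \<Longrightarrow> path_len \<gamma> t s \<le> ennreal (e/2)"
    "\<And>s. s \<in> {0..1} \<Longrightarrow> s \<le> t \<Longrightarrow> t - d < s \<Longrightarrow> path_len \<gamma> s t \<le> ennreal (e/2)"
    by (rule path_len_small[of 0 1 \<gamma> t "e/2"]) (use path rect t \<open>0 < e\<close> in \<open>auto simp: path_def\<close>)
  have "dist (arc_len \<gamma> s) (arc_len \<gamma> t) < e" if s: "s \<in> {0..1}" "dist s t < d" for s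
  proof (cases "t \<le> s")
    case True
    have "path_len \<gamma> t s \<le> ennreal (e/2)" using d(2)[OF s(1)] True s(2) by (auto simp: dist_real_def)
    then have "arc_len \<gamma> s - arc_len \<gamma> t \<le> e/2"
      using path_len_diff[of t s] True s t \<open>0 < e\<close> by (simp add: ennreal_le_iff)
    then show ?thesis using arc_len_mono[of t s] True s t \<open>0 < e\<close> by (auto simp: dist_real_def)
  next
    case False
    have "path_len \<gamma> s t \<le> ennreal (e/2)" using d(3)[OF s(1)] False s(2) by (auto simp: dist_real_def)
    then have "arc_len \<gamma> t - arc_len \<gamma> s \<le> e/2"
      using path_len_diff[of s t] False s t \<open>0 < e\<close> by (simp add: ennreal_le_iff)
    then show ?thesis using arc_len_mono[of s t] False s t \<open>0 < e\<close> by (auto simp: dist_real_def)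
  qed
  then show "\<exists>d>0. \<forall>s\<in>{0..1}. dist s t < d \<longrightarrow> dist (arc_len \<gamma> s) (arc_len \<gamma> t) < e"
    using d(1) by blast
qed

lemma arc_len_surj:
  assumes "0 \<le> s" "s \<le> arc_len \<gamma> 1"
  obtains t where "t \<in> {0..1}" "arc_len \<gamma> t = s"
  using IVT'[of "arc_len \<gamma>" 0 s 1] assms continuous_on_arc_len arc_len_0 that by auto

lemma arc_param_arc_len:
  assumes t: "t \<in> {0..1}"
  shows "arc_param \<gamma> (arc_len \<gamma> t) = \<gamma> t"
proof -
  define t' where "t' = (SOME t'. t' \<in> {0..1} \<and> path_len \<gamma> 0 t' = ennreal (arc_len \<gamma> t))"
  have "t' \<in> {0..1} \<and> path_len \<gamma> 0 t' = ennreal (arc_len \<gamma> t)"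
    unfolding t'_def by (rule someI[of _ t]) (use t path_len_arc_len in auto)
  then have t': "t' \<in> {0..1}" "arc_len \<gamma> t' = arc_len \<gamma> t"
    by (auto simp: arc_len_def)
  have "dist (\<gamma> t') (\<gamma> t) \<le> 0"
  proof (cases "t \<le> t'")
    case True
    then have "dist (\<gamma> t) (\<gamma> t') \<le> arc_len \<gamma> t' - arc_len \<gamma> t"
      using t t'(1) by (intro dist_le_arc_len) auto
    then show ?thesis unfolding t'(2) by (simp add: dist_commute)
  next
    case False
    then have "dist (\<gamma> t') (\<gamma> t) \<le> arc_len \<gamma> t - arc_len \<gamma> t'"
      using t t'(1) by (intro dist_le_arc_len) auto
    then show ?thesis unfolding t'(2) by simp
  qed
  then have "\<gamma> t' = \<gamma> t" by simp
  then show ?thesis by (simp add: arc_param_def t'_def)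
qed

lemma arc_param_lipschitz: "1-lipschitz_on {0..arc_len \<gamma> 1} (arc_param \<gamma>)"
proof (rule lipschitz_onI)
  fix x y assume "x \<in> {0..arc_len \<gamma> 1}" "y \<in> {0..arc_len \<gamma> 1}"
  then obtain s t where st: "s \<in> {0..1}" "arc_len \<gamma> s = x" "t \<in> {0..1}" "arc_len \<gamma> t = y"
    by (metis arc_len_surj atLeastAtMost_iff)
  then have "dist (\<gamma> s) (\<gamma> t) \<le> \<bar>arc_len \<gamma> s - arc_len \<gamma> t\<bar>"
    using dist_le_arc_len[of s t] dist_le_arc_len[of t s] by (cases "s \<le> t") (auto simp: dist_commute)
  then show "dist (arc_param \<gamma> x) (arc_param \<gamma> y) \<le> 1 * dist x y"
    using st arc_param_arc_len[of s] arc_param_arc_len[of t] by (simp add: dist_real_def)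
qed simp

text \<open>The length travelled along the piece is a difference of values of
  \<open>arc_len\<close>, so the arc-length parametrization of the piece is that of \<gamma> shifted
  by \<open>arc_len \<gamma> a\<close>. The choice made inside \<open>arc_param\<close> is absorbed
  by \<open>arc_param_arc_len\<close>.\<close>

lemma path_piece_arc:
  assumes ab: "0 \<le> a" "a < b" "b \<le> 1" and neq: "arc_len \<gamma> a < arc_len \<gamma> b"
  shows "path_len (path_piece a b \<gamma>) 0 1 = ennreal (arc_len \<gamma> b - arc_len \<gamma> a)"
    and "0 \<le> s \<Longrightarrow> s \<le> arc_len \<gamma> b - arc_len \<gamma> a \<Longrightarrow>
      arc_param (path_piece a b \<gamma>) s = arc_param \<gamma> (s + arc_len \<gamma> a)"
proof -
  have sub: "path_len (path_piece a b \<gamma>) x y = path_len \<gamma> ((b - a) * x + a) ((b - a) * y + a)" for x y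
    unfolding path_piece_def using path_len_affine[of "b - a" \<gamma> a x y] ab by simp
  have inn: "(b - a) * x + a \<in> {a..b}" if "x \<in> {0..1}" for x
    using path_piece_param[of a b x] that ab by simp
  have len: "path_len (path_piece a b \<gamma>) 0 x = ennreal (arc_len \<gamma> ((b - a) * x + a) - arc_len \<gamma> a)"
    if "x \<in> {0..1}" for x
    using sub[of 0 x] inn[OF that] ab path_len_diff[of a "(b - a) * x + a"] by simp
  show "path_len (path_piece a b \<gamma>) 0 1 = ennreal (arc_len \<gamma> b - arc_len \<gamma> a)"
    using len[of 1] by simp
  assume s: "0 \<le> s" "s \<le> arc_len \<gamma> b - arc_len \<gamma> a"
  have cont: "continuous_on {a..b} (arc_len \<gamma>)"
    using continuous_on_arc_len by (rule continuous_on_subset) (use ab in auto)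
  obtain t where t: "a \<le> t" "t \<le> b" "arc_len \<gamma> t = s + arc_len \<gamma> a"
    using IVT'[of "arc_len \<gamma>" a "s + arc_len \<gamma> a" b] cont s ab by auto
  define x where "x = (SOME x. x \<in> {0..1} \<and> path_len (path_piece a b \<gamma>) 0 x = ennreal s)"
  have "x \<in> {0..1} \<and> path_len (path_piece a b \<gamma>) 0 x = ennreal s"
    unfolding x_def
  proof (rule someI)
    have x: "(t - a) / (b - a) \<in> {0..1}" using t ab by (auto simp: divide_simps)
    moreover have "(b - a) * ((t - a) / (b - a)) + a = t" using ab by simp
    ultimately show "(t - a) / (b - a) \<in> {0..1} \<and> path_len (path_piece a b \<gamma>) 0 ((t - a) / (b - a)) = ennreal s"
      using len[OF x] t by simp
  qed
  then have x: "x \<in> {0..1}" "arc_len \<gamma> ((b - a) * x + a) = s + arc_len \<gamma> a"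
    using len[of x] s inn[of x] arc_len_mono[of a "(b - a) * x + a"] ab by auto
  have "arc_param (path_piece a b \<gamma>) s = \<gamma> ((b - a) * x + a)"
    by (simp add: arc_param_def x_def path_piece_def)
  also have "\<dots> = arc_param \<gamma> (s + arc_len \<gamma> a)"
    using arc_param_arc_len[of "(b - a) * x + a"] x inn[OF x(1)] ab by simp
  finally show "arc_param (path_piece a b \<gamma>) s = arc_param \<gamma> (s + arc_len \<gamma> a)" .
qed

end

text \<open>The indicator confines the function to [0, l], where \<sigma> is continuous; outside
  that interval the values of \<open>arc_param\<close> are arbitrary choices.\<close>

lemma borel_measurable_on_path:
  fixes \<sigma> :: "real \<Rightarrow> 'x::topological_space" and g :: "'x \<Rightarrow> ennreal"
  assumes "continuous_on {0..l} \<sigma>" "g \<in> borel_measurable borel" "A \<in> sets borel" "A \<subseteq> {0..l}"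
  shows "(\<lambda>s. g (\<sigma> s) * indicator A s) \<in> borel_measurable borel"
proof -
  have "continuous_on A \<sigma>" using assms(1,4) by (rule continuous_on_subset)
  then have "\<sigma> \<in> borel_measurable (restrict_space borel A)"
    using assms(3) by (intro borel_measurable_continuous_on_restrict)
  then have "(\<lambda>s. g (\<sigma> s)) \<in> borel_measurable (restrict_space borel A)"
    using assms(2) by (rule measurable_compose)
  then show ?thesis
    using assms(3) by (subst (asm) borel_measurable_restrict_space_iff_ennreal) auto
qed

text \<open>The interface to paths for all that follows: a path becomes a 1-Lipschitz map on an
  interval, path integrals become Lebesgue integrals, and every piece is again a rectifiable path,
  in any set \<Omega>' that contains its image. Integrals over pieces are described for Borel
  functions because the shift is a change of variables.\<close>

lemma rect_path_arc:
  fixes \<gamma> :: "real \<Rightarrow> 'x::metric_space"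
  assumes \<gamma>: "\<gamma> \<in> rect_paths \<Omega>"
  obtains l :: real and \<sigma> :: "real \<Rightarrow> 'x" where "0 < l" "\<sigma> 0 = pathstart \<gamma>" "\<sigma> l = pathfinish \<gamma>" "\<sigma> ` {0..l} \<subseteq> \<Omega>"
    "1-lipschitz_on {0..l} \<sigma>"
    "\<And>g. path_integral g \<gamma> = (\<integral>\<^sup>+s\<in>{0..l}. g (\<sigma> s) \<partial>lborel)"
    "\<And>\<Omega>' a b. 0 \<le> a \<Longrightarrow> a < b \<Longrightarrow> b \<le> l \<Longrightarrow> \<sigma> ` {a..b} \<subseteq> \<Omega>' \<Longrightarrow>
       \<exists>\<gamma>'\<in>rect_paths \<Omega>'. pathstart \<gamma>' = \<sigma> a \<and> pathfinish \<gamma>' = \<sigma> b \<and>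
         (\<forall>g\<in>borel_measurable borel. path_integral g \<gamma>' = (\<integral>\<^sup>+s\<in>{a..b}. g (\<sigma> s) \<partial>lborel))"
proof -
  define l where "l = arc_len \<gamma> 1"
  define \<sigma> where "\<sigma> = arc_param \<gamma>"
  have path: "path \<gamma>" and im: "path_image \<gamma> \<subseteq> \<Omega>" and nc: "\<not> \<gamma> constant_on {0..1}"
    and rect: "path_len \<gamma> 0 1 < \<infinity>"
    using \<gamma> by (auto simp: rect_paths_def)
  have \<sigma>: "\<sigma> (arc_len \<gamma> t) = \<gamma> t" if "t \<in> {0..1}" for t
    unfolding \<sigma>_def by (rule arc_param_arc_len[OF path rect that])
  have surj: "\<exists>t\<in>{0..1}. arc_len \<gamma> t = s" if "0 \<le> s" "s \<le> l" for s
    using arc_len_surj[OF path rect] that unfolding l_def by metis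
  have lip: "1-lipschitz_on {0..l} \<sigma>"
    unfolding \<sigma>_def l_def by (rule arc_param_lipschitz[OF path rect])
  \<comment> \<open>Length zero would force a constant path, which \<open>rect_paths\<close>
    excludes.\<close>
  have "l \<noteq> 0"
  proof
    assume "l = 0"
    have "\<gamma> t = \<gamma> 0" if t: "t \<in> {0..1}" for t
    proof -
      have "arc_len \<gamma> t \<le> 0"
        using arc_len_mono[OF path rect, of t 1] t \<open>l = 0\<close> by (simp add: l_def)
      moreover have "dist (\<gamma> 0) (\<gamma> t) \<le> arc_len \<gamma> t - arc_len \<gamma> 0"
        using t by (intro dist_le_arc_len[OF path rect]) auto
      ultimately have "dist (\<gamma> 0) (\<gamma> t) \<le> 0"
        using arc_len_0[OF path rect] by linarith
      then show ?thesis by simp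
    qed
    then have "\<gamma> constant_on {0..1}" unfolding constant_on_def by blast
    with nc show False by contradiction
  qed
  moreover have "0 \<le> l" by (simp add: l_def arc_len_def)
  ultimately have l: "0 < l" by simp
  show thesis
  proof (rule that[of l \<sigma>])
    show "0 < l" by fact
    show "\<sigma> 0 = pathstart \<gamma>" using \<sigma>[of 0] arc_len_0[OF path rect] by (simp add: pathstart_def)
    show "\<sigma> l = pathfinish \<gamma>" using \<sigma>[of 1] by (simp add: l_def pathfinish_def)
    show "\<sigma> ` {0..l} \<subseteq> \<Omega>"
    proof
      fix x assume "x \<in> \<sigma> ` {0..l}"
      then obtain s where s: "0 \<le> s" "s \<le> l" "x = \<sigma> s" by auto
      obtain t where t: "t \<in> {0..1}" "arc_len \<gamma> t = s" using surj[OF s(1,2)] by blast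
      have "x = \<gamma> t" unfolding s(3) t(2)[symmetric] by (rule \<sigma>[OF t(1)])
      with t(1) im show "x \<in> \<Omega>" unfolding path_image_def by blast
    qed
    show "1-lipschitz_on {0..l} \<sigma>" by fact
    show "path_integral g \<gamma> = (\<integral>\<^sup>+s\<in>{0..l}. g (\<sigma> s) \<partial>lborel)" for g
      by (simp add: path_integral_def l_def arc_len_def \<sigma>_def)
    fix \<Omega>' a b assume ab: "0 \<le> a" "a < b" "b \<le> l" and im': "\<sigma> ` {a..b} \<subseteq> \<Omega>'"
    obtain x where x: "x \<in> {0..1}" "arc_len \<gamma> x = a" using surj[of a] ab by auto
    obtain y where y: "y \<in> {0..1}" "arc_len \<gamma> y = b" using surj[of b] ab by auto
    have "x < y"
      using arc_len_mono[OF path rect, of y x] x y ab by (auto simp: not_le[symmetric])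
    note xy = path_piece_arc[OF path rect, of x y]
    define \<gamma>' where "\<gamma>' = path_piece x y \<gamma>"
    have len: "path_len \<gamma>' 0 1 = ennreal (b - a)"
      unfolding \<gamma>'_def using xy(1) x y ab \<open>x < y\<close> by auto
    have par: "arc_param \<gamma>' s = \<sigma> (s + a)" if "0 \<le> s" "s \<le> b - a" for s
      unfolding \<gamma>'_def \<sigma>_def using xy(2)[of s] x y ab \<open>x < y\<close> that by auto
    have pi: "path_integral g \<gamma>' = (\<integral>\<^sup>+s\<in>{a..b}. g (\<sigma> s) \<partial>lborel)"
      if g: "g \<in> borel_measurable borel" for g
    proof -
      have meas: "(\<lambda>s. g (\<sigma> s) * indicator {a..b} s) \<in> borel_measurable borel"
        using lip g ab by (intro borel_measurable_on_path[of l]) (auto intro: lipschitz_on_continuous_on)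
      have "path_integral g \<gamma>' = (\<integral>\<^sup>+s\<in>{0..b - a}. g (\<sigma> (a + s)) \<partial>lborel)"
        unfolding path_integral_def len using ab
        by (auto intro!: nn_integral_cong simp: par indicator_def add.commute)
      also have "\<dots> = (\<integral>\<^sup>+s\<in>{a..b}. g (\<sigma> s) \<partial>lborel)"
        by (subst nn_integral_real_affine[OF meas, of 1 a]) (auto intro!: nn_integral_cong simp: indicator_def)
      finally show ?thesis .
    qed
    have "path \<gamma>'" unfolding \<gamma>'_def using path x y \<open>x < y\<close> by (intro path_path_piece) auto
    moreover have "path_image \<gamma>' \<subseteq> \<Omega>'"
    proof -
      have "path_image \<gamma>' \<subseteq> \<gamma> ` {x..y}"
        unfolding \<gamma>'_def path_image_def path_piece_def using path_piece_param[of x y] \<open>x < y\<close> by fastforce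
      also have "\<dots> \<subseteq> \<sigma> ` {a..b}"
      proof
        fix z assume "z \<in> \<gamma> ` {x..y}"
        then obtain t where t: "x \<le> t" "t \<le> y" "z = \<gamma> t" by auto
        then have "arc_len \<gamma> t \<in> {a..b}" "z = \<sigma> (arc_len \<gamma> t)"
          using arc_len_mono[OF path rect, of x t] arc_len_mono[OF path rect, of t y] x y \<sigma>[of t] by auto
        then show "z \<in> \<sigma> ` {a..b}" by blast
      qed
      finally show ?thesis using im' by blast
    qed
    \<comment> \<open>A constant piece would have all polygonal lengths 0, against its length
      \<open>b - a\<close>.\<close>
    moreover have "\<not> \<gamma>' constant_on {0..1}"
    proof
      assume "\<gamma>' constant_on {0..1}"
      then obtain c where c: "\<And>t. t \<in> {0..1} \<Longrightarrow> \<gamma>' t = c" by (auto simp: constant_on_def)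
      have "poly_len \<gamma>' ts = 0" if "set ts \<subseteq> {0..1}" for ts
        using that by (induction ts rule: induct_list012) (auto simp: c)
      then have "path_len \<gamma>' 0 1 \<le> 0"
        unfolding path_len_eq_SUP by (intro SUP_least) auto
      then show False using len ab by simp
    qed
    ultimately have "\<gamma>' \<in> rect_paths \<Omega>'" using len by (auto simp: rect_paths_def)
    moreover have "pathstart \<gamma>' = \<sigma> a" "pathfinish \<gamma>' = \<sigma> b"
      using \<sigma>[OF x(1)] \<sigma>[OF y(1)] x y by (auto simp: \<gamma>'_def path_piece_def pathstart_def pathfinish_def)
    ultimately show "\<exists>\<gamma>'\<in>rect_paths \<Omega>'. pathstart \<gamma>' = \<sigma> a \<and> pathfinish \<gamma>' = \<sigma> b \<and>
         (\<forall>g\<in>borel_measurable borel. path_integral g \<gamma>' = (\<integral>\<^sup>+s\<in>{a..b}. g (\<sigma> s) \<partial>lborel))"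
      using pi by blast
  qed
qed

section \<open>Gluing estimates on an interval\<close>

text \<open>Half-open intervals make consecutive pieces disjoint, so the integrals add up
  exactly.\<close>

lemma set_nn_integral_Ioc_add:
  fixes f :: "real \<Rightarrow> ennreal"
  assumes "f \<in> borel_measurable borel" "a \<le> b" "b \<le> c"
  shows "(\<integral>\<^sup>+s\<in>{a<..c}. f s \<partial>lborel) = (\<integral>\<^sup>+s\<in>{a<..b}. f s \<partial>lborel) + (\<integral>\<^sup>+s\<in>{b<..c}. f s \<partial>lborel)"
proof -
  have "(\<integral>\<^sup>+s\<in>{a<..c}. f s \<partial>lborel) = (\<integral>\<^sup>+s. f s * indicator {a<..b} s + f s * indicator {b<..c} s \<partial>lborel)"
    using assms by (intro nn_integral_cong) (auto simp: indicator_def)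
  then show ?thesis using assms(1) by (simp add: nn_integral_add)
qed

lemma ennreal_abs_triangle:
  fixes x y z :: real
  assumes "ennreal \<bar>x - y\<bar> \<le> A" "ennreal \<bar>y - z\<bar> \<le> B"
  shows "ennreal \<bar>x - z\<bar> \<le> A + B"
proof -
  have "ennreal \<bar>x - z\<bar> \<le> ennreal (\<bar>x - y\<bar> + \<bar>y - z\<bar>)" by (intro ennreal_leI) linarith
  also have "\<dots> = ennreal \<bar>x - y\<bar> + ennreal \<bar>y - z\<bar>" by simp
  finally show ?thesis using add_mono[OF assms] by (rule order_trans)
qed

text \<open>Bisection in the form of \<open>Bolzano\<close> reduces the claim to short intervals.
  Between its first and last point in \<open>Z\<close> such an interval may leave \<open>Z\<close>,
  so \<open>H\<close> has to be charged on the whole neighbourhood \<open>O'\<close>; the excess on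
  \<open>O' - Z\<close> is made small later by shrinking \<open>O'\<close>.\<close>

lemma glue_open_cover:
  fixes f :: "real \<Rightarrow> real" and G H :: "real \<Rightarrow> ennreal"
  assumes G: "G \<in> borel_measurable borel" and H: "H \<in> borel_measurable borel"
    and fG: "\<And>a b. 0 \<le> a \<Longrightarrow> a \<le> b \<Longrightarrow> b \<le> l \<Longrightarrow> ennreal \<bar>f a - f b\<bar> \<le> (\<integral>\<^sup>+s\<in>{a<..b}. G s \<partial>lborel)"
    and Z: "compact Z" "Z \<subseteq> {0..l}" and O: "open O'" "Z \<subseteq> O'"
    and fH: "\<And>a b. a \<in> Z \<Longrightarrow> b \<in> Z \<Longrightarrow> a \<le> b \<Longrightarrow> {a..b} \<subseteq> O' \<Longrightarrow>
      ennreal \<bar>f a - f b\<bar> \<le> (\<integral>\<^sup>+s\<in>{a<..b}. H s \<partial>lborel)"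
    and l: "0 \<le> l"
  shows "ennreal \<bar>f 0 - f l\<bar> \<le>
    (\<integral>\<^sup>+s\<in>{0<..l}. G s * indicator (- Z) s + H s * indicator O' s \<partial>lborel)"
proof -
  define \<Psi> where "\<Psi> s = G s * indicator (- Z) s + H s * indicator O' s" for s
  have cl: "closed Z" using Z by (simp add: compact_imp_closed)
  note [measurable] = G H
  have [measurable]: "Z \<in> sets borel" "O' \<in> sets borel"
    using O cl by auto
  have [measurable]: "\<Psi> \<in> borel_measurable borel"
    unfolding \<Psi>_def by measurable
  define P where "P a b \<longleftrightarrow> (0 \<le> a \<and> a \<le> b \<and> b \<le> l \<longrightarrow>
    ennreal \<bar>f a - f b\<bar> \<le> (\<integral>\<^sup>+s\<in>{a<..b}. \<Psi> s \<partial>lborel))" for a b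
  \<comment> \<open>Off \<open>Z\<close> the integrand \<Psi> dominates \<open>G\<close>. The point
    \<open>a\<close> is excluded by the half-open interval, and \<open>b\<close>, which may lie in
    \<open>Z\<close>, is a null set.\<close>
  have off: "P a b" if "{a<..<b} \<inter> Z = {}" for a b
    unfolding P_def
  proof
    assume ab: "0 \<le> a \<and> a \<le> b \<and> b \<le> l"
    have "AE s in lborel. G s * indicator {a<..b} s \<le> \<Psi> s * indicator {a<..b} s"
      using AE_lborel_singleton[of b]
    proof eventually_elim
      case (elim s)
      with that have "s \<in> {a<..b} \<Longrightarrow> s \<notin> Z" by (auto simp: disjoint_iff)
      then show ?case by (auto simp: \<Psi>_def indicator_def)
    qed
    then have "(\<integral>\<^sup>+s\<in>{a<..b}. G s \<partial>lborel) \<le> (\<integral>\<^sup>+s\<in>{a<..b}. \<Psi> s \<partial>lborel)"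
      by (rule nn_integral_mono_AE)
    then show "ennreal \<bar>f a - f b\<bar> \<le> (\<integral>\<^sup>+s\<in>{a<..b}. \<Psi> s \<partial>lborel)"
      using fG[of a b] ab by (meson order_trans)
  qed
  have trans: "P a c" if "P a b" "P b c" "a \<le> b" "b \<le> c" for a b c
  proof -
    have "(\<integral>\<^sup>+s\<in>{a<..c}. \<Psi> s \<partial>lborel) = (\<integral>\<^sup>+s\<in>{a<..b}. \<Psi> s \<partial>lborel) + (\<integral>\<^sup>+s\<in>{b<..c}. \<Psi> s \<partial>lborel)"
      using that by (intro set_nn_integral_Ioc_add) auto
    then show ?thesis using that ennreal_abs_triangle[of "f a" "f b" _ "f c"] unfolding P_def by auto
  qed
  have on: "P a b" if ab: "a \<in> Z" "b \<in> Z" "a \<le> b" "{a..b} \<subseteq> O'" for a b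
  proof -
    have "(\<integral>\<^sup>+s\<in>{a<..b}. H s \<partial>lborel) \<le> (\<integral>\<^sup>+s\<in>{a<..b}. \<Psi> s \<partial>lborel)"
      using ab by (intro nn_integral_mono) (auto simp: \<Psi>_def indicator_def subset_iff)
    then show ?thesis using fH[OF ab] unfolding P_def by (meson order_trans)
  qed
  have "P 0 l"
    using l
  proof (induction rule: Bolzano)
    case (trans a b c) then show ?case using \<open>\<And>a b c. P a b \<Longrightarrow> P b c \<Longrightarrow> a \<le> b \<Longrightarrow> b \<le> c \<Longrightarrow> P a c\<close> by blast
  next
    case (local x)
    show ?case
    proof (cases "x \<in> Z")
      case False
      then obtain d where d: "0 < d" "ball x d \<subseteq> - Z"
        using cl open_contains_ball[of "- Z"] by (auto simp: closed_def)
      have "P a b" if "a \<le> x" "x \<le> b" "b - a < d" for a b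
        by (rule off) (use that d(2) in \<open>fastforce simp: subset_iff dist_real_def abs_if\<close>)
      then show ?thesis using d(1) by blast
    next
      case True
      then obtain d where d: "0 < d" "ball x d \<subseteq> O'"
        using O open_contains_ball[of O'] by blast
      have "P a b" if ab: "a \<le> x" "x \<le> b" "b - a < d" for a b
      proof -
        have sub: "{a..b} \<subseteq> O'" using ab d(2) by (force simp: subset_iff dist_real_def abs_if)
        \<comment> \<open>Compactness provides the first point \<open>c\<close> and the last point
          \<open>e\<close> of \<open>Z\<close> in [a, b]; the set is nonempty since it contains
          \<open>x\<close>.\<close>
        have K: "compact (Z \<inter> {a..b})" "Z \<inter> {a..b} \<noteq> {}"
          using Z(1) True ab by (auto intro: compact_Int)
        obtain c where c: "c \<in> Z" "a \<le> c" "c \<le> b" "\<And>y. y \<in> Z \<inter> {a..b} \<Longrightarrow> c \<le> y"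
          using compact_attains_inf[OF K] by auto
        obtain e where e: "e \<in> Z" "a \<le> e" "e \<le> b" "\<And>y. y \<in> Z \<inter> {a..b} \<Longrightarrow> y \<le> e"
          using compact_attains_sup[OF K] by auto
        have "c \<le> e" using c e by auto
        have "P a c" by (rule off) (use c(3,4) in force)
        moreover have "P c e" by (rule on) (use c e \<open>c \<le> e\<close> sub in auto)
        moreover have "P e b" by (rule off) (use e(2,4) in force)
        ultimately show "P a b" using trans c e \<open>c \<le> e\<close> by meson
      qed
      then show ?thesis using d(1) by blast
    qed
  qed
  then show ?thesis using l unfolding P_def \<Psi>_def by simp
qed

text \<open>The measure with density \<open>f\<close> is finite, hence inner regular on the real
  line; the subtraction of measures is legitimate for the same reason.\<close>

lemma set_nn_integral_inner_compact:
  fixes f :: "real \<Rightarrow> ennreal"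
  assumes f: "f \<in> borel_measurable borel" and fin: "(\<integral>\<^sup>+s. f s \<partial>lborel) < \<infinity>"
    and Z: "Z \<in> sets borel" and "0 < e"
  obtains K where "compact K" "K \<subseteq> Z" "(\<integral>\<^sup>+s\<in>Z - K. f s \<partial>lborel) \<le> ennreal e"
proof -
  define N where "N = density lborel f"
  have em: "emeasure N A = (\<integral>\<^sup>+s\<in>A. f s \<partial>lborel)" if "A \<in> sets borel" for A
    unfolding N_def using that f by (subst emeasure_density) auto
  have sN: "sets N = sets borel" "space N = UNIV" by (auto simp: N_def)
  have finN: "emeasure N (space N) \<noteq> \<infinity>" using em[of UNIV] fin sN by simp
  then interpret N: finite_measure N by (intro finite_measureI) simp
  have "\<exists>K\<in>{K. K \<subseteq> Z \<and> compact K}. emeasure N Z < emeasure N K + ennreal e"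
    by (rule SUP_approx_ennreal[OF \<open>0 < e\<close> _ inner_regular[OF sN(1) finN Z]]) auto
  then obtain K where K: "K \<subseteq> Z" "compact K" "emeasure N Z < emeasure N K + ennreal e" by auto
  then have Kb: "K \<in> sets borel" by (simp add: borel_compact)
  have "emeasure N (Z - K) = emeasure N Z - emeasure N K"
    using K Kb Z sN by (intro emeasure_Diff) auto
  also have "\<dots> \<le> ennreal e"
    using K(3) by (simp add: ennreal_minus_le_iff less_imp_le)
  finally show thesis using K Kb Z em[of "Z - K"] by (intro that) auto
qed

text \<open>Outer regularity of the finite measure with density \<open>f\<close>. In the application
  \<open>H\<close> is therefore first cut off to a set of finite integral.\<close>

lemma set_nn_integral_outer_open:
  fixes f :: "real \<Rightarrow> ennreal"
  assumes f: "f \<in> borel_measurable borel" and fin: "(\<integral>\<^sup>+s. f s \<partial>lborel) < \<infinity>"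
    and Z: "Z \<in> sets borel" and "0 < e"
  obtains W where "open W" "Z \<subseteq> W" "(\<integral>\<^sup>+s\<in>W. f s \<partial>lborel) \<le> (\<integral>\<^sup>+s\<in>Z. f s \<partial>lborel) + ennreal e"
proof -
  define N where "N = density lborel f"
  have em: "emeasure N A = (\<integral>\<^sup>+s\<in>A. f s \<partial>lborel)" if "A \<in> sets borel" for A
    unfolding N_def using that f by (subst emeasure_density) auto
  have sN: "sets N = sets borel" "space N = UNIV" by (auto simp: N_def)
  have finN: "emeasure N (space N) \<noteq> \<infinity>" using em[of UNIV] fin sN by simp
  then interpret N: finite_measure N by (intro finite_measureI) simp
  have "emeasure N Z < emeasure N Z + ennreal e"
    using \<open>0 < e\<close> by (simp add: N.emeasure_eq_measure ennreal_less_iff flip: ennreal_plus)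
  then have "(INF U\<in>{U. Z \<subseteq> U \<and> open U}. emeasure N U) < emeasure N Z + ennreal e"
    using outer_regular[OF sN(1) finN Z] by simp
  then obtain W where "Z \<subseteq> W" "open W" "emeasure N W < emeasure N Z + ennreal e"
    unfolding INF_less_iff by auto
  then show thesis using em[of W] em[of Z] Z by (intro that) (auto intro: less_imp_le)
qed

text \<open>The set \<open>Z\<close> is exhausted by compact subsets, along which the open cover in
  \<open>glue_open_cover\<close> can be shrunk.\<close>

lemma glue_borel:
  fixes f :: "real \<Rightarrow> real" and G H :: "real \<Rightarrow> ennreal"
  assumes G: "G \<in> borel_measurable borel" and H: "H \<in> borel_measurable borel"
    and l: "0 \<le> l"
    and fG: "\<And>a b. 0 \<le> a \<Longrightarrow> a \<le> b \<Longrightarrow> b \<le> l \<Longrightarrow> ennreal \<bar>f a - f b\<bar> \<le> (\<integral>\<^sup>+s\<in>{a<..b}. G s \<partial>lborel)"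
    and finG: "(\<integral>\<^sup>+s\<in>{0<..l}. G s \<partial>lborel) < \<infinity>"
    and Z: "Z \<in> sets borel" "Z \<subseteq> {0..l}"
    and W: "\<And>K. compact K \<Longrightarrow> K \<subseteq> Z \<Longrightarrow>
       \<exists>W. open W \<and> K \<subseteq> W \<and> (\<integral>\<^sup>+s\<in>W \<inter> {0<..l}. H s \<partial>lborel) < \<infinity> \<and>
         (\<forall>a\<in>K. \<forall>b\<in>K. a \<le> b \<longrightarrow> {a..b} \<subseteq> W \<longrightarrow>
            ennreal \<bar>f a - f b\<bar> \<le> (\<integral>\<^sup>+s\<in>{a<..b}. H s \<partial>lborel))"
  shows "ennreal \<bar>f 0 - f l\<bar> \<le> (\<integral>\<^sup>+s\<in>{0<..l}. (if s \<in> Z then H s else G s) \<partial>lborel)"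
proof (rule ennreal_le_epsilon)
  fix e :: real assume "0 < e"
  note [measurable] = G H Z(1)
  let ?I = "{0<..l}"
  have finG': "(\<integral>\<^sup>+s. G s * indicator ?I s \<partial>lborel) < \<infinity>" using finG by simp
  \<comment> \<open>On \<open>Z - K\<close> the function \<open>G\<close> is still charged;
    \<open>K\<close> is chosen so that this costs at most e/2.\<close>
  obtain K where K: "compact K" "K \<subseteq> Z" 
    "(\<integral>\<^sup>+s\<in>Z - K. G s * indicator ?I s \<partial>lborel) \<le> ennreal (e/2)"
    by (rule set_nn_integral_inner_compact[OF _ finG' Z(1), of "e/2"]) (use \<open>0 < e\<close> in auto)
  have [measurable]: "K \<in> sets borel" using K by (simp add: borel_compact)
  obtain W where W: "open W" "K \<subseteq> W" "(\<integral>\<^sup>+s\<in>W \<inter> ?I. H s \<partial>lborel) < \<infinity>"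
    "\<And>a b. a \<in> K \<Longrightarrow> b \<in> K \<Longrightarrow> a \<le> b \<Longrightarrow> {a..b} \<subseteq> W \<Longrightarrow>
            ennreal \<bar>f a - f b\<bar> \<le> (\<integral>\<^sup>+s\<in>{a<..b}. H s \<partial>lborel)"
    using W[OF K(1,2)] by blast
  have [measurable]: "W \<in> sets borel" using W by auto
  \<comment> \<open>Inside \<open>W\<close> and the interval, the integral of \<open>H\<close> over
    \<open>V\<close> exceeds that over \<open>K\<close> by at most e/2; \<open>V \<inter> W\<close>
    is the neighbourhood for the open cover estimate.\<close>
  obtain V where V: "open V" "K \<subseteq> V"
    "(\<integral>\<^sup>+s\<in>V. H s * indicator (W \<inter> ?I) s \<partial>lborel)
      \<le> (\<integral>\<^sup>+s\<in>K. H s * indicator (W \<inter> ?I) s \<partial>lborel) + ennreal (e/2)"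
    by (rule set_nn_integral_outer_open[of "\<lambda>s. H s * indicator (W \<inter> ?I) s" K "e/2"])
      (use W \<open>0 < e\<close> in auto)
  have [measurable]: "V \<in> sets borel" using V by auto
  have "ennreal \<bar>f 0 - f l\<bar> \<le>
    (\<integral>\<^sup>+s\<in>?I. G s * indicator (- K) s + H s * indicator (V \<inter> W) s \<partial>lborel)"
    by (rule glue_open_cover[OF G H fG]) (use K Z V W l in auto)
  also have "\<dots> = (\<integral>\<^sup>+s. G s * indicator (- K) s * indicator ?I s \<partial>lborel) 
      + (\<integral>\<^sup>+s\<in>V. H s * indicator (W \<inter> ?I) s \<partial>lborel)"
    by (subst nn_integral_add[symmetric]) (auto intro!: nn_integral_cong simp: indicator_def)
  also have "\<dots> \<le> (\<integral>\<^sup>+s. G s * indicator (- K) s * indicator ?I s \<partial>lborel) 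
      + ((\<integral>\<^sup>+s\<in>K. H s * indicator (W \<inter> ?I) s \<partial>lborel) + ennreal (e/2))"
    by (intro add_left_mono V(3))
  also have "(\<integral>\<^sup>+s. G s * indicator (- K) s * indicator ?I s \<partial>lborel) =
      (\<integral>\<^sup>+s. G s * indicator (- Z) s * indicator ?I s \<partial>lborel) + (\<integral>\<^sup>+s\<in>Z - K. G s * indicator ?I s \<partial>lborel)"
    using K(2) by (subst nn_integral_add[symmetric]) (auto intro!: nn_integral_cong simp: indicator_def)
  also have "\<dots> + ((\<integral>\<^sup>+s\<in>K. H s * indicator (W \<inter> ?I) s \<partial>lborel) + ennreal (e/2))
     \<le> (\<integral>\<^sup>+s. G s * indicator (- Z) s * indicator ?I s \<partial>lborel) + ennreal (e/2)
      + ((\<integral>\<^sup>+s. H s * indicator Z s * indicator ?I s \<partial>lborel) + ennreal (e/2))"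
    using K by (intro add_mono order_refl nn_integral_mono) (auto simp: indicator_def)
  also have "\<dots> = (\<integral>\<^sup>+s. G s * indicator (- Z) s * indicator ?I s \<partial>lborel)
      + (\<integral>\<^sup>+s. H s * indicator Z s * indicator ?I s \<partial>lborel) + (ennreal (e/2) + ennreal (e/2))"
    by (simp add: ac_simps)
  also have "\<dots> = (\<integral>\<^sup>+s\<in>?I. (if s \<in> Z then H s else G s) \<partial>lborel) + ennreal e"
    using \<open>0 < e\<close> by (subst nn_integral_add[symmetric], measurable, subst ennreal_plus[symmetric])
      (auto intro!: arg_cong2[where f="(+)"] nn_integral_cong simp: indicator_def)
  finally show "ennreal \<bar>f 0 - f l\<bar> \<le> (\<integral>\<^sup>+s\<in>?I. (if s \<in> Z then H s else G s) \<partial>lborel) + ennreal e" .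
qed

section \<open>Exceptional families of paths\<close>

lemma epow_mono: "0 \<le> q \<Longrightarrow> a \<le> b \<Longrightarrow> epow a q \<le> epow b q"
  by (cases a; cases b) (auto simp: epow_def top_unique ennreal_le_iff intro!: ennreal_leI powr_mono2)

lemma epow_less_top_iff [simp]: "epow a q < top \<longleftrightarrow> a < top"
  by (simp add: epow_def less_top)

lemma epow_0 [simp]: "epow 0 q = 0"
  by (simp add: epow_def)

lemma epow_ennreal: "0 \<le> x \<Longrightarrow> epow (ennreal x) q = ennreal (x powr q)"
  by (simp add: epow_def)

lemma epow_epow_inverse: "0 < q \<Longrightarrow> epow (epow a q) (1 / q) = a" "0 < q \<Longrightarrow> epow (epow a (1 / q)) q = a"
  by (cases a; simp add: epow_def powr_powr)+

lemma epow_cmult: "0 < c \<Longrightarrow> 0 < q \<Longrightarrow> epow (ennreal c * a) q = ennreal (c powr q) * epow a q"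
  by (cases a) (auto simp: epow_def ennreal_mult_eq_top_iff ennreal_mult_top powr_mult simp flip: ennreal_mult)

lemma borel_measurable_epow [measurable]:
  assumes [measurable]: "f \<in> borel_measurable M"
  shows "(\<lambda>x. epow (f x) q) \<in> borel_measurable M"
  unfolding epow_def by measurable

text \<open>Each \<open>a i\<close> is at most the q-th root of the sum. Suprema thus serve in place
  of sums when infinitely many L^p functions are combined.\<close>

lemma epow_SUP_le:
  assumes "0 < q"
  shows "epow (SUP i. a i) q \<le> (\<Sum>i. epow (a i) q)"
proof -
  let ?S = "\<Sum>i. epow (a i) q"
  have "a i \<le> epow ?S (1 / q)" for i
  proof -
    have "epow (a i) q \<le> ?S" using sum_le_suminf[of "\<lambda>i. epow (a i) q" "{i}"] by simp
    then have "epow (epow (a i) q) (1 / q) \<le> epow ?S (1 / q)" using assms by (intro epow_mono) auto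
    then show ?thesis using assms by (simp add: epow_epow_inverse)
  qed
  then have "epow (SUP i. a i) q \<le> epow (epow ?S (1 / q)) q"
    using assms by (intro epow_mono SUP_least) auto
  then show ?thesis using assms by (simp add: epow_epow_inverse)
qed

text \<open>Borel measurability is demanded as for the admissible functions in
  \<open>p_modulus\<close>: a path may run inside a null set, so values on null sets matter.\<close>

definition Lp_fun :: "real \<Rightarrow> 'x::topological_space measure \<Rightarrow> ('x \<Rightarrow> ennreal) \<Rightarrow> bool" where
  "Lp_fun p M \<rho> \<longleftrightarrow> \<rho> \<in> borel_measurable borel \<and> (\<integral>\<^sup>+x. epow (\<rho> x) p \<partial>M) < \<infinity>"

lemma Lp_fun_SUP:
  fixes M :: "'x::topological_space measure"
  assumes p: "0 < p" and M: "sets M = sets borel" and c: "\<And>i. 0 < c i"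
    and \<rho>: "\<And>i::nat. \<rho> i \<in> borel_measurable borel"
    and bd: "\<And>i. ennreal (c i powr p) * (\<integral>\<^sup>+x. epow (\<rho> i x) p \<partial>M) \<le> ennreal ((1/2) ^ Suc i)"
  shows "Lp_fun p M (\<lambda>x. SUP i. ennreal (c i) * \<rho> i x)"
  unfolding Lp_fun_def
proof
  note [measurable] = \<rho> and [measurable_cong] = M
  show "(\<lambda>x. SUP i. ennreal (c i) * \<rho> i x) \<in> borel_measurable borel" by measurable
  have "(\<integral>\<^sup>+x. epow (SUP i. ennreal (c i) * \<rho> i x) p \<partial>M)
    \<le> (\<integral>\<^sup>+x. (\<Sum>i. epow (ennreal (c i) * \<rho> i x) p) \<partial>M)"
    by (intro nn_integral_mono epow_SUP_le p)
  also have "\<dots> = (\<Sum>i. ennreal (c i powr p) * (\<integral>\<^sup>+x. epow (\<rho> i x) p \<partial>M))"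
    by (subst nn_integral_suminf) (auto simp: epow_cmult[OF c p] nn_integral_cmult)
  also have "\<dots> \<le> (\<Sum>i. ennreal ((1/2) ^ Suc i))"
    by (intro suminf_le bd) auto
  also have "\<dots> = ennreal 1"
    using power_half_series by (intro suminf_ennreal_eq) auto
  finally show "(\<integral>\<^sup>+x. epow (SUP i. ennreal (c i) * \<rho> i x) p \<partial>M) < \<infinity>"
    by (rule order.strict_trans1) simp
qed

text \<open>Countable subadditivity of null families in functional form: along a path with finite
  integral of \<rho>', every \<open>\<rho> i\<close> has finite integral.\<close>

lemma Lp_fun_combine:
  fixes M :: "'x::topological_space measure"
  assumes p: "0 < p" and M: "sets M = sets borel" and \<rho>: "\<And>i::nat. Lp_fun p M (\<rho> i)"
  obtains \<rho>' c where "Lp_fun p M \<rho>'" "\<And>i. 0 < c i" "\<And>i x. ennreal (c i) * \<rho> i x \<le> \<rho>' x"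
proof -
  define I where "I i = enn2real (\<integral>\<^sup>+x. epow (\<rho> i x) p \<partial>M)" for i
  have I: "(\<integral>\<^sup>+x. epow (\<rho> i x) p \<partial>M) = ennreal (I i)" "0 \<le> I i" for i
    using \<rho>[of i] by (auto simp: I_def Lp_fun_def)
  \<comment> \<open>Chosen so that \<open>c i powr p * I i \<le> (1/2) ^ Suc i\<close>; the summand
    1 keeps the denominator positive.\<close>
  define c where "c i = ((1/2) ^ Suc i / (1 + I i)) powr (1/p)" for i
  have c: "0 < c i" for i using I(2)[of i] by (simp add: c_def)
  have "Lp_fun p M (\<lambda>x. SUP i. ennreal (c i) * \<rho> i x)"
  proof (rule Lp_fun_SUP[OF p M c])
    show "\<rho> i \<in> borel_measurable borel" for i using \<rho>[of i] by (simp add: Lp_fun_def)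
    fix i
    have "c i powr p = (1/2) ^ Suc i / (1 + I i)"
      using p I(2)[of i] by (simp add: c_def powr_powr)
    also have "\<dots> * I i = (1/2) ^ Suc i * (I i / (1 + I i))"
      by simp
    also have "\<dots> \<le> (1/2) ^ Suc i * 1"
      using I(2)[of i] by (intro mult_left_mono) auto
    finally have "c i powr p * I i \<le> (1/2) ^ Suc i" by simp
    then show "ennreal (c i powr p) * (\<integral>\<^sup>+x. epow (\<rho> i x) p \<partial>M) \<le> ennreal ((1/2) ^ Suc i)"
      unfolding I(1) using I(2)[of i] by (subst ennreal_mult[symmetric]) (auto intro: ennreal_leI)
  qed
  then show thesis
  proof (rule that[of _ c])
    show "0 < c i" for i by (rule c)
    show "ennreal (c i) * \<rho> i x \<le> (SUP i. ennreal (c i) * \<rho> i x)" for i x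
      by (rule SUP_upper) simp
  qed
qed

section \<open>Path integrals and families of zero modulus\<close>

lemma path_integral_mono: "(\<And>x. f x \<le> g x) \<Longrightarrow> path_integral f \<gamma> \<le> path_integral g \<gamma>"
  unfolding path_integral_def by (intro nn_integral_mono mult_right_mono) auto

lemma path_integral_cmult:
  assumes \<gamma>: "\<gamma> \<in> rect_paths \<Omega>" and f: "f \<in> borel_measurable borel"
  shows "path_integral (\<lambda>x. c * f x) \<gamma> = c * path_integral f \<gamma>"
proof -
  obtain l :: real and \<sigma> where l: "1-lipschitz_on {0..l} \<sigma>"
    and pi: "\<And>g. path_integral g \<gamma> = (\<integral>\<^sup>+s\<in>{0..l}. g (\<sigma> s) \<partial>lborel)"
    by (rule rect_path_arc[OF \<gamma>]) (rule that, assumption+)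
  have "(\<lambda>s. f (\<sigma> s) * indicator {0..l} s) \<in> borel_measurable borel"
    by (rule borel_measurable_on_path[of l]) (use l f in \<open>auto intro: lipschitz_on_continuous_on\<close>)
  then show ?thesis unfolding pi by (simp add: mult.assoc nn_integral_cmult)
qed

lemma path_integral_cong:
  assumes \<gamma>: "\<gamma> \<in> rect_paths \<Omega>" and fg: "\<And>x. x \<in> \<Omega> \<Longrightarrow> f x = g x"
  shows "path_integral f \<gamma> = path_integral g \<gamma>"
proof -
  obtain l :: real and \<sigma> where l: "\<sigma> ` {0..l} \<subseteq> \<Omega>"
    and pi: "\<And>g. path_integral g \<gamma> = (\<integral>\<^sup>+s\<in>{0..l}. g (\<sigma> s) \<partial>lborel)"
    by (rule rect_path_arc[OF \<gamma>]) (rule that, assumption+)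
  show ?thesis unfolding pi using l by (intro nn_integral_cong) (auto simp: indicator_def image_subset_iff intro!: fg)
qed

lemma rect_paths_mono: "\<Omega> \<subseteq> \<Omega>' \<Longrightarrow> rect_paths \<Omega> \<subseteq> rect_paths \<Omega>'"
  by (auto simp: rect_paths_def)

lemma path_integral_dominated:
  assumes \<gamma>: "\<gamma> \<in> rect_paths \<Omega>" and f: "f \<in> borel_measurable borel"
    and c: "0 < c" "\<And>x. ennreal c * f x \<le> g x" and fin: "path_integral g \<gamma> < \<infinity>"
  shows "path_integral f \<gamma> < \<infinity>"
proof -
  have "ennreal c * path_integral f \<gamma> \<le> path_integral g \<gamma>"
    unfolding path_integral_cmult[OF \<gamma> f, symmetric] by (intro path_integral_mono c)
  then have "ennreal c * path_integral f \<gamma> < \<infinity>" using fin by (rule order.strict_trans1)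
  then show ?thesis using c(1) by (auto simp: ennreal_mult_less_top)
qed

text \<open>Fuglede's characterization. A function with infinite integrals stays admissible under
  scaling by any positive constant, so the modulus is arbitrarily small; conversely, admissible
  functions of rapidly decreasing energy are weighted by growing factors and combined by a
  supremum.\<close>

lemma p_modulus_eq_0_iff:
  fixes M :: "'x::metric_space measure"
  assumes p: "0 < p" and M: "sets M = sets borel" and \<Gamma>: "\<Gamma> \<subseteq> rect_paths \<Omega>"
  shows "p_modulus p M \<Gamma> = 0 \<longleftrightarrow> (\<exists>\<rho>. Lp_fun p M \<rho> \<and> (\<forall>\<gamma>\<in>\<Gamma>. path_integral \<rho> \<gamma> = \<infinity>))"
proof
  note [measurable_cong] = M
  assume "\<exists>\<rho>. Lp_fun p M \<rho> \<and> (\<forall>\<gamma>\<in>\<Gamma>. path_integral \<rho> \<gamma> = \<infinity>)"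
  then obtain \<rho> where \<rho>[measurable]: "\<rho> \<in> borel_measurable borel"
    and fin: "(\<integral>\<^sup>+x. epow (\<rho> x) p \<partial>M) < \<infinity>" and inf: "\<And>\<gamma>. \<gamma> \<in> \<Gamma> \<Longrightarrow> path_integral \<rho> \<gamma> = \<infinity>"
    by (auto simp: Lp_fun_def)
  obtain I where I: "(\<integral>\<^sup>+x. epow (\<rho> x) p \<partial>M) = ennreal I" "0 \<le> I"
    using fin by (cases "\<integral>\<^sup>+x. epow (\<rho> x) p \<partial>M") auto
  have le: "p_modulus p M \<Gamma> \<le> ennreal e" if "0 < e" for e
  proof -
    \<comment> \<open>Scaling by \<open>c\<close> multiplies the energy \<open>I\<close> by
      \<open>e / (1 + I)\<close>, so that it becomes at most \<open>e\<close>.\<close>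
    define c where "c = (e / (1 + I)) powr (1/p)"
    have c: "0 < c" "c powr p = e / (1 + I)" using that I(2) p by (auto simp: c_def powr_powr)
    have "1 \<le> path_integral (\<lambda>x. ennreal c * \<rho> x) \<gamma>" if "\<gamma> \<in> \<Gamma>" for \<gamma>
      using that \<Gamma> c(1) by (subst path_integral_cmult[OF _ \<rho>]) (auto simp: inf ennreal_mult_top)
    then have "p_modulus p M \<Gamma> \<le> (\<integral>\<^sup>+x. epow (ennreal c * \<rho> x) p \<partial>M)"
      unfolding p_modulus_def by (intro INF_lower) auto
    also have "\<dots> = ennreal (c powr p * I)"
      using I c(1) p by (simp add: epow_cmult nn_integral_cmult ennreal_mult)
    also have "\<dots> \<le> ennreal e"
      unfolding c(2) using I(2) that by (intro ennreal_leI) (simp add: field_simps)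
    finally show ?thesis .
  qed
  have "p_modulus p M \<Gamma> \<le> 0"
    by (rule ennreal_le_epsilon) (use le in auto)
  then show "p_modulus p M \<Gamma> = 0" by simp
next
  assume 0: "p_modulus p M \<Gamma> = 0"
  \<comment> \<open>Division by \<open>real (Suc i) powr p\<close> compensates the weight
    \<open>Suc i\<close> given to \<open>\<rho> i\<close>; the power of 1/2 makes the weighted
    energies summable.\<close>
  define e where "e i = (1/2) ^ Suc i / real (Suc i) powr p" for i
  have e: "0 < e i" for i by (simp add: e_def)
  have "\<exists>\<rho>. \<rho> \<in> borel_measurable borel \<and> (\<forall>\<gamma>\<in>\<Gamma>. 1 \<le> path_integral \<rho> \<gamma>) \<and>
      (\<integral>\<^sup>+x. epow (\<rho> x) p \<partial>M) < ennreal (e i)" for i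
  proof -
    have "p_modulus p M \<Gamma> < ennreal (e i)" using 0 e[of i] by simp
    then show ?thesis unfolding p_modulus_def INF_less_iff by auto
  qed
  then obtain \<rho> where \<rho>: "\<And>i. \<rho> i \<in> borel_measurable borel"
    "\<And>i \<gamma>. \<gamma> \<in> \<Gamma> \<Longrightarrow> 1 \<le> path_integral (\<rho> i) \<gamma>"
    "\<And>i. (\<integral>\<^sup>+x. epow (\<rho> i x) p \<partial>M) < ennreal (e i)" by metis
  define \<rho>' where "\<rho>' x = (SUP i. ennreal (real (Suc i)) * \<rho> i x)" for x
  have "Lp_fun p M \<rho>'"
    unfolding \<rho>'_def
  proof (rule Lp_fun_SUP[OF p M _ \<rho>(1)])
    fix i
    have "ennreal (real (Suc i) powr p) * (\<integral>\<^sup>+x. epow (\<rho> i x) p \<partial>M) \<le> ennreal (real (Suc i) powr p) * ennreal (e i)"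
      using \<rho>(3)[of i] by (intro mult_left_mono) auto
    also have "\<dots> = ennreal ((1/2) ^ Suc i)"
      by (subst ennreal_mult[symmetric]) (auto simp: e_def)
    finally show "ennreal (real (Suc i) powr p) * (\<integral>\<^sup>+x. epow (\<rho> i x) p \<partial>M) \<le> ennreal ((1/2) ^ Suc i)" .
  qed simp
  moreover have "path_integral \<rho>' \<gamma> = \<infinity>" if "\<gamma> \<in> \<Gamma>" for \<gamma>
  proof -
    have \<gamma>: "\<gamma> \<in> rect_paths \<Omega>" using that \<Gamma> by auto
    have "ennreal (real i) \<le> path_integral \<rho>' \<gamma>" for i
    proof -
      have "ennreal (real i) \<le> ennreal (real (Suc i)) * 1" by (simp add: ennreal_leI)
      also have "\<dots> \<le> ennreal (real (Suc i)) * path_integral (\<rho> i) \<gamma>"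
        by (intro mult_left_mono \<rho>(2) that) simp
      also have "\<dots> = path_integral (\<lambda>x. ennreal (real (Suc i)) * \<rho> i x) \<gamma>"
        by (rule path_integral_cmult[OF \<gamma> \<rho>(1), symmetric])
      also have "\<dots> \<le> path_integral \<rho>' \<gamma>"
        unfolding \<rho>'_def by (intro path_integral_mono SUP_upper2[of i]) auto
      finally show ?thesis .
    qed
    then show ?thesis
      by (metis ennreal_of_nat_eq_real_of_nat ennreal_SUP_of_nat_eq_top infinity_ennreal_def SUP_least top_unique)
  qed
  ultimately show "\<exists>\<rho>. Lp_fun p M \<rho> \<and> (\<forall>\<gamma>\<in>\<Gamma>. path_integral \<rho> \<gamma> = \<infinity>)" by blast
qed

text \<open>Compared with a null family, a function \<rho> has the advantage that finiteness of its
  integral passes from a path to its pieces.\<close>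

lemma weak_upper_gradient_iff:
  fixes M :: "'x::metric_space measure"
  assumes p: "0 < p" and M: "sets M = sets borel"
  shows "weak_upper_gradient p M \<Omega> u g \<longleftrightarrow> g \<in> borel_measurable (restrict_space borel \<Omega>) \<and>
    (\<exists>\<rho>. Lp_fun p M \<rho> \<and> (\<forall>\<gamma>\<in>rect_paths \<Omega>. path_integral \<rho> \<gamma> < \<infinity> \<longrightarrow> ug_ineq u g \<gamma>))"
proof -
  have "(\<exists>\<Gamma>. \<Gamma> \<subseteq> rect_paths \<Omega> \<and> p_modulus p M \<Gamma> = 0 \<and> (\<forall>\<gamma>\<in>rect_paths \<Omega> - \<Gamma>. ug_ineq u g \<gamma>))
    \<longleftrightarrow> (\<exists>\<rho>. Lp_fun p M \<rho> \<and> (\<forall>\<gamma>\<in>rect_paths \<Omega>. path_integral \<rho> \<gamma> < \<infinity> \<longrightarrow> ug_ineq u g \<gamma>))"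
    (is "?L \<longleftrightarrow> ?R")
  proof
    assume ?L then show ?R
      using p_modulus_eq_0_iff[OF p M, of _ \<Omega>] by (metis DiffI less_irrefl)
  next
    assume ?R
    then obtain \<rho> where \<rho>: "Lp_fun p M \<rho>"
      "\<And>\<gamma>. \<gamma> \<in> rect_paths \<Omega> \<Longrightarrow> path_integral \<rho> \<gamma> < \<infinity> \<Longrightarrow> ug_ineq u g \<gamma>" by auto
    define \<Gamma> where "\<Gamma> = {\<gamma>\<in>rect_paths \<Omega>. path_integral \<rho> \<gamma> = \<infinity>}"
    have "\<Gamma> \<subseteq> rect_paths \<Omega>" by (auto simp: \<Gamma>_def)
    moreover have "p_modulus p M \<Gamma> = 0"
      using \<rho>(1) by (subst p_modulus_eq_0_iff[OF p M, of _ \<Omega>]) (auto simp: \<Gamma>_def)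
    moreover have "\<forall>\<gamma>\<in>rect_paths \<Omega> - \<Gamma>. ug_ineq u g \<gamma>"
      using \<rho>(2) by (auto simp: \<Gamma>_def less_top)
    ultimately show ?L by blast
  qed
  then show ?thesis by (simp add: weak_upper_gradient_def)
qed

section \<open>Minimal weak upper gradients\<close>

text \<open>In \<open>ereal\<close> a difference with an infinite term has infinite absolute value,
  even for equal infinities. So a finite upper gradient integral makes the function finite at both
  ends of the path.\<close>

lemma e2ennreal_abs_diff_finite:
  assumes "e2ennreal \<bar>x - y\<bar> < \<infinity>"
  shows "\<bar>x\<bar> \<noteq> \<infinity>" "\<bar>y\<bar> \<noteq> \<infinity>"
proof -
  have "\<bar>x - y\<bar> \<noteq> \<infinity>" using assms by (metis e2ennreal_infty infinity_ennreal_def less_irrefl)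
  then show "\<bar>x\<bar> \<noteq> \<infinity>" "\<bar>y\<bar> \<noteq> \<infinity>"
    by (cases x rule: ereal_cases; cases y rule: ereal_cases; simp)+
qed

lemma e2ennreal_abs_diff_real:
  assumes "\<bar>x\<bar> \<noteq> \<infinity>" "\<bar>y\<bar> \<noteq> \<infinity>"
  shows "e2ennreal \<bar>x - y\<bar> = ennreal \<bar>real_of_ereal x - real_of_ereal y\<bar>"
proof -
  obtain a where "x = ereal a" using assms(1) by (cases x) auto
  moreover obtain b where "y = ereal b" using assms(2) by (cases y) auto
  ultimately show ?thesis by simp
qed

lemma e2ennreal_abs_enn2ereal [simp]: "e2ennreal \<bar>enn2ereal a\<bar> = a"
  by (simp add: abs_ereal_ge0)

lemma epow_mult_indicator: "epow (a * indicator B x) q = epow a q * indicator B x"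
  by (simp add: indicator_def)

definition loc_wug ::
    "real \<Rightarrow> 'x::metric_space measure \<Rightarrow> 'x set \<Rightarrow> ('x \<Rightarrow> ereal) \<Rightarrow> ('x \<Rightarrow> ennreal) \<Rightarrow> bool" where
  "loc_wug p M \<Omega> u g \<longleftrightarrow> weak_upper_gradient p M \<Omega> u g \<and> in_Lp_loc p M \<Omega> (\<lambda>x. enn2ereal (g x))"

lemma minimal_wug_iff:
  "minimal_wug p M \<Omega> u g \<longleftrightarrow> loc_wug p M \<Omega> u g \<and>
    (\<forall>h. loc_wug p M \<Omega> u h \<longrightarrow> (AE x in M. x \<in> \<Omega> \<longrightarrow> g x \<le> h x))"
  by (auto simp: minimal_wug_def loc_wug_def)

lemma compactly_in_mono: "compactly_in B \<Omega> \<Longrightarrow> \<Omega> \<subseteq> \<Omega>' \<Longrightarrow> compactly_in B \<Omega>'"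
  by (auto simp: compactly_in_def)

text \<open>The interface between doubling measures and the calculus of upper gradients. Properness
  yields exhaustions of \<Omega> by sets with compact closure; finiteness on bounded sets yields
  sigma-finiteness and finite energies of Lipschitz perturbations.\<close>

locale proper_measure_space =
  fixes M :: "'x::metric_space measure" and p :: real
  assumes p_pos: "0 < p"
    and sets_M [measurable_cong]: "sets M = sets borel"
    and proper: "\<And>S::'x set. closed S \<Longrightarrow> bounded S \<Longrightarrow> compact S"
    and finite_bounded: "\<And>S. bounded S \<Longrightarrow> emeasure M S < \<infinity>"
begin

lemma space_M [simp]: "space M = UNIV"
  using sets_eq_imp_space_eq[OF sets_M] by simp

lemma sigma_finite_M: "sigma_finite_measure M"
proof
  define A where "A = range (\<lambda>n. ball (undefined::'x) (real n))"
  have "\<Union>A = UNIV"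
  proof -
    have "x \<in> \<Union>A" for x
      using reals_Archimedean2[of "dist undefined x"] by (auto simp: A_def)
    then show ?thesis by auto
  qed
  then show "\<exists>A. countable A \<and> A \<subseteq> sets M \<and> \<Union> A = space M \<and> (\<forall>a\<in>A. emeasure M a \<noteq> \<infinity>)"
    using finite_bounded by (intro exI[of _ A]) (auto simp: A_def sets_M less_top)
qed

lemma exhaustion:
  assumes "open \<Omega>" "bounded \<Omega>"
  obtains B :: "nat \<Rightarrow> 'x set" where "\<And>n. open (B n)" "\<And>n. compactly_in (B n) \<Omega>" "incseq B"
    "\<And>K. compact K \<Longrightarrow> K \<subseteq> \<Omega> \<Longrightarrow> \<exists>n. K \<subseteq> B n"
proof (cases "\<Omega> = UNIV")
  \<comment> \<open>The distance to the empty complement is 0 by convention, so this case is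
    separate; a bounded whole space is compact by properness.\<close>
  case True
  have "bounded (UNIV::'x set)" using assms(2) unfolding True .
  then have "compact (UNIV::'x set)" by (rule proper[OF closed_UNIV])
  then have "compactly_in UNIV \<Omega>" unfolding True compactly_in_def by simp
  then show thesis by (rule that[of "\<lambda>_. UNIV", rotated]) (simp_all add: incseq_def)
next
  case False
  define F where "F = - \<Omega>"
  have F: "closed F" "F \<noteq> {}" using assms False by (auto simp: F_def)
  define B where "B n = {x. 1 / real (Suc n) < infdist x F}" for n
  have cont: "continuous_on UNIV (\<lambda>x. infdist x F)" by (intro continuous_intros)
  have inF: "x \<in> \<Omega>" if "0 < infdist x F" for x
    using that by (cases "x \<in> F") (auto simp: F_def)
  show thesis
  proof (rule that[of B])
    show "open (B n)" for n
      unfolding B_def by (intro open_Collect_less continuous_intros)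
    show "compactly_in (B n) \<Omega>" for n
    proof -
      have "closed {x. 1 / real (Suc n) \<le> infdist x F}"
        by (intro closed_Collect_le continuous_intros)
      then have cl: "closure (B n) \<subseteq> {x. 1 / real (Suc n) \<le> infdist x F}"
        by (intro closure_minimal) (auto simp: B_def)
      have "closure (B n) \<subseteq> \<Omega>"
      proof
        fix x assume "x \<in> closure (B n)"
        with cl have "1 / real (Suc n) \<le> infdist x F" by auto
        moreover have "0 < 1 / real (Suc n)" by simp
        ultimately show "x \<in> \<Omega>" by (intro inF) linarith
      qed
      moreover then have "compact (closure (B n))"
        using assms by (intro proper) (auto intro: bounded_subset)
      ultimately show ?thesis by (simp add: compactly_in_def)
    qed
    show "incseq B"
    proof (rule incseq_SucI, rule subsetI)
      fix n x assume "x \<in> B n"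
      then have "1 / real (Suc n) < infdist x F" by (simp add: B_def)
      moreover have "1 / real (Suc (Suc n)) \<le> 1 / real (Suc n)" by (intro divide_left_mono) auto
      ultimately show "x \<in> B (Suc n)" unfolding B_def by simp
    qed
    fix K assume K: "compact K" "K \<subseteq> \<Omega>"
    show "\<exists>n. K \<subseteq> B n"
    proof (cases "K = {}")
      case False
      \<comment> \<open>The distance to the complement attains its minimum on \<open>K\<close>,
        which is positive.\<close>
      obtain x where x: "x \<in> K" "\<And>y. y \<in> K \<Longrightarrow> infdist x F \<le> infdist y F"
        using continuous_attains_inf[OF K(1) False continuous_on_subset[OF cont]] by auto
      have "0 < infdist x F"
        using x(1) K(2) F infdist_pos_not_in_closed[OF F, of x] by (auto simp: F_def)
      then obtain n where "1 / real (Suc n) < infdist x F"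
        using nat_approx_posE by blast
      then have "K \<subseteq> B n" using x(2) by (force simp: B_def)
      then show ?thesis ..
    qed simp
  qed
qed

lemma borel_restrict_iff:
  fixes g :: "'x \<Rightarrow> ennreal"
  assumes "open \<Omega>"
  shows "g \<in> borel_measurable (restrict_space borel \<Omega>) \<longleftrightarrow> (\<lambda>x. g x * indicator \<Omega> x) \<in> borel_measurable borel"
  using assms by (subst borel_measurable_restrict_space_iff_ennreal) auto

lemma borel_restrict_mono:
  fixes g :: "'x \<Rightarrow> ennreal"
  assumes "open \<Omega>" "open B" "B \<subseteq> \<Omega>" "g \<in> borel_measurable (restrict_space borel \<Omega>)"
  shows "g \<in> borel_measurable (restrict_space borel B)"
proof -
  have [measurable]: "(\<lambda>x. g x * indicator \<Omega> x) \<in> borel_measurable borel" "B \<in> sets borel"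
    using assms by (auto simp: borel_restrict_iff)
  have "(\<lambda>x. (g x * indicator \<Omega> x) * indicator B x) \<in> borel_measurable borel" by measurable
  also have "(\<lambda>x. (g x * indicator \<Omega> x) * indicator B x) = (\<lambda>x. g x * indicator B x)"
    using assms(3) by (auto simp: indicator_def fun_eq_iff)
  finally show ?thesis using assms by (simp add: borel_restrict_iff)
qed

lemma Lp_norm_ennreal: "Lp_norm p M B (\<lambda>x. enn2ereal (g x)) = epow (\<integral>\<^sup>+x\<in>B. epow (g x) p \<partial>M) (1 / p)"
  by (simp add: Lp_norm_def)

lemma in_Lp_ennreal_iff:
  assumes "open B" "g \<in> borel_measurable (restrict_space borel B)"
  shows "in_Lp p M B (\<lambda>x. enn2ereal (g x)) \<longleftrightarrow> (\<integral>\<^sup>+x\<in>B. epow (g x) p \<partial>M) < \<infinity>"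
proof -
  have "(\<lambda>x. g x * indicator B x) \<in> borel_measurable M"
    using assms by (simp add: borel_restrict_iff cong: measurable_cong_sets[OF sets_M refl])
  then have "(\<lambda>x. g x * indicator B x) \<in> borel_measurable (completion M)"
    by (rule measurable_completion)
  then have "g \<in> borel_measurable (restrict_space (completion M) B)"
    using assms by (subst borel_measurable_restrict_space_iff_ennreal) (auto simp: sets_M sets_completionI_sets)
  then have "(\<lambda>x. enn2ereal (g x)) \<in> borel_measurable (restrict_space (completion M) B)" by measurable
  then show ?thesis by (simp add: in_Lp_def Lp_norm_ennreal)
qed

lemma in_Lp_loc_ennreal_iff:
  assumes "open \<Omega>" "g \<in> borel_measurable (restrict_space borel \<Omega>)"
  shows "in_Lp_loc p M \<Omega> (\<lambda>x. enn2ereal (g x)) \<longleftrightarrow>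
    (\<forall>B. open B \<and> compactly_in B \<Omega> \<longrightarrow> (\<integral>\<^sup>+x\<in>B. epow (g x) p \<partial>M) < \<infinity>)"
proof -
  have "in_Lp p M B (\<lambda>x. enn2ereal (g x)) \<longleftrightarrow> (\<integral>\<^sup>+x\<in>B. epow (g x) p \<partial>M) < \<infinity>"
    if "open B" "compactly_in B \<Omega>" for B
  proof (rule in_Lp_ennreal_iff[OF that(1)])
    have "B \<subseteq> \<Omega>" using that(2) closure_subset unfolding compactly_in_def by blast
    then show "g \<in> borel_measurable (restrict_space borel B)"
      by (rule borel_restrict_mono[OF assms(1) that(1) _ assms(2)])
  qed
  then show ?thesis unfolding in_Lp_loc_def by (intro iff_allI imp_cong refl) simp
qed

lemma loc_wug_iff:
  assumes "open \<Omega>"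
  shows "loc_wug p M \<Omega> u g \<longleftrightarrow>
    (\<lambda>x. g x * indicator \<Omega> x) \<in> borel_measurable borel \<and>
    (\<forall>B. open B \<and> compactly_in B \<Omega> \<longrightarrow> (\<integral>\<^sup>+x\<in>B. epow (g x) p \<partial>M) < \<infinity>) \<and>
    (\<exists>\<rho>. Lp_fun p M \<rho> \<and> (\<forall>\<gamma>\<in>rect_paths \<Omega>. path_integral \<rho> \<gamma> < \<infinity> \<longrightarrow> ug_ineq u g \<gamma>))"
  by (cases "g \<in> borel_measurable (restrict_space borel \<Omega>)")
    (simp_all add: loc_wug_def weak_upper_gradient_iff[OF p_pos sets_M] in_Lp_loc_ennreal_iff[OF assms]
      borel_restrict_iff[OF assms, symmetric] conj_ac)

lemma loc_wug_restrict:
  assumes g: "loc_wug p M \<Omega> u g" and o: "open \<Omega>" "open \<Omega>'" and sub: "\<Omega>' \<subseteq> \<Omega>"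
  shows "loc_wug p M \<Omega>' u g"
  unfolding loc_wug_iff[OF o(2)] borel_restrict_iff[OF o(2), symmetric]
proof (intro conjI allI impI)
  have g': "g \<in> borel_measurable (restrict_space borel \<Omega>)"
    "\<And>B. open B \<Longrightarrow> compactly_in B \<Omega> \<Longrightarrow> (\<integral>\<^sup>+x\<in>B. epow (g x) p \<partial>M) < \<infinity>"
    "\<exists>\<rho>. Lp_fun p M \<rho> \<and> (\<forall>\<gamma>\<in>rect_paths \<Omega>. path_integral \<rho> \<gamma> < \<infinity> \<longrightarrow> ug_ineq u g \<gamma>)"
    using g unfolding loc_wug_iff[OF o(1)] borel_restrict_iff[OF o(1), symmetric] by blast+
  show "g \<in> borel_measurable (restrict_space borel \<Omega>')"
    by (rule borel_restrict_mono[OF o sub g'(1)])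
  show "(\<integral>\<^sup>+x\<in>B. epow (g x) p \<partial>M) < \<infinity>" if "open B \<and> compactly_in B \<Omega>'" for B
    using that by (intro g'(2) compactly_in_mono[OF _ sub]) auto
  show "\<exists>\<rho>. Lp_fun p M \<rho> \<and> (\<forall>\<gamma>\<in>rect_paths \<Omega>'. path_integral \<rho> \<gamma> < \<infinity> \<longrightarrow> ug_ineq u g \<gamma>)"
    using g'(3) rect_paths_mono[OF sub] by blast
qed

text \<open>One exceptional family serves for the upper gradient inequality and for the integrability of
  \<open>g\<close> along compact paths.\<close>

lemma loc_wug_good_paths:
  assumes g: "loc_wug p M \<Omega> u g" and o: "open \<Omega>" "bounded \<Omega>"
  obtains \<rho> where "Lp_fun p M \<rho>"
    "\<And>\<gamma>. \<gamma> \<in> rect_paths \<Omega> \<Longrightarrow> path_integral \<rho> \<gamma> < \<infinity> \<Longrightarrow> ug_ineq u g \<gamma>"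
    "\<And>\<gamma> \<Omega>' K. \<gamma> \<in> rect_paths \<Omega>' \<Longrightarrow> path_integral \<rho> \<gamma> < \<infinity> \<Longrightarrow> compact K \<Longrightarrow> K \<subseteq> \<Omega> \<Longrightarrow>
       \<exists>B. open B \<and> K \<subseteq> B \<and> B \<subseteq> \<Omega> \<and> path_integral (\<lambda>x. g x * indicator B x) \<gamma> < \<infinity>"
proof -
  obtain B :: "nat \<Rightarrow> 'x set" where B: "\<And>n. open (B n)" "\<And>n. compactly_in (B n) \<Omega>" "incseq B"
    "\<And>K. compact K \<Longrightarrow> K \<subseteq> \<Omega> \<Longrightarrow> \<exists>n. K \<subseteq> B n"
    using exhaustion[OF o] by metis
  have B\<Omega>: "B n \<subseteq> \<Omega>" for n using B(2)[of n] closure_subset by (auto simp: compactly_in_def)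
  obtain \<rho>0 where \<rho>0: "Lp_fun p M \<rho>0"
    "\<And>\<gamma>. \<gamma> \<in> rect_paths \<Omega> \<Longrightarrow> path_integral \<rho>0 \<gamma> < \<infinity> \<Longrightarrow> ug_ineq u g \<gamma>"
    using g unfolding loc_wug_iff[OF o(1)] by blast
  have meas: "(\<lambda>x. g x * indicator (B n) x) \<in> borel_measurable borel" for n
    using borel_restrict_mono[OF o(1) B(1) B\<Omega>, of g n] g o B(1)
    by (simp add: borel_restrict_iff loc_wug_iff)
  have gB: "Lp_fun p M (\<lambda>x. g x * indicator (B n) x)" for n
    using g B(1,2) meas unfolding loc_wug_iff[OF o(1)] Lp_fun_def epow_mult_indicator by blast
  \<comment> \<open>Index 0 carries the exceptional function of \<open>g\<close>, index
    \<open>n + 1\<close> the cut-off of \<open>g\<close> to \<open>B n\<close>, which is in L^p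
    globally.\<close>
  define r where "r n = (if n = 0 then \<rho>0 else (\<lambda>x. g x * indicator (B (n - 1)) x))" for n
  have r: "Lp_fun p M (r n)" for n using gB \<rho>0 by (simp add: r_def)
  obtain \<rho> c where \<rho>: "Lp_fun p M \<rho>" "\<And>i. 0 < c i" "\<And>i x. ennreal (c i) * r i x \<le> \<rho> x"
    by (rule Lp_fun_combine[of p M r, OF p_pos sets_M r]) (rule that)
  have fin: "path_integral (r i) \<gamma> < \<infinity>" if "\<gamma> \<in> rect_paths \<Omega>'" "path_integral \<rho> \<gamma> < \<infinity>" for \<gamma> i \<Omega>'
    using r[of i] by (intro path_integral_dominated[OF that(1) _ \<rho>(2,3)[of i] that(2)]) (simp add: Lp_fun_def)
  show thesis
  proof (rule that[OF \<rho>(1)])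
    show "ug_ineq u g \<gamma>" if "\<gamma> \<in> rect_paths \<Omega>" "path_integral \<rho> \<gamma> < \<infinity>" for \<gamma>
      using fin[OF that, of 0] that \<rho>0(2) by (simp add: r_def)
    fix \<gamma> \<Omega>' K assume \<gamma>: "\<gamma> \<in> rect_paths \<Omega>'" "path_integral \<rho> \<gamma> < \<infinity>" and K: "compact K" "K \<subseteq> \<Omega>"
    obtain n where n: "K \<subseteq> B n" using B(4)[OF K] by blast
    show "\<exists>B. open B \<and> K \<subseteq> B \<and> B \<subseteq> \<Omega> \<and> path_integral (\<lambda>x. g x * indicator B x) \<gamma> < \<infinity>"
      using fin[OF \<gamma>, of "Suc n"] n B(1) B\<Omega> by (intro exI[of _ "B n"]) (simp add: r_def)
  qed
qed

text \<open>Along a path \<sigma> the set \<open>E\<close> becomes a set \<open>Z\<close> of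
  parameters, and \<open>glue_borel\<close> applies. The path may leave \<Omega>', where nothing is
  known about \<open>h\<close>; integrability along it is available near compact parts of
  \<open>E\<close>, which explains the shape of the hypothesis on \<open>H\<close> in
  \<open>glue_borel\<close>.\<close>

lemma loc_wug_glue:
  assumes o: "open \<Omega>" "bounded \<Omega>" "open \<Omega>'" "\<Omega>' \<subseteq> \<Omega>"
    and g: "loc_wug p M \<Omega> u g" and h: "loc_wug p M \<Omega>' v h"
    and E: "E \<in> sets borel" "E \<subseteq> \<Omega>'" and uv: "\<And>x. x \<in> E \<Longrightarrow> u x = v x"
  obtains \<rho> where "Lp_fun p M \<rho>"
    "\<And>\<gamma>. \<gamma> \<in> rect_paths \<Omega> \<Longrightarrow> path_integral \<rho> \<gamma> < \<infinity> \<Longrightarrow> ug_ineq u (\<lambda>x. if x \<in> E then h x else g x) \<gamma>"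
proof -
  have bd': "bounded \<Omega>'" using o by (auto intro: bounded_subset)
  obtain \<rho>1 where \<rho>1: "Lp_fun p M \<rho>1"
    "\<And>\<gamma>. \<gamma> \<in> rect_paths \<Omega> \<Longrightarrow> path_integral \<rho>1 \<gamma> < \<infinity> \<Longrightarrow> ug_ineq u g \<gamma>"
    "\<And>\<gamma> \<Omega>' K. \<gamma> \<in> rect_paths \<Omega>' \<Longrightarrow> path_integral \<rho>1 \<gamma> < \<infinity> \<Longrightarrow> compact K \<Longrightarrow> K \<subseteq> \<Omega> \<Longrightarrow>
       \<exists>B. open B \<and> K \<subseteq> B \<and> B \<subseteq> \<Omega> \<and> path_integral (\<lambda>x. g x * indicator B x) \<gamma> < \<infinity>"
    by (rule loc_wug_good_paths[OF g o(1,2)]) (rule that)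
  obtain \<rho>2 where \<rho>2: "Lp_fun p M \<rho>2"
    "\<And>\<gamma>. \<gamma> \<in> rect_paths \<Omega>' \<Longrightarrow> path_integral \<rho>2 \<gamma> < \<infinity> \<Longrightarrow> ug_ineq v h \<gamma>"
    "\<And>\<gamma> \<Omega>'' K. \<gamma> \<in> rect_paths \<Omega>'' \<Longrightarrow> path_integral \<rho>2 \<gamma> < \<infinity> \<Longrightarrow> compact K \<Longrightarrow> K \<subseteq> \<Omega>' \<Longrightarrow>
       \<exists>B. open B \<and> K \<subseteq> B \<and> B \<subseteq> \<Omega>' \<and> path_integral (\<lambda>x. h x * indicator B x) \<gamma> < \<infinity>"
    by (rule loc_wug_good_paths[OF h o(3) bd']) (rule that)
  \<comment> \<open>The two functions are presented as a sequence, so that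
    \<open>Lp_fun_combine\<close> joins them.\<close>
  have "Lp_fun p M (if i = 0 then \<rho>1 else \<rho>2)" for i :: nat using \<rho>1(1) \<rho>2(1) by simp
  then obtain \<rho> c where \<rho>: "Lp_fun p M \<rho>" "\<And>i. 0 < c i" 
     "\<And>i x. ennreal (c i) * (if i = (0::nat) then \<rho>1 else \<rho>2) x \<le> \<rho> x"
    by (rule Lp_fun_combine[of p M "\<lambda>i. if i = 0 then \<rho>1 else \<rho>2", OF p_pos sets_M]) (rule that)
  have fin: "path_integral \<rho>1 \<gamma> < \<infinity>" "path_integral \<rho>2 \<gamma> < \<infinity>"
    if "\<gamma> \<in> rect_paths \<Omega>''" "path_integral \<rho> \<gamma> < \<infinity>" for \<gamma> \<Omega>''
  proof -
    show "path_integral \<rho>1 \<gamma> < \<infinity>"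
      by (rule path_integral_dominated[OF that(1) _ \<rho>(2)[of 0] _ that(2)])
        (use \<rho>1(1) \<rho>(3)[of 0] in \<open>auto simp: Lp_fun_def\<close>)
    show "path_integral \<rho>2 \<gamma> < \<infinity>"
      by (rule path_integral_dominated[OF that(1) _ \<rho>(2)[of 1] _ that(2)])
        (use \<rho>2(1) \<rho>(3)[of 1] in \<open>auto simp: Lp_fun_def\<close>)
  qed
  define g0 where "g0 x = g x * indicator \<Omega> x" for x
  define h0 where "h0 x = h x * indicator \<Omega>' x" for x
  have [measurable]: "g0 \<in> borel_measurable borel" "h0 \<in> borel_measurable borel"
    using g h o unfolding g0_def h0_def by (auto simp: loc_wug_iff)
  note [measurable] = E(1)
  have \<rho>_borel [measurable]: "\<rho> \<in> borel_measurable borel" using \<rho>(1) by (simp add: Lp_fun_def)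
  show thesis
  proof (rule that[OF \<rho>(1)])
    fix \<gamma> assume \<gamma>: "\<gamma> \<in> rect_paths \<Omega>" and \<gamma>fin: "path_integral \<rho> \<gamma> < \<infinity>"
    obtain l :: real and \<sigma> where l: "0 < l" and ends: "\<sigma> 0 = pathstart \<gamma>" "\<sigma> l = pathfinish \<gamma>"
      and im: "\<sigma> ` {0..l} \<subseteq> \<Omega>" and lip: "1-lipschitz_on {0..l} \<sigma>"
      and pi: "\<And>g. path_integral g \<gamma> = (\<integral>\<^sup>+s\<in>{0..l}. g (\<sigma> s) \<partial>lborel)"
      and sub: "\<And>\<Omega>' a b. 0 \<le> a \<Longrightarrow> a < b \<Longrightarrow> b \<le> l \<Longrightarrow> \<sigma> ` {a..b} \<subseteq> \<Omega>' \<Longrightarrow>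
       \<exists>\<gamma>'\<in>rect_paths \<Omega>'. pathstart \<gamma>' = \<sigma> a \<and> pathfinish \<gamma>' = \<sigma> b \<and>
         (\<forall>g\<in>borel_measurable borel. path_integral g \<gamma>' = (\<integral>\<^sup>+s\<in>{a..b}. g (\<sigma> s) \<partial>lborel))"
      by (rule rect_path_arc[OF \<gamma>]) (rule that, assumption+)
    have cont: "continuous_on {0..l} \<sigma>" using lip by (rule lipschitz_on_continuous_on)
    have \<sigma>m: "(\<lambda>s. f (\<sigma> s) * indicator {0..l} s) \<in> borel_measurable borel"
      if "f \<in> borel_measurable borel" for f :: "'x \<Rightarrow> ennreal"
      by (rule borel_measurable_on_path[OF cont that]) auto
    define G where "G s = g0 (\<sigma> s) * indicator {0..l} s" for s
    define H where "H s = h0 (\<sigma> s) * indicator {0..l} s" for s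
    define f where "f s = real_of_ereal (u (\<sigma> s))" for s
    have GH[measurable]: "G \<in> borel_measurable borel" "H \<in> borel_measurable borel"
      unfolding G_def H_def by (rule \<sigma>m; measurable)+
    \<comment> \<open>Pieces of a good path are good, so the upper gradient inequalities are
      available on subintervals.\<close>
    have subfin: "path_integral \<rho> \<gamma>' < \<infinity>"
      if "path_integral \<rho> \<gamma>' = (\<integral>\<^sup>+s\<in>{a..b}. \<rho> (\<sigma> s) \<partial>lborel)" "0 \<le> a" "b \<le> l" for \<gamma>' a b
    proof -
      have "path_integral \<rho> \<gamma>' \<le> path_integral \<rho> \<gamma>"
        unfolding that(1) pi using that(2,3) by (intro nn_integral_mono) (auto simp: indicator_def)
      then show ?thesis using \<gamma>fin by (rule order.strict_trans1)
    qed
    have Ioc: "(\<integral>\<^sup>+s\<in>{a..b}. k s \<partial>lborel) = (\<integral>\<^sup>+s\<in>{a<..b}. k s \<partial>lborel)" for k :: "real \<Rightarrow> ennreal" and a b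
    proof (rule nn_integral_cong_AE)
      show "AE s in lborel. k s * indicator {a..b} s = k s * indicator {a<..b} s"
        using AE_lborel_singleton[of a] by eventually_elim (auto simp: indicator_def)
    qed
    obtain B where B: "open B" "\<sigma> ` {0..l} \<subseteq> B" "path_integral (\<lambda>x. g x * indicator B x) \<gamma> < \<infinity>"
      using \<rho>1(3)[OF \<gamma> fin(1)[OF \<gamma> \<gamma>fin] compact_continuous_image[OF cont] im] by auto
    have finG: "(\<integral>\<^sup>+s\<in>{0<..l}. G s \<partial>lborel) < \<infinity>"
    proof -
      have "(\<integral>\<^sup>+s\<in>{0<..l}. G s \<partial>lborel) \<le> path_integral (\<lambda>x. g x * indicator B x) \<gamma>"
        unfolding pi using B(2) by (intro nn_integral_mono) (auto simp: indicator_def G_def g0_def image_subset_iff)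
      then show ?thesis using B(3) by (rule order.strict_trans1)
    qed
    have ug: "e2ennreal \<bar>u (\<sigma> a) - u (\<sigma> b)\<bar> \<le> (\<integral>\<^sup>+s\<in>{a<..b}. G s \<partial>lborel)"
      if ab: "0 \<le> a" "a < b" "b \<le> l" for a b
    proof -
      have im': "\<sigma> ` {a..b} \<subseteq> \<Omega>" using im ab by (auto simp: image_subset_iff)
      obtain \<gamma>' where \<gamma>': "\<gamma>' \<in> rect_paths \<Omega>" "pathstart \<gamma>' = \<sigma> a" "pathfinish \<gamma>' = \<sigma> b"
        "\<And>g. g \<in> borel_measurable borel \<Longrightarrow> path_integral g \<gamma>' = (\<integral>\<^sup>+s\<in>{a..b}. g (\<sigma> s) \<partial>lborel)"
        using sub[OF ab im'] by blast
      have "ug_ineq u g \<gamma>'"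
        using \<gamma>'(1) fin(1)[OF \<gamma>'(1)] subfin[OF \<gamma>'(4)[OF \<rho>_borel] ab(1,3)] by (intro \<rho>1(2)) auto
      then have "e2ennreal \<bar>u (\<sigma> a) - u (\<sigma> b)\<bar> \<le> path_integral g0 \<gamma>'"
        using path_integral_cong[OF \<gamma>'(1), of g g0] by (simp add: ug_ineq_def \<gamma>' g0_def)
      also have "\<dots> = (\<integral>\<^sup>+s\<in>{a..b}. G s \<partial>lborel)"
        using ab by (subst \<gamma>'(4)) (auto intro!: nn_integral_cong simp: G_def indicator_def)
      finally show ?thesis by (simp add: Ioc)
    qed
    \<comment> \<open>Each point is joined to an end of the path by a piece with finite integral of
      \<open>G\<close>, so \<open>u\<close> is finite along \<sigma>; this permits real
      differences.\<close>
    have fin_u: "\<bar>u (\<sigma> s)\<bar> \<noteq> \<infinity>" if "s \<in> {0..l}" for s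
    proof -
      have le: "(\<integral>\<^sup>+s\<in>{a<..b}. G s \<partial>lborel) \<le> (\<integral>\<^sup>+s\<in>{0<..l}. G s \<partial>lborel)" if "0 \<le> a" "b \<le> l" for a b
        using that by (intro nn_integral_mono) (auto simp: indicator_def)
      show ?thesis
      proof (cases "s = l")
        case True
        have "e2ennreal \<bar>u (\<sigma> 0) - u (\<sigma> l)\<bar> < \<infinity>"
          using ug[of 0 l] le[of 0 l] finG l by (auto intro: order.strict_trans1)
        from e2ennreal_abs_diff_finite(2)[OF this] show ?thesis using True by simp
      next
        case False
        then have "e2ennreal \<bar>u (\<sigma> s) - u (\<sigma> l)\<bar> < \<infinity>"
          using ug[of s l] le[of s l] finG that by (auto intro: order.strict_trans1)
        from e2ennreal_abs_diff_finite(1)[OF this] show ?thesis .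
      qed
    qed
    define Z where "Z = {s \<in> {0..l}. \<sigma> s \<in> E}"
    have "Z = \<sigma> -` E \<inter> space (restrict_space borel {0..l})" by (auto simp: Z_def space_restrict_space)
    also have "\<dots> \<in> sets (restrict_space borel {0..l})"
      using borel_measurable_continuous_on_restrict[OF cont] E(1) by (rule measurable_sets)
    finally have Z: "Z \<in> sets borel" by (auto simp: sets_restrict_space_iff)
    have "ennreal \<bar>f 0 - f l\<bar> \<le> (\<integral>\<^sup>+s\<in>{0<..l}. (if s \<in> Z then H s else G s) \<partial>lborel)"
    proof (rule glue_borel[OF GH _ _ finG Z])
      show "ennreal \<bar>f a - f b\<bar> \<le> (\<integral>\<^sup>+s\<in>{a<..b}. G s \<partial>lborel)" if "0 \<le> a" "a \<le> b" "b \<le> l" for a b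
      proof (cases "a = b")
        case False
        then show ?thesis using ug[of a b] fin_u[of a] fin_u[of b] that
          by (simp add: f_def e2ennreal_abs_diff_real)
      qed simp
      show "0 \<le> l" using l by simp
      show "Z \<subseteq> {0..l}" by (auto simp: Z_def)
      fix K assume K: "compact K" "K \<subseteq> Z"
      have K': "K \<subseteq> {0..l}" using K by (auto simp: Z_def)
      have cK: "compact (\<sigma> ` K)"
        using continuous_on_subset[OF cont K'] K(1) by (rule compact_continuous_image)
      have sK: "\<sigma> ` K \<subseteq> \<Omega>'" using K(2) E(2) by (auto simp: Z_def)
      \<comment> \<open>On a good path, local integrability of \<open>h\<close> in \<Omega>' gives a
        neighbourhood of the compact image of \<open>K\<close> over which the path integral is
        finite.\<close>
      obtain B where B: "open B" "\<sigma> ` K \<subseteq> B" "B \<subseteq> \<Omega>'"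
        "path_integral (\<lambda>x. h x * indicator B x) \<gamma> < \<infinity>"
        using \<rho>2(3)[OF \<gamma> fin(2)[OF \<gamma> \<gamma>fin] cK sK] by blast
      \<comment> \<open>The relatively open preimage of \<open>B\<close> in [0, l], extended to an
        open set of reals.\<close>
      obtain W where W: "open W" "W \<inter> {0..l} = \<sigma> -` B \<inter> {0..l}"
        using cont B(1) unfolding continuous_on_open_invariant by blast
      show "\<exists>W. open W \<and> K \<subseteq> W \<and> (\<integral>\<^sup>+s\<in>W \<inter> {0<..l}. H s \<partial>lborel) < \<infinity> \<and>
         (\<forall>a\<in>K. \<forall>b\<in>K. a \<le> b \<longrightarrow> {a..b} \<subseteq> W \<longrightarrow>
            ennreal \<bar>f a - f b\<bar> \<le> (\<integral>\<^sup>+s\<in>{a<..b}. H s \<partial>lborel))"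
      proof (intro exI[of _ W] conjI ballI impI)
        show "open W" by fact
        show "K \<subseteq> W" using W(2) B(2) K' by blast
        have "(\<integral>\<^sup>+s\<in>W \<inter> {0<..l}. H s \<partial>lborel) \<le> path_integral (\<lambda>x. h x * indicator B x) \<gamma>"
          unfolding pi
        proof (rule nn_integral_mono)
          fix s
          have "s \<in> W \<inter> {0<..l} \<Longrightarrow> \<sigma> s \<in> B \<and> s \<in> {0..l}" using W(2) by fastforce
          then show "H s * indicator (W \<inter> {0<..l}) s \<le> h (\<sigma> s) * indicator B (\<sigma> s) * indicator {0..l} s"
            by (auto simp: H_def h0_def indicator_def)
        qed
        then show "(\<integral>\<^sup>+s\<in>W \<inter> {0<..l}. H s \<partial>lborel) < \<infinity>" using B(4) by (rule order.strict_trans1)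
        fix a b assume ab: "a \<in> K" "b \<in> K" "a \<le> b" "{a..b} \<subseteq> W"
        show "ennreal \<bar>f a - f b\<bar> \<le> (\<integral>\<^sup>+s\<in>{a<..b}. H s \<partial>lborel)"
        proof (cases "a = b")
          case False
          then have ab': "0 \<le> a" "a < b" "b \<le> l" using ab K' by auto
          have "\<sigma> ` {a..b} \<subseteq> B"
          proof
            fix x assume "x \<in> \<sigma> ` {a..b}"
            then obtain s where s: "s \<in> {a..b}" "x = \<sigma> s" by auto
            then have "s \<in> W \<inter> {0..l}" using ab(4) ab' by auto
            then show "x \<in> B" unfolding W(2) using s by simp
          qed
          then have im': "\<sigma> ` {a..b} \<subseteq> \<Omega>'" using B(3) by blast
          obtain \<gamma>' where \<gamma>': "\<gamma>' \<in> rect_paths \<Omega>'" "pathstart \<gamma>' = \<sigma> a" "pathfinish \<gamma>' = \<sigma> b"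
            "\<And>g. g \<in> borel_measurable borel \<Longrightarrow> path_integral g \<gamma>' = (\<integral>\<^sup>+s\<in>{a..b}. g (\<sigma> s) \<partial>lborel)"
            using sub[OF ab' im'] by blast
          have "ug_ineq v h \<gamma>'"
            using \<gamma>'(1) fin(2)[OF \<gamma>'(1)] subfin[OF \<gamma>'(4)[OF \<rho>_borel] ab'(1,3)] by (intro \<rho>2(2)) auto
          then have "e2ennreal \<bar>v (\<sigma> a) - v (\<sigma> b)\<bar> \<le> path_integral h0 \<gamma>'"
            using path_integral_cong[OF \<gamma>'(1), of h h0] by (simp add: ug_ineq_def \<gamma>' h0_def)
          also have "\<dots> = (\<integral>\<^sup>+s\<in>{a..b}. H s \<partial>lborel)"
            using ab' by (subst \<gamma>'(4)) (auto intro!: nn_integral_cong simp: H_def indicator_def)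
          also have "\<dots> = (\<integral>\<^sup>+s\<in>{a<..b}. H s \<partial>lborel)" by (rule Ioc)
          \<comment> \<open>Agreement of the two functions enters at the end points, which lie in
            \<open>E\<close>; in between the path may leave \<open>E\<close> but stays in
            \<Omega>'.\<close>
          also have "v (\<sigma> a) = u (\<sigma> a)" using ab(1) K(2) by (intro uv[symmetric]) (auto simp: Z_def)
          also have "v (\<sigma> b) = u (\<sigma> b)" using ab(2) K(2) by (intro uv[symmetric]) (auto simp: Z_def)
          finally have "e2ennreal \<bar>u (\<sigma> a) - u (\<sigma> b)\<bar> \<le> (\<integral>\<^sup>+s\<in>{a<..b}. H s \<partial>lborel)" .
          moreover have "\<bar>u (\<sigma> a)\<bar> \<noteq> \<infinity>" "\<bar>u (\<sigma> b)\<bar> \<noteq> \<infinity>"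
            by (rule fin_u; use ab' in simp)+
          ultimately show ?thesis
            unfolding f_def by (simp only: e2ennreal_abs_diff_real not_False_eq_True)
        qed simp
      qed
    qed
    also have "\<dots> \<le> path_integral (\<lambda>x. if x \<in> E then h x else g x) \<gamma>"
      unfolding pi
    proof (rule nn_integral_mono)
      fix s
      show "(if s \<in> Z then H s else G s) * indicator {0<..l} s
        \<le> (if \<sigma> s \<in> E then h (\<sigma> s) else g (\<sigma> s)) * indicator {0..l} s"
        by (cases "s \<in> {0<..l}"; cases "\<sigma> s \<in> E")
          (auto simp: G_def H_def Z_def g0_def h0_def indicator_def)
    qed
    finally have *: "ennreal \<bar>f 0 - f l\<bar> \<le> path_integral (\<lambda>x. if x \<in> E then h x else g x) \<gamma>" .
    have "\<bar>u (\<sigma> 0)\<bar> \<noteq> \<infinity>" "\<bar>u (\<sigma> l)\<bar> \<noteq> \<infinity>"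
      by (rule fin_u; use l in simp)+
    with * show "ug_ineq u (\<lambda>x. if x \<in> E then h x else g x) \<gamma>"
      unfolding ug_ineq_def ends[symmetric] f_def by (simp only: e2ennreal_abs_diff_real not_False_eq_True)
  qed
qed

end

lemma ennreal_inverse_antimono:
  assumes "a \<le> b"
  shows "inverse b \<le> inverse (a::ennreal)"
proof (cases "a = 0 \<or> b = top")
  case False
  with assms have "0 < a" "a < top" "b < top" by (auto simp: less_top zero_less_iff_neq_zero top_unique)
  then obtain r s where "a = ennreal r" "b = ennreal s" "0 < r"
    by (cases a; cases b) auto
  with assms show ?thesis
    by (auto simp: inverse_ennreal ennreal_le_iff2 intro!: ennreal_leI le_imp_inverse_le)
qed auto

text \<open>The value 0 is taken at \<infinity>, while finite arguments have positive values, on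
  which real arithmetic applies.\<close>

lemma ennreal_inverse_1_plus_inj:
  fixes a b :: ennreal
  assumes "inverse (1 + a) = inverse (1 + b)"
  shows "a = b"
proof -
  have *: "inverse (1 + ennreal r) = ennreal (inverse (1 + r))" if "0 \<le> r" for r
    using that inverse_ennreal[of "1 + r"] by simp
  have "0 < inverse (1 + r)" if "0 \<le> r" for r :: real using that by simp
  then show ?thesis using assms * by (cases a; cases b) fastforce+
qed

context proper_measure_space
begin

lemma ug_ineq_mono:
  assumes "ug_ineq u g \<gamma>" "\<gamma> \<in> rect_paths \<Omega>" "\<And>x. x \<in> \<Omega> \<Longrightarrow> g x \<le> h x"
  shows "ug_ineq u h \<gamma>"
proof -
  have "path_integral g \<gamma> \<le> path_integral (\<lambda>x. if x \<in> \<Omega> then h x else \<infinity>) \<gamma>"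
    using assms(3) by (intro path_integral_mono) auto
  also have "\<dots> = path_integral h \<gamma>"
    using assms(2) by (rule path_integral_cong) auto
  finally show ?thesis using assms(1) unfolding ug_ineq_def by (rule order_trans[rotated])
qed

text \<open>Gluing is restricted to points with \<open>h x < g x\<close>, so the energy does not
  grow and local integrability is inherited from \<open>g\<close>. The set of these points is Borel
  because it is described by the Borel functions \<open>g0\<close> and \<open>h0\<close>.\<close>

lemma loc_wug_min:
  assumes o: "open \<Omega>" "bounded \<Omega>" "open \<Omega>'" "\<Omega>' \<subseteq> \<Omega>"
    and g: "loc_wug p M \<Omega> u g" and h: "loc_wug p M \<Omega>' v h"
    and E: "E \<in> sets borel" "E \<subseteq> \<Omega>'" and uv: "\<And>x. x \<in> E \<Longrightarrow> u x = v x"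
  shows "loc_wug p M \<Omega> u (\<lambda>x. if x \<in> E \<and> h x < g x then h x else g x)"
proof -
  let ?k = "\<lambda>x. if x \<in> E \<and> h x < g x then h x else g x"
  define g0 where "g0 x = g x * indicator \<Omega> x" for x
  define h0 where "h0 x = h x * indicator \<Omega>' x" for x
  have [measurable]: "g0 \<in> borel_measurable borel" "h0 \<in> borel_measurable borel"
    using g h o unfolding g0_def h0_def by (auto simp: loc_wug_iff)
  note [measurable] = E(1)
  define E' where "E' = {x \<in> E. h0 x < g0 x}"
  have E': "E' \<in> sets borel" "E' \<subseteq> \<Omega>'" using E(2) by (auto simp: E'_def)
  note [measurable] = E'(1)
  have E'_iff: "x \<in> E' \<longleftrightarrow> x \<in> E \<and> h x < g x" for x
    using E(2) o(4) by (auto simp: E'_def h0_def g0_def indicator_def)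
  obtain \<rho> where \<rho>: "Lp_fun p M \<rho>"
    "\<And>\<gamma>. \<gamma> \<in> rect_paths \<Omega> \<Longrightarrow> path_integral \<rho> \<gamma> < \<infinity> \<Longrightarrow> ug_ineq u (\<lambda>x. if x \<in> E' then h x else g x) \<gamma>"
    by (rule loc_wug_glue[OF o g h E' uv]) (auto simp: E'_iff intro: that)
  have "(\<lambda>x. ?k x * indicator \<Omega> x) = (\<lambda>x. if x \<in> E' then h0 x else g0 x)"
  proof
    fix x show "?k x * indicator \<Omega> x = (if x \<in> E' then h0 x else g0 x)"
      using E(2) o(4) by (auto simp: E'_iff g0_def h0_def indicator_def)
  qed
  then have "(\<lambda>x. ?k x * indicator \<Omega> x) \<in> borel_measurable borel" by simp
  moreover have "(\<integral>\<^sup>+x\<in>B. epow (?k x) p \<partial>M) < \<infinity>" if "open B \<and> compactly_in B \<Omega>" for B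
  proof -
    have "(\<integral>\<^sup>+x\<in>B. epow (?k x) p \<partial>M) \<le> (\<integral>\<^sup>+x\<in>B. epow (g x) p \<partial>M)"
      using p_pos by (intro nn_integral_mono mult_right_mono epow_mono) auto
    also have "\<dots> < \<infinity>" using g that unfolding loc_wug_iff[OF o(1)] by blast
    finally show ?thesis .
  qed
  ultimately show ?thesis
    unfolding loc_wug_iff[OF o(1)] using \<rho> by (auto simp: E'_iff)
qed

text \<open>Minimality is tested against the competitor from \<open>loc_wug_min\<close>, which lies
  strictly below \<open>g\<close> wherever \<open>h x < g x\<close> on \<open>E\<close>.\<close>

lemma minimal_wug_le:
  assumes o: "open \<Omega>" "bounded \<Omega>" "open \<Omega>'" "\<Omega>' \<subseteq> \<Omega>"
    and g: "minimal_wug p M \<Omega> u g" and h: "loc_wug p M \<Omega>' v h"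
    and E: "E \<in> sets borel" "E \<subseteq> \<Omega>'" and uv: "\<And>x. x \<in> E \<Longrightarrow> u x = v x"
  shows "AE x in M. x \<in> E \<longrightarrow> g x \<le> h x"
proof -
  have g1: "loc_wug p M \<Omega> u g" using g by (simp add: minimal_wug_iff)
  have "AE x in M. x \<in> \<Omega> \<longrightarrow> g x \<le> (if x \<in> E \<and> h x < g x then h x else g x)"
    using g loc_wug_min[OF o g1 h E uv] by (simp add: minimal_wug_iff)
  then show ?thesis
    by eventually_elim (use E(2) o(4) in \<open>auto split: if_splits\<close>)
qed

text \<open>Locality: with \<open>v = u\<close> this compares the minimal weak upper gradients on \<open>\<Omega>\<close> and on an open
  subset, and with \<open>\<Omega>' = \<Omega>\<close> those of two functions that agree on \<open>E\<close>.\<close>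

lemma minimal_wug_agree:
  assumes o: "open \<Omega>" "bounded \<Omega>" "open \<Omega>'" "\<Omega>' \<subseteq> \<Omega>"
    and g: "minimal_wug p M \<Omega> u g" and h: "minimal_wug p M \<Omega>' v h"
    and E: "E \<in> sets borel" "E \<subseteq> \<Omega>'" and uv: "\<And>x. x \<in> E \<Longrightarrow> u x = v x"
  shows "AE x in M. x \<in> E \<longrightarrow> g x = h x"
proof -
  have "AE x in M. x \<in> E \<longrightarrow> g x \<le> h x"
    using h by (intro minimal_wug_le[OF o g _ E uv]) (auto simp: minimal_wug_iff)
  \<comment> \<open>The roles are exchanged with \<Omega>' as ambient set, where \<open>g\<close> is
    a competitor by restriction.\<close>
  moreover have "AE x in M. x \<in> E \<longrightarrow> h x \<le> g x"
  proof (rule minimal_wug_le[OF o(3) _ o(3) subset_refl h _ E])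
    show "bounded \<Omega>'" using o by (auto intro: bounded_subset)
    show "loc_wug p M \<Omega>' u g"
      using g by (intro loc_wug_restrict[OF _ o(1,3,4)]) (auto simp: minimal_wug_iff)
    show "v x = u x" if "x \<in> E" for x using uv[OF that] by simp
  qed
  ultimately show ?thesis by eventually_elim auto
qed

text \<open>Monotone convergence from above along good paths. It starts from a finite integral,
  supplied by the integrability of \<open>m 0\<close> near the compact image of the path.\<close>

lemma loc_wug_INF:
  fixes m :: "nat \<Rightarrow> 'x \<Rightarrow> ennreal"
  assumes o: "open \<Omega>" "bounded \<Omega>" and m: "\<And>n. loc_wug p M \<Omega> u (m n)" and dec: "decseq m"
  shows "loc_wug p M \<Omega> u (\<lambda>x. INF n. m n x)"
proof -
  have le: "(INF n. m n x) \<le> m 0 x" for x by (rule INF_lower) simp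
  have [measurable]: "(\<lambda>x. m n x * indicator \<Omega> x) \<in> borel_measurable borel" for n
    using m[of n] unfolding loc_wug_iff[OF o(1)] by blast
  have "(\<lambda>x. (INF n. m n x) * indicator \<Omega> x) = (\<lambda>x. INF n. m n x * indicator \<Omega> x)"
    by (auto simp: indicator_def fun_eq_iff)
  then have meas: "(\<lambda>x. (INF n. m n x) * indicator \<Omega> x) \<in> borel_measurable borel" by simp
  have fin: "(\<integral>\<^sup>+x\<in>B. epow (INF n. m n x) p \<partial>M) < \<infinity>" if "open B \<and> compactly_in B \<Omega>" for B
  proof -
    have "(\<integral>\<^sup>+x\<in>B. epow (INF n. m n x) p \<partial>M) \<le> (\<integral>\<^sup>+x\<in>B. epow (m 0 x) p \<partial>M)"
      using p_pos by (intro nn_integral_mono mult_right_mono epow_mono le) auto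
    also have "\<dots> < \<infinity>" using m[of 0] that unfolding loc_wug_iff[OF o(1)] by blast
    finally show ?thesis .
  qed
  obtain \<rho>0 where \<rho>0: "Lp_fun p M \<rho>0"
    "\<And>\<gamma>. \<gamma> \<in> rect_paths \<Omega> \<Longrightarrow> path_integral \<rho>0 \<gamma> < \<infinity> \<Longrightarrow> ug_ineq u (m 0) \<gamma>"
    "\<And>\<gamma> \<Omega>' K. \<gamma> \<in> rect_paths \<Omega>' \<Longrightarrow> path_integral \<rho>0 \<gamma> < \<infinity> \<Longrightarrow> compact K \<Longrightarrow> K \<subseteq> \<Omega> \<Longrightarrow>
       \<exists>B. open B \<and> K \<subseteq> B \<and> B \<subseteq> \<Omega> \<and> path_integral (\<lambda>x. m 0 x * indicator B x) \<gamma> < \<infinity>"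
    by (rule loc_wug_good_paths[OF m o]) (rule that)
  have "\<exists>\<rho>. Lp_fun p M \<rho> \<and> (\<forall>\<gamma>\<in>rect_paths \<Omega>. path_integral \<rho> \<gamma> < \<infinity> \<longrightarrow> ug_ineq u (m n) \<gamma>)" for n
    using m[of n] unfolding loc_wug_iff[OF o(1)] by blast
  then obtain r where r: "\<And>n. Lp_fun p M (r n)"
    "\<And>n \<gamma>. \<gamma> \<in> rect_paths \<Omega> \<Longrightarrow> path_integral (r n) \<gamma> < \<infinity> \<Longrightarrow> ug_ineq u (m n) \<gamma>" by metis
  \<comment> \<open>Index 0 secures integrability of \<open>m 0\<close>, index \<open>n + 1\<close>
    the upper gradient inequality for \<open>m n\<close>.\<close>
  define r' where "r' n = (if n = 0 then \<rho>0 else r (n - 1))" for n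
  have r': "Lp_fun p M (r' n)" for n using r(1) \<rho>0(1) by (simp add: r'_def)
  obtain \<rho> c where \<rho>: "Lp_fun p M \<rho>" "\<And>i. 0 < c i" "\<And>i x. ennreal (c i) * r' i x \<le> \<rho> x"
    by (rule Lp_fun_combine[of p M r', OF p_pos sets_M r']) (rule that)
  have "ug_ineq u (\<lambda>x. INF n. m n x) \<gamma>" if \<gamma>: "\<gamma> \<in> rect_paths \<Omega>" "path_integral \<rho> \<gamma> < \<infinity>" for \<gamma>
  proof -
    have fin: "path_integral (r' i) \<gamma> < \<infinity>" for i
      using r'[of i] by (intro path_integral_dominated[OF \<gamma>(1) _ \<rho>(2,3)[of i] \<gamma>(2)]) (simp add: Lp_fun_def)
    have ug: "ug_ineq u (m n) \<gamma>" for n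
      using r(2)[OF \<gamma>(1), of n] fin[of "Suc n"] by (simp add: r'_def)
    obtain l :: real and \<sigma> where im: "\<sigma> ` {0..l} \<subseteq> \<Omega>" and lip: "1-lipschitz_on {0..l} \<sigma>"
      and pi: "\<And>g. path_integral g \<gamma> = (\<integral>\<^sup>+s\<in>{0..l}. g (\<sigma> s) \<partial>lborel)"
      by (rule rect_path_arc[OF \<gamma>(1)]) (rule that, assumption+)
    have cont: "continuous_on {0..l} \<sigma>" using lip by (rule lipschitz_on_continuous_on)
    obtain B where B: "\<sigma> ` {0..l} \<subseteq> B" "path_integral (\<lambda>x. m 0 x * indicator B x) \<gamma> < \<infinity>"
      using \<rho>0(3)[OF \<gamma>(1) _ compact_continuous_image[OF cont compact_Icc] im] fin[of 0] by (auto simp: r'_def)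
    have eq: "m n (\<sigma> s) * indicator {0..l} s = (m n (\<sigma> s) * indicator \<Omega> (\<sigma> s)) * indicator {0..l} s" for n s
      using im by (auto simp: indicator_def image_subset_iff)
    have meas: "(\<lambda>s. m n (\<sigma> s) * indicator {0..l} s) \<in> borel_measurable lborel" for n
      unfolding eq by (simp, rule borel_measurable_on_path[OF cont, where g = "\<lambda>x. m n x * indicator \<Omega> x"]) auto
    have "path_integral (\<lambda>x. INF n. m n x) \<gamma> = (\<integral>\<^sup>+s. (INF n. m n (\<sigma> s) * indicator {0..l} s) \<partial>lborel)"
      unfolding pi by (intro nn_integral_cong) (auto simp: indicator_def)
    also have "\<dots> = (INF n. path_integral (m n) \<gamma>)"
      unfolding pi
    proof (rule nn_integral_monotone_convergence_INF_decseq[where i=0])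
      show "decseq (\<lambda>n s. m n (\<sigma> s) * indicator {0..l} s)"
        using decseq_SucD[OF dec] by (intro decseq_SucI) (simp add: le_fun_def mult_right_mono)
      show "(\<lambda>s. m n (\<sigma> s) * indicator {0..l} s) \<in> borel_measurable lborel" for n by (rule meas)
      have "(\<integral>\<^sup>+s. m 0 (\<sigma> s) * indicator {0..l} s \<partial>lborel) = path_integral (\<lambda>x. m 0 x * indicator B x) \<gamma>"
        unfolding pi using B(1) by (intro nn_integral_cong) (auto simp: indicator_def image_subset_iff)
      then show "(\<integral>\<^sup>+s. m 0 (\<sigma> s) * indicator {0..l} s \<partial>lborel) < \<infinity>" using B(2) by simp
    qed
    finally show ?thesis
      using ug unfolding ug_ineq_def by (auto intro: INF_greatest)
  qed
  then show ?thesis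
    unfolding loc_wug_iff[OF o(1)] using meas fin \<rho>(1) by blast
qed

text \<open>Minimality is obtained by maximizing \<open>\<integral> w / (1 + g)\<close> for a positive integrable weight \<open>w\<close>: this
  functional is finite and strictly decreasing in \<open>g\<close>.\<close>

lemma minimal_wug_exists:
  assumes o: "open \<Omega>" "bounded \<Omega>" and g: "loc_wug p M \<Omega> u g0"
  obtains g where "minimal_wug p M \<Omega> u g"
proof -
  interpret sigma_finite_measure M by (rule sigma_finite_M)
  obtain w where w: "(\<integral>\<^sup>+x. w x \<partial>M) \<noteq> \<infinity>" "\<And>x. 0 < w x" "\<And>x. w x < \<infinity>"
    and [measurable]: "w \<in> borel_measurable M"
    using Ex_finite_integrable_function by auto
  define F where "F g x = inverse (1 + g x * indicator \<Omega> x) * w x" for g :: "'x \<Rightarrow> ennreal" and x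
  define J where "J g = (\<integral>\<^sup>+x. F g x \<partial>M)" for g
  have inv1: "inverse (1 + a) \<le> (1::ennreal)" for a
    using ennreal_inverse_antimono[of 1 "1 + a"] by simp
  have F_le: "F g x \<le> w x" for g x
    unfolding F_def using mult_right_mono[OF inv1, of "w x"] by simp
  have J_fin: "J g < \<infinity>" for g
  proof -
    have "J g \<le> (\<integral>\<^sup>+x. w x \<partial>M)" unfolding J_def by (intro nn_integral_mono F_le)
    then show ?thesis using w(1) by (simp add: less_top top_unique order.strict_trans1)
  qed
  have F_anti: "F h x \<le> F g x" if "g x \<le> h x" for g h x
    unfolding F_def using that by (intro mult_right_mono ennreal_inverse_antimono add_left_mono) auto
  have meas: "F g \<in> borel_measurable M" if "loc_wug p M \<Omega> u g" for g
  proof -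
    have [measurable]: "(\<lambda>x. g x * indicator \<Omega> x) \<in> borel_measurable borel"
      using that unfolding loc_wug_iff[OF o(1)] by blast
    show ?thesis unfolding F_def by measurable
  qed
  define W where "W = {g. loc_wug p M \<Omega> u g}"
  have "J ` W \<noteq> {}" using g by (auto simp: W_def)
  then obtain f :: "nat \<Rightarrow> ennreal" where f: "range f \<subseteq> J ` W" "Sup (J ` W) = (SUP n. f n)"
    using ennreal_Sup_countable_SUP by metis
  then have "\<exists>g. loc_wug p M \<Omega> u g \<and> f n = J g" for n by (auto simp: W_def)
  then obtain a where a: "\<And>n. loc_wug p M \<Omega> u (a n)" "\<And>n. f n = J (a n)" by metis
  \<comment> \<open>The competitor from \<open>loc_wug_min\<close> with \<open>E\<close> equal to
    \<Omega> coincides with the minimum on \<Omega>, and the defining properties look at values in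
    \<Omega>.\<close>
  have wmin: "loc_wug p M \<Omega> u (\<lambda>x. min (g x) (h x))" if "loc_wug p M \<Omega> u g" "loc_wug p M \<Omega> u h" for g h
  proof -
    have "loc_wug p M \<Omega> u (\<lambda>x. if x \<in> \<Omega> \<and> h x < g x then h x else g x)"
      using o by (intro loc_wug_min[OF o o(1) subset_refl that]) auto
    moreover have "(\<lambda>x. (if x \<in> \<Omega> \<and> h x < g x then h x else g x) * indicator \<Omega> x)
        = (\<lambda>x. min (g x) (h x) * indicator \<Omega> x)"
      by (auto simp: indicator_def fun_eq_iff min_def)
    moreover have "(\<integral>\<^sup>+x\<in>B. epow (min (g x) (h x)) p \<partial>M) \<le> (\<integral>\<^sup>+x\<in>B. epow (g x) p \<partial>M)" for B
      using p_pos by (intro nn_integral_mono mult_right_mono epow_mono) auto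
    moreover have "ug_ineq u (\<lambda>x. min (g x) (h x)) \<gamma>"
      if "ug_ineq u (\<lambda>x. if x \<in> \<Omega> \<and> h x < g x then h x else g x) \<gamma>" "\<gamma> \<in> rect_paths \<Omega>" for \<gamma>
      using that by (rule ug_ineq_mono) (auto simp: min_def)
    ultimately show ?thesis
      using that(1) unfolding loc_wug_iff[OF o(1)] by (metis (no_types, lifting) order.strict_trans1)
  qed
  \<comment> \<open>Running minima of a maximizing sequence: still competitors, and decreasing, so
    that their infimum is a competitor as well.\<close>
  define m where "m = rec_nat (a 0) (\<lambda>n mn x. min (mn x) (a (Suc n) x))"
  have m_Suc: "m (Suc n) = (\<lambda>x. min (m n x) (a (Suc n) x))" for n by (simp add: m_def)
  have m: "loc_wug p M \<Omega> u (m n)" for n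
  proof (induction n)
    case 0 then show ?case using a(1) by (simp add: m_def)
  next
    case (Suc n) then show ?case unfolding m_Suc using a(1) by (rule wmin)
  qed
  have dec: "decseq m" by (intro decseq_SucI) (auto simp: m_Suc le_fun_def)
  have m_le: "m n x \<le> a n x" for n x by (cases n) (auto simp: m_Suc, simp add: m_def)
  define g where "g x = (INF n. m n x)" for x
  have gW: "loc_wug p M \<Omega> u g"
    unfolding g_def by (rule loc_wug_INF[OF o m dec])
  have J_le: "J h \<le> J g" if "loc_wug p M \<Omega> u h" for h
  proof -
    have "f n \<le> J g" for n
      unfolding a(2) J_def g_def
      by (intro nn_integral_mono F_anti) (meson INF_lower UNIV_I m_le order_trans)
    then have "Sup (J ` W) \<le> J g" unfolding f(2) by (rule SUP_least)
    moreover have "J h \<le> Sup (J ` W)" using that by (intro Sup_upper) (auto simp: W_def)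
    ultimately show ?thesis by (rule order_trans[rotated])
  qed
  have "AE x in M. x \<in> \<Omega> \<longrightarrow> g x \<le> h x" if h: "loc_wug p M \<Omega> u h" for h
  proof -
    \<comment> \<open>The competitor \<open>k\<close> lies below \<open>g\<close>, so its functional
      is at least as large and by maximality equal. As the value is finite, the integrands agree
      almost everywhere.\<close>
    define k where "k x = min (g x) (h x)" for x
    have k: "loc_wug p M \<Omega> u k" unfolding k_def by (rule wmin[OF gW h])
    note [measurable] = meas[OF k] meas[OF gW]
    have le: "F g x \<le> F k x" for x by (intro F_anti) (simp add: k_def)
    have "(\<integral>\<^sup>+x. F k x - F g x \<partial>M) = J k - J g"
      unfolding J_def using J_fin[of g] le by (intro nn_integral_diff) (auto simp: J_def)
    also have "\<dots> = 0" using J_le[OF k] by (simp add: diff_eq_0_iff_ennreal J_fin[simplified])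
    finally have "AE x in M. F k x - F g x = 0"
      by (subst (asm) nn_integral_0_iff_AE) auto
    then show ?thesis
    proof eventually_elim
      case (elim x)
      show ?case
      proof
        assume x: "x \<in> \<Omega>"
        have fin: "F k x < \<infinity>" "F g x < \<infinity>"
          using F_le[of k x] F_le[of g x] w(3)[of x] by (auto intro: order.strict_trans1)
        with elim have "F k x \<le> F g x" by (simp add: diff_eq_0_iff_ennreal)
        with le[of x] have "F k x = F g x" by simp
        then have "inverse (1 + k x) = inverse (1 + g x)"
          using w(2)[of x] w(3)[of x] x unfolding F_def by (auto simp: mult.commute[of _ "w x"] ennreal_mult_cancel_left)
        then have "k x = g x" by (rule ennreal_inverse_1_plus_inj)
        then show "g x \<le> h x" by (simp add: k_def min_def split: if_splits)
      qed
    qed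
  qed
  then have "minimal_wug p M \<Omega> u g" using gW unfolding minimal_wug_iff by blast
  then show thesis by (rule that)
qed

text \<open>Slices of \<open>u\<close> are known to be Newtonian on compactly contained sets, while
  \<open>par_ugrad\<close> needs a gradient on all of \<Omega>. By locality the minimal gradients on
  the sets \<open>B n\<close> agree almost everywhere, and each path in \<Omega> lies in one of
  these sets by compactness.\<close>

lemma loc_wug_exhaust:
  fixes B :: "nat \<Rightarrow> 'x set"
  assumes o: "open \<Omega>" "bounded \<Omega>"
    and B: "\<And>n. open (B n)" "\<And>n. compactly_in (B n) \<Omega>" "incseq B"
      "\<And>K. compact K \<Longrightarrow> K \<subseteq> \<Omega> \<Longrightarrow> \<exists>n. K \<subseteq> B n"
    and ex: "\<And>n. \<exists>g. loc_wug p M (B n) u g"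
  shows "\<exists>g. loc_wug p M \<Omega> u g"
proof -
  have sub: "B n \<subseteq> \<Omega>" for n using B(2)[of n] closure_subset unfolding compactly_in_def by blast
  have bd: "bounded (B n)" for n using o(2) sub by (rule bounded_subset)
  have "\<exists>g. minimal_wug p M (B n) u g" for n
    using ex[of n] minimal_wug_exists[OF B(1) bd] by blast
  then obtain G where G: "\<And>n. minimal_wug p M (B n) u (G n)" by metis
  have GW: "loc_wug p M (B n) u (G n)" for n using G[of n] by (simp add: minimal_wug_iff)
  \<comment> \<open>The supremum dominates every \<open>G n\<close> pointwise on \<open>B n\<close>,
    as is needed along paths, and still equals \<open>G n\<close> almost everywhere there.\<close>
  define g where "g x = (SUP n. G n x * indicator (B n) x)" for x
  have agree: "AE x in M. x \<in> B n \<longrightarrow> G m x = G n x" if "n \<le> m" for n m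
    using B(1)[of n] incseqD[OF B(3) that] by (intro minimal_wug_agree[OF B(1) bd B(1) _ G G]) auto
  have ae: "AE x in M. x \<in> B n \<longrightarrow> g x \<le> G n x" for n
  proof -
    have "AE x in M. x \<in> B (min n m) \<longrightarrow> G (max n m) x = G (min n m) x" for m
      by (rule agree) simp
    then have "AE x in M. \<forall>m. x \<in> B (min n m) \<longrightarrow> G (max n m) x = G (min n m) x"
      by (simp add: AE_all_countable)
    then show ?thesis
    proof eventually_elim
      case (elim x)
      show ?case
      proof
        assume x: "x \<in> B n"
        have "G m x * indicator (B m) x \<le> G n x" for m
          using elim[rule_format, of m] x by (cases "n \<le> m") (auto simp: indicator_def)
        then show "g x \<le> G n x" unfolding g_def by (intro SUP_least)
      qed
    qed
  qed
  have [measurable]: "(\<lambda>x. G n x * indicator (B n) x) \<in> borel_measurable borel" for n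
    using GW[of n] unfolding loc_wug_iff[OF B(1)] by blast
  have [measurable]: "g \<in> borel_measurable borel"
    unfolding g_def by (rule borel_measurable_SUP) auto
  have [measurable]: "\<Omega> \<in> sets borel" using o(1) by simp
  have "(\<lambda>x. g x * indicator \<Omega> x) \<in> borel_measurable borel"
    by measurable
  moreover have "(\<integral>\<^sup>+x\<in>C. epow (g x) p \<partial>M) < \<infinity>" if C: "open C \<and> compactly_in C \<Omega>" for C
  proof -
    obtain n where n: "closure C \<subseteq> B n" using B(4)[of "closure C"] C by (auto simp: compactly_in_def)
    have "(\<integral>\<^sup>+x\<in>C. epow (g x) p \<partial>M) \<le> (\<integral>\<^sup>+x\<in>C. epow (G n x) p \<partial>M)"
    proof (rule nn_integral_mono_AE)
      show "AE x in M. epow (g x) p * indicator C x \<le> epow (G n x) p * indicator C x"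
        using ae[of n]
      proof eventually_elim
        case (elim x)
        have "C \<subseteq> B n" using n closure_subset by blast
        with elim p_pos show ?case by (auto simp: indicator_def intro!: epow_mono)
      qed
    qed
    also have "\<dots> < \<infinity>"
      using GW[of n] C n unfolding loc_wug_iff[OF B(1)] compactly_in_def by blast
    finally show ?thesis .
  qed
  moreover have "\<exists>\<rho>. Lp_fun p M \<rho> \<and> (\<forall>\<gamma>\<in>rect_paths \<Omega>. path_integral \<rho> \<gamma> < \<infinity> \<longrightarrow> ug_ineq u g \<gamma>)"
  proof -
    have "\<exists>\<rho>. Lp_fun p M \<rho> \<and> (\<forall>\<gamma>\<in>rect_paths (B n). path_integral \<rho> \<gamma> < \<infinity> \<longrightarrow> ug_ineq u (G n) \<gamma>)" for n
      using GW[of n] unfolding loc_wug_iff[OF B(1)] by blast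
    then obtain r where r: "\<And>n. Lp_fun p M (r n)"
      "\<And>n \<gamma>. \<gamma> \<in> rect_paths (B n) \<Longrightarrow> path_integral (r n) \<gamma> < \<infinity> \<Longrightarrow> ug_ineq u (G n) \<gamma>" by metis
    obtain \<rho> c where \<rho>: "Lp_fun p M \<rho>" "\<And>i. 0 < c i" "\<And>i x. ennreal (c i) * r i x \<le> \<rho> x"
      by (rule Lp_fun_combine[of p M r, OF p_pos sets_M r(1)]) (rule that)
    have "ug_ineq u g \<gamma>" if \<gamma>: "\<gamma> \<in> rect_paths \<Omega>" "path_integral \<rho> \<gamma> < \<infinity>" for \<gamma>
    proof -
      have im: "path_image \<gamma> \<subseteq> \<Omega>" "path \<gamma>" using \<gamma>(1) by (auto simp: rect_paths_def)
      have "compact (path_image \<gamma>)"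
        using im(2) unfolding path_def path_image_def by (rule compact_continuous_image) simp
      then obtain n where n: "path_image \<gamma> \<subseteq> B n" using B(4) im(1) by blast
      have \<gamma>n: "\<gamma> \<in> rect_paths (B n)" using \<gamma>(1) n by (auto simp: rect_paths_def)
      have "path_integral (r n) \<gamma> < \<infinity>"
        using r(1)[of n] by (intro path_integral_dominated[OF \<gamma>(1) _ \<rho>(2,3)[of n] \<gamma>(2)]) (simp add: Lp_fun_def)
      then have "ug_ineq u (G n) \<gamma>" using \<gamma>n by (intro r(2))
      then show ?thesis
        by (rule ug_ineq_mono[OF _ \<gamma>n]) (auto simp: g_def intro!: SUP_upper2[of n])
    qed
    then show ?thesis using \<rho>(1) by blast
  qed
  ultimately show ?thesis
    unfolding loc_wug_iff[OF o(1)] by blast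
qed

section \<open>Newtonian functions and Lipschitz perturbations\<close>

lemma Lp_fun_0: "Lp_fun p M (\<lambda>_. 0)"
  by (simp add: Lp_fun_def)

lemma newtonian_loc_wug:
  assumes "newtonian p M B u" "open B"
  shows "\<exists>g. loc_wug p M B u g"
proof -
  obtain g where g: "upper_gradient B u g" "in_Lp p M B (\<lambda>x. enn2ereal (g x))"
    using assms(1) by (auto simp: newtonian_def)
  have gm: "g \<in> borel_measurable (restrict_space borel B)"
    and ug: "\<And>\<gamma>. \<gamma> \<in> rect_paths B \<Longrightarrow> ug_ineq u g \<gamma>" using g(1) by (auto simp: upper_gradient_def)
  have "(\<integral>\<^sup>+x\<in>C. epow (g x) p \<partial>M) < \<infinity>" if "compactly_in C B" for C
  proof -
    have "C \<subseteq> B" using that closure_subset unfolding compactly_in_def by blast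
    then have "(\<integral>\<^sup>+x\<in>C. epow (g x) p \<partial>M) \<le> (\<integral>\<^sup>+x\<in>B. epow (g x) p \<partial>M)"
      by (intro nn_integral_mono) (auto simp: indicator_def)
    also have "\<dots> < \<infinity>" using g(2) in_Lp_ennreal_iff[OF assms(2) gm] by simp
    finally show ?thesis .
  qed
  then have "loc_wug p M B u g"
    unfolding loc_wug_iff[OF assms(2)] borel_restrict_iff[OF assms(2), symmetric]
    using gm ug Lp_fun_0 by blast
  then show ?thesis by blast
qed

lemma minimal_wug_min_ugrad:
  assumes "open \<Omega>" "bounded \<Omega>" "\<exists>g. loc_wug p M \<Omega> u g"
  shows "minimal_wug p M \<Omega> u (min_ugrad p M \<Omega> u)"
proof -
  have "\<exists>g. minimal_wug p M \<Omega> u g" using assms minimal_wug_exists by blast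
  then show ?thesis unfolding min_ugrad_def by (simp add: someI_ex)
qed

text \<open>The parametrization is 1-Lipschitz, so the length dominates the distance of the end
  points, and the constant \<open>L\<close> contributes \<open>L\<close> times the length.\<close>

lemma path_integral_add_const:
  assumes \<gamma>: "\<gamma> \<in> rect_paths \<Omega>" and g: "(\<lambda>x. g x * indicator \<Omega> x) \<in> borel_measurable borel" and L: "0 \<le> L"
  shows "path_integral g \<gamma> + ennreal (L * dist (pathstart \<gamma>) (pathfinish \<gamma>)) \<le> path_integral (\<lambda>x. g x + ennreal L) \<gamma>"
proof -
  obtain l :: real and \<sigma> where l: "0 < l" and ends: "\<sigma> 0 = pathstart \<gamma>" "\<sigma> l = pathfinish \<gamma>"
    and im: "\<sigma> ` {0..l} \<subseteq> \<Omega>" and lip: "1-lipschitz_on {0..l} \<sigma>"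
    and pi: "\<And>g. path_integral g \<gamma> = (\<integral>\<^sup>+s\<in>{0..l}. g (\<sigma> s) \<partial>lborel)"
    by (rule rect_path_arc[OF \<gamma>]) (rule that, assumption+)
  have "dist (\<sigma> 0) (\<sigma> l) \<le> 1 * dist 0 l" by (rule lipschitz_onD[OF lip]) (use l in auto)
  then have d: "L * dist (pathstart \<gamma>) (pathfinish \<gamma>) \<le> L * l"
    using l L by (intro mult_left_mono) (auto simp: ends)
  have cont: "continuous_on {0..l} \<sigma>" using lip by (rule lipschitz_on_continuous_on)
  have eq: "g (\<sigma> s) * indicator {0..l} s = (g (\<sigma> s) * indicator \<Omega> (\<sigma> s)) * indicator {0..l} s" for s
    using im by (auto simp: indicator_def image_subset_iff)
  have [measurable]: "(\<lambda>s. g (\<sigma> s) * indicator {0..l} s) \<in> borel_measurable borel"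
    unfolding eq by (rule borel_measurable_on_path[OF cont g]) auto
  have "path_integral (\<lambda>x. g x + ennreal L) \<gamma> = path_integral g \<gamma> + (\<integral>\<^sup>+s. ennreal L * indicator {0..l} s \<partial>lborel)"
    unfolding pi by (simp add: distrib_right nn_integral_add)
  also have "(\<integral>\<^sup>+s. ennreal L * indicator {0..l} s \<partial>lborel) = ennreal (L * l)"
    using l L by (simp add: nn_integral_cmult_indicator ennreal_mult)
  finally show ?thesis using d by (simp add: add_left_mono ennreal_leI)
qed

text \<open>The factor comes from \<open>a + b \<le> 2 * max a b\<close>; the estimate serves to
  show that energies are finite.\<close>

lemma epow_add_le: "0 < q \<Longrightarrow> epow (a + b) q \<le> ennreal (2 powr q) * epow a q + ennreal (2 powr q) * epow b q"
proof -
  assume q: "0 < q"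
  have le: "a + b \<le> ennreal 2 * max a b"
  proof -
    have "a + b \<le> max a b + max a b" by (intro add_mono) auto
    also have "\<dots> = ennreal 2 * max a b" by (metis mult_2 ennreal_numeral zero_le_numeral)
    finally show ?thesis .
  qed
  have "epow (a + b) q \<le> epow (ennreal 2 * max a b) q" using le q by (intro epow_mono) auto
  also have "\<dots> = ennreal (2 powr q) * epow (max a b) q" using q by (intro epow_cmult) auto
  also have "\<dots> \<le> ennreal (2 powr q) * (epow a q + epow b q)"
    by (intro mult_left_mono) (auto simp: max_def add_increasing add_increasing2)
  finally show ?thesis by (simp add: distrib_left)
qed

text \<open>This provides minimal gradients for the slices of \<open>u + \<phi>\<close> and bounds
  them by those of \<open>u\<close> up to the Lipschitz constant.\<close>

lemma loc_wug_add_lipschitz: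
  assumes o: "open \<Omega>" and g: "loc_wug p M \<Omega> u g" and \<phi>: "L-lipschitz_on \<Omega> \<phi>"
  shows "loc_wug p M \<Omega> (\<lambda>x. u x + ereal (\<phi> x)) (\<lambda>x. g x + ennreal L)"
proof -
  have L: "0 \<le> L" using \<phi> by (rule lipschitz_on_nonneg)
  have gm[measurable]: "(\<lambda>x. g x * indicator \<Omega> x) \<in> borel_measurable borel"
    using g unfolding loc_wug_iff[OF o] by blast
  have [measurable]: "\<Omega> \<in> sets borel" using o by simp
  have "(\<lambda>x. g x * indicator \<Omega> x + ennreal L * indicator \<Omega> x) \<in> borel_measurable borel" by measurable
  then have "(\<lambda>x. (g x + ennreal L) * indicator \<Omega> x) \<in> borel_measurable borel" by (simp add: distrib_right)
  moreover have "(\<integral>\<^sup>+x\<in>B. epow (g x + ennreal L) p \<partial>M) < \<infinity>" if B: "open B \<and> compactly_in B \<Omega>" for B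
  proof -
    have [measurable]: "B \<in> sets borel" using B by simp
    have sub: "B \<subseteq> \<Omega>" using B closure_subset unfolding compactly_in_def by blast
    have "bounded B" using B unfolding compactly_in_def by (meson bounded_closure_image bounded_subset closure_subset compact_imp_bounded)
    then have fB: "emeasure M B < \<infinity>" by (rule finite_bounded)
    have [measurable]: "(\<lambda>x. epow (g x) p * indicator B x) \<in> borel_measurable borel"
    proof -
      have "(\<lambda>x. epow (g x * indicator \<Omega> x) p * indicator B x) \<in> borel_measurable borel" by measurable
      also have "(\<lambda>x. epow (g x * indicator \<Omega> x) p * indicator B x) = (\<lambda>x. epow (g x) p * indicator B x)"
        using sub by (auto simp: indicator_def fun_eq_iff)
      finally show ?thesis .
    qed
    have "(\<integral>\<^sup>+x\<in>B. epow (g x + ennreal L) p \<partial>M)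
      \<le> (\<integral>\<^sup>+x. ennreal (2 powr p) * (epow (g x) p * indicator B x) + ennreal (2 powr p) * epow (ennreal L) p * indicator B x \<partial>M)"
      using epow_add_le[OF p_pos] by (intro nn_integral_mono) (auto simp: indicator_def)
    also have "\<dots> = ennreal (2 powr p) * (\<integral>\<^sup>+x\<in>B. epow (g x) p \<partial>M) + ennreal (2 powr p) * epow (ennreal L) p * emeasure M B"
      by (simp add: nn_integral_add nn_integral_cmult nn_integral_cmult_indicator sets_M)
    also have "\<dots> < \<infinity>"
      using g B fB unfolding loc_wug_iff[OF o] by (simp add: ennreal_mult_less_top)
    finally show ?thesis .
  qed
  moreover have "\<exists>\<rho>. Lp_fun p M \<rho> \<and> (\<forall>\<gamma>\<in>rect_paths \<Omega>. path_integral \<rho> \<gamma> < \<infinity> \<longrightarrow>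
      ug_ineq (\<lambda>x. u x + ereal (\<phi> x)) (\<lambda>x. g x + ennreal L) \<gamma>)"
  proof -
    obtain \<rho> where \<rho>: "Lp_fun p M \<rho>" "\<And>\<gamma>. \<gamma> \<in> rect_paths \<Omega> \<Longrightarrow> path_integral \<rho> \<gamma> < \<infinity> \<Longrightarrow> ug_ineq u g \<gamma>"
      using g unfolding loc_wug_iff[OF o] by blast
    have "ug_ineq (\<lambda>x. u x + ereal (\<phi> x)) (\<lambda>x. g x + ennreal L) \<gamma>"
      if \<gamma>: "\<gamma> \<in> rect_paths \<Omega>" "path_integral \<rho> \<gamma> < \<infinity>" for \<gamma>
    proof -
      define x y where "x = pathstart \<gamma>" and "y = pathfinish \<gamma>"
      have xy: "x \<in> \<Omega>" "y \<in> \<Omega>"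
        using \<gamma>(1) unfolding x_def y_def rect_paths_def by (auto simp: subset_iff)
      have ug: "e2ennreal \<bar>u x - u y\<bar> \<le> path_integral g \<gamma>"
        using \<rho>(2)[OF \<gamma>] by (simp add: ug_ineq_def x_def y_def)
      have "\<bar>\<phi> x - \<phi> y\<bar> \<le> L * dist x y" using lipschitz_onD[OF \<phi> xy] by (simp add: dist_real_def)
      then have \<phi>xy: "ennreal \<bar>\<phi> x - \<phi> y\<bar> \<le> ennreal (L * dist x y)" by (rule ennreal_leI)
      have "e2ennreal \<bar>(u x + ereal (\<phi> x)) - (u y + ereal (\<phi> y))\<bar> \<le> e2ennreal \<bar>u x - u y\<bar> + ennreal \<bar>\<phi> x - \<phi> y\<bar>"
      proof (cases "\<bar>u x\<bar> = \<infinity> \<or> \<bar>u y\<bar> = \<infinity>")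
        \<comment> \<open>An infinite value of \<open>u\<close> makes the right-hand side
          infinite.\<close>
        case True
        then have "\<bar>u x - u y\<bar> = \<infinity>" by (cases "u x"; cases "u y") auto
        then show ?thesis by (simp add: e2ennreal_infty)
      next
        case False
        then obtain a where a: "u x = ereal a" by (cases "u x") auto
        obtain b where b: "u y = ereal b" using False by (cases "u y") auto
        have "ennreal \<bar>(a + \<phi> x) - (b + \<phi> y)\<bar> \<le> ennreal (\<bar>a - b\<bar> + \<bar>\<phi> x - \<phi> y\<bar>)"
          by (intro ennreal_leI) linarith
        then show ?thesis by (simp add: a b)
      qed
      also have "\<dots> \<le> path_integral g \<gamma> + ennreal (L * dist x y)"
        by (intro add_mono ug \<phi>xy)
      also have "\<dots> \<le> path_integral (\<lambda>x. g x + ennreal L) \<gamma>"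
        unfolding x_def y_def by (rule path_integral_add_const[OF \<gamma>(1) gm L])
      finally show ?thesis by (simp add: ug_ineq_def x_def y_def)
    qed
    then show ?thesis using \<rho>(1) by blast
  qed
  ultimately show ?thesis unfolding loc_wug_iff[OF o] by blast
qed

end

text \<open>Above the truncation level the test function is lowered by a constant, which leaves all
  differences along paths unchanged.\<close>

lemma minimal_wug_add_const:
  "minimal_wug p M \<Omega> (\<lambda>x. u x + ereal c) g \<longleftrightarrow> minimal_wug p M \<Omega> u g"
proof -
  have "\<bar>(a + ereal c) - (b + ereal c)\<bar> = \<bar>a - b\<bar>" for a b :: ereal
    by (cases a; cases b) auto
  then have "ug_ineq (\<lambda>x. u x + ereal c) h \<gamma> \<longleftrightarrow> ug_ineq u h \<gamma>" for h \<gamma>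
    by (simp add: ug_ineq_def)
  then show ?thesis by (simp add: minimal_wug_def weak_upper_gradient_def)
qed

section \<open>Doubling measures\<close>

text \<open>A packing argument. For an e-separated subset of \<open>S\<close> the balls of radius
  e/2 are disjoint, and doubling bounds the measure of each from below by a fixed fraction of that
  of \<open>ball a R\<close>. So the cardinality is bounded, and a separated set of maximal
  cardinality is an e-net.\<close>

lemma doubling_proper:
  fixes M :: "'x::complete_space measure"
  assumes M: "doubling_measure M" and S: "closed (S::'x set)" "bounded S"
  shows "compact S"
  unfolding compact_eq_totally_bounded
proof (intro conjI allI impI)
  show "complete S" using S(1) by (simp add: complete_eq_closed)
  fix e :: real assume e: "0 < e"
  have sM: "sets M = sets borel" using M by (simp add: doubling_measure_def)
  obtain a R0 where R0: "S \<subseteq> cball a R0" using S(2) by (auto simp: bounded_subset_cball)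
  define R where "R = max R0 0 + 1"
  have R: "S \<subseteq> ball a R" "0 < R" using R0 by (auto simp: R_def)
  obtain C where C: "1 \<le> C" "\<And>x r. 0 < r \<Longrightarrow> emeasure M (ball x (2 * r)) \<le> ennreal C * emeasure M (ball x r)"
    using M unfolding doubling_measure_def by blast
  have pos: "0 < emeasure M (ball x r)" and fin: "emeasure M (ball x r) < \<infinity>" if "0 < r" for x r
    using M that by (auto simp: doubling_measure_def)
  define m where "m x r = measure M (ball x r)" for x r
  have em: "emeasure M (ball x r) = ennreal (m x r)" if "0 < r" for x r
    using fin[OF that, of x] by (simp add: m_def emeasure_eq_ennreal_measure less_top)
  have m_pos: "0 < m x r" if "0 < r" for x r using pos[OF that, of x] em[OF that, of x] by simp
  have m_dbl: "m x (2 * r) \<le> C * m x r" if "0 < r" for x r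
  proof -
    have "ennreal (m x (2 * r)) \<le> ennreal (C * m x r)"
      using C(2)[OF that, of x] C(1) m_pos[OF that, of x] that by (simp add: em ennreal_mult)
    then show ?thesis using C(1) m_pos[OF that, of x] by (simp add: ennreal_le_iff)
  qed
  have m_pow: "m x (2 ^ n * r) \<le> C ^ n * m x r" if "0 < r" for x r n
  proof (induction n)
    case (Suc n)
    have "m x (2 * (2 ^ n * r)) \<le> C * m x (2 ^ n * r)" using that by (intro m_dbl) simp
    also have "\<dots> \<le> C * (C ^ n * m x r)" using Suc C(1) by (intro mult_left_mono) auto
    finally show ?case by (simp add: mult.assoc)
  qed simp
  \<comment> \<open>After \<open>n\<close> doublings the ball of radius e/2 about a point of
    \<open>S\<close> contains \<open>ball a R\<close>, all of whose points have distance less than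
    \<open>2 * R\<close> from it.\<close>
  obtain n where n: "2 * R / (e / 2) < 2 ^ n" using real_arch_pow[of 2 "2 * R / (e/2)"] by auto
  have low: "m a R \<le> C ^ n * m x (e / 2)" if "x \<in> S" for x
  proof -
    have "dist a x < R" using R that by auto
    have "2 * R \<le> 2 ^ n * (e / 2)" using n e by (simp add: field_simps)
    have "ball a R \<subseteq> ball x (2 ^ n * (e / 2))"
    proof
      fix y assume "y \<in> ball a R"
      then have "dist x y < 2 * R" using \<open>dist a x < R\<close> dist_triangle3[of x y a] by simp
      with \<open>2 * R \<le> _\<close> show "y \<in> ball x (2 ^ n * (e / 2))" by simp
    qed
    then have "emeasure M (ball a R) \<le> emeasure M (ball x (2 ^ n * (e / 2)))"
      by (intro emeasure_mono) (auto simp: sM)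
    then have "m a R \<le> m x (2 ^ n * (e / 2))"
      using e R(2) m_pos[of "2 ^ n * (e/2)" x] by (simp add: em ennreal_le_iff)
    also have "\<dots> \<le> C ^ n * m x (e / 2)" using e by (intro m_pow) simp
    finally show ?thesis .
  qed
  define sep where "sep F \<longleftrightarrow> finite F \<and> F \<subseteq> S \<and> (\<forall>x\<in>F. \<forall>y\<in>F. x \<noteq> y \<longrightarrow> e \<le> dist x y)" for F
  define N where "N = C ^ n * m a (R + e) / m a R"
  have card: "real (card F) \<le> N" if F: "sep F" for F
  proof -
    have sub: "(\<Union>x\<in>F. ball x (e/2)) \<subseteq> ball a (R + e)"
    proof (intro UN_least subsetI)
      fix x y assume "x \<in> F" "y \<in> ball x (e/2)"
      moreover then have "dist a x < R" using F R by (auto simp: sep_def)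
      ultimately show "y \<in> ball a (R + e)" using dist_triangle[of a y x] e by auto
    qed
    have disj: "disjoint_family_on (\<lambda>x. ball x (e/2)) F"
      unfolding disjoint_family_on_def
    proof (intro ballI impI)
      fix x y assume "x \<in> F" "y \<in> F" "x \<noteq> y"
      then have "e \<le> dist x y" using F by (auto simp: sep_def)
      then show "ball x (e/2) \<inter> ball y (e/2) = {}"
        using dist_triangle_half_r[of _ x e y] by (force simp: dist_commute)
    qed
    have "real (card F) * m a R = (\<Sum>x\<in>F. m a R)" by simp
    also have "\<dots> \<le> (\<Sum>x\<in>F. C ^ n * m x (e/2))" using F by (intro sum_mono low) (auto simp: sep_def)
    also have "\<dots> = C ^ n * (\<Sum>x\<in>F. m x (e/2))" by (simp add: sum_distrib_left)
    also have "(\<Sum>x\<in>F. m x (e/2)) \<le> m a (R + e)"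
    proof -
      have "ennreal (\<Sum>x\<in>F. m x (e/2)) = (\<Sum>x\<in>F. emeasure M (ball x (e/2)))"
        using e m_pos by (subst sum_ennreal[symmetric]) (auto simp: em less_imp_le)
      also have "\<dots> = emeasure M (\<Union>x\<in>F. ball x (e/2))"
        using F disj by (intro sum_emeasure) (auto simp: sep_def sM)
      also have "\<dots> \<le> emeasure M (ball a (R + e))"
        using sub by (intro emeasure_mono) (auto simp: sM)
      finally show ?thesis using e R(2) m_pos[of "R + e" a] by (simp add: em ennreal_le_iff)
    qed
    then have "C ^ n * (\<Sum>x\<in>F. m x (e/2)) \<le> C ^ n * m a (R + e)"
      using C(1) by (intro mult_left_mono) auto
    finally show ?thesis using m_pos[OF R(2), of a] by (simp add: N_def field_simps)
  qed
  have "\<exists>F. sep F \<and> (\<forall>F'. sep F' \<longrightarrow> card F' \<le> card F)"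
  proof (rule ex_has_greatest_nat)
    show "sep {}" by (simp add: sep_def)
    show "\<forall>F. sep F \<longrightarrow> card F < Suc (nat \<lceil>N\<rceil>)"
    proof (intro allI impI)
      fix F assume "sep F"
      then have "real (card F) \<le> real (nat \<lceil>N\<rceil>)" using card[of F] real_nat_ceiling_ge[of N] by linarith
      then show "card F < Suc (nat \<lceil>N\<rceil>)" by simp
    qed
  qed
  then obtain F where F: "sep F" "\<And>F'. sep F' \<Longrightarrow> card F' \<le> card F" by blast
  have "S \<subseteq> (\<Union>x\<in>F. ball x e)"
  proof
    fix y assume y: "y \<in> S"
    show "y \<in> (\<Union>x\<in>F. ball x e)"
    proof (rule ccontr)
      assume "y \<notin> (\<Union>x\<in>F. ball x e)"
      then have far: "e \<le> dist x y" if "x \<in> F" for x using that by (auto simp: not_less)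
      then have "y \<notin> F" using e by force
      have "sep (insert y F)" using F(1) y far by (auto simp: sep_def dist_commute)
      then have "card (insert y F) \<le> card F" by (rule F(2))
      then show False using F(1) \<open>y \<notin> F\<close> by (simp add: sep_def)
    qed
  qed
  then show "\<exists>k. finite k \<and> S \<subseteq> (\<Union>x\<in>k. ball x e)" using F(1) by (auto simp: sep_def)
qed

lemma doubling_proper_measure_space:
  fixes M :: "'x::complete_space measure"
  assumes M: "doubling_measure M" and p: "0 < p"
  shows "proper_measure_space M p"
proof
  show "0 < p" by fact
  show sM: "sets M = sets borel" using M by (simp add: doubling_measure_def)
  show "compact S" if "closed S" "bounded S" for S :: "'x set"
    using doubling_proper[OF M that] .
  fix S :: "'x set" assume "bounded S"
  then obtain a R where R: "S \<subseteq> ball a R" "0 < R"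
    by (metis bounded_subset_ballD)
  have "emeasure M S \<le> emeasure M (ball a R)" using R(1) by (intro emeasure_mono) (auto simp: sM)
  also have "\<dots> < \<infinity>" using M R(2) by (auto simp: doubling_measure_def)
  finally show "emeasure M S < \<infinity>" .
qed

section \<open>Borel sets of space-time\<close>

context proper_measure_space
begin

text \<open>Closed balls are compact, so finite nets of mesh 1/(k+1) in growing balls form a
  countable dense set; the balls of these radii around it are a basis.\<close>

lemma countable_basis_exists:
  obtains \<B> :: "'x set set" where "countable \<B>" "topological_basis \<B>"
proof -
  define a :: 'x where "a = undefined"
  have "\<exists>F. finite F \<and> cball a (real n) \<subseteq> (\<Union>x\<in>F. ball x (1 / real (Suc k)))" for n k :: nat
  proof -
    have "compact (cball a (real n))" by (intro proper) auto
    then show ?thesis by (simp add: compact_eq_totally_bounded)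
  qed
  then obtain F where F: "\<And>n k. finite (F n k)"
    "\<And>n k. cball a (real n) \<subseteq> (\<Union>x\<in>F n k. ball x (1 / real (Suc k)))" by metis
  define D where "D = (\<Union>n k. F n k)"
  define \<B> where "\<B> = (\<lambda>(x, k). ball x (1 / real (Suc k))) ` (D \<times> UNIV)"
  have "countable D" unfolding D_def by (simp add: countable_finite F(1))
  then have "countable \<B>" unfolding \<B>_def by (intro countable_image countable_SIGMA) auto
  moreover have "topological_basis \<B>"
  proof (rule topological_basisI)
    show "open B" if "B \<in> \<B>" for B using that by (auto simp: \<B>_def)
    fix U and x :: 'x assume "open U" "x \<in> U"
    then obtain e where e: "0 < e" "ball x e \<subseteq> U" by (meson open_contains_ball)
    obtain k where k: "1 / real (Suc k) < e / 2" using nat_approx_posE[of "e/2"] e(1) by auto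
    obtain n where "dist a x \<le> real n" using real_arch_simple by blast
    then have "x \<in> cball a (real n)" by simp
    from subsetD[OF F(2) this] obtain y where y: "y \<in> F n k" "dist y x < 1 / real (Suc k)"
      by (metis UN_E mem_ball)
    have "ball y (1 / real (Suc k)) \<subseteq> ball x e"
    proof
      fix z assume "z \<in> ball y (1 / real (Suc k))"
      then show "z \<in> ball x e" using y(2) k dist_triangle[of x z y] by (simp add: dist_commute)
    qed
    moreover have "ball y (1 / real (Suc k)) \<in> \<B>" using y(1) by (auto simp: \<B>_def D_def)
    ultimately show "\<exists>B\<in>\<B>. x \<in> B \<and> B \<subseteq> U" using y(2) e(2) by (intro bexI[of _ "ball y (1 / real (Suc k))"]) auto
  qed
  ultimately show thesis by (rule that)
qed

text \<open>Countable bases of both factors make every open subset of the product a countable union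
  of open rectangles. Thus open sets and supports are measurable for the product measure.\<close>

lemma sets_spacetime: "sets (spacetime M) = sets borel"
proof
  obtain \<B> :: "'x set set" where \<B>: "countable \<B>" "topological_basis \<B>" by (rule countable_basis_exists)
  obtain \<C> :: "real set set" where \<C>: "countable \<C>" "topological_basis \<C>" using ex_countable_basis by auto
  let ?P = "(\<lambda>(a, b). a \<times> b) ` (\<B> \<times> \<C>)"
  have P: "countable ?P" "topological_basis ?P"
    using \<B> \<C> by (auto intro: topological_basis_prod)
  have "?P \<subseteq> sets (spacetime M)"
    using \<B>(2) \<C>(2) by (auto simp: sets_M topological_basis_open intro!: pair_measureI)
  then have "sigma_sets UNIV ?P \<subseteq> sets (spacetime M)"
    using sets.sigma_sets_subset[of ?P "spacetime M"] by (simp add: space_pair_measure)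
  then show "sets borel \<subseteq> sets (spacetime M)"
    unfolding borel_eq_countable_basis[OF P] by simp
  have "{A \<times> B |A B. A \<in> sets M \<and> B \<in> sets lborel} \<subseteq> sets (borel :: ('x \<times> real) measure)"
  proof
    fix E :: "('x \<times> real) set" assume "E \<in> {A \<times> B |A B. A \<in> sets M \<and> B \<in> sets lborel}"
    then obtain A B where E: "E = A \<times> B" and "A \<in> sets M" "B \<in> sets lborel" by blast
    then have "fst -` A \<in> sets (borel :: ('x \<times> real) measure)" "snd -` B \<in> sets (borel :: ('x \<times> real) measure)"
      using measurable_sets[OF borel_measurable_continuous_onI[of fst], of A]
        measurable_sets[OF borel_measurable_continuous_onI[of snd], of B]
      by (auto simp: sets_M continuous_on_fst continuous_on_snd continuous_on_id)
    then have "fst -` A \<inter> snd -` B \<in> sets (borel :: ('x \<times> real) measure)" by (rule sets.Int)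
    then show "E \<in> sets borel" by (simp add: E vimage_fst vimage_snd Times_Int_Times)
  qed
  from sets.sigma_sets_subset[OF this] show "sets (spacetime M) \<subseteq> sets borel"
    by (simp add: sets_pair_measure)
qed

end

section \<open>The time derivative of a Lipschitz function\<close>

text \<open>Here \<open>deriv\<close> chooses among numbers with an unsatisfiable property, so its
  value is one fixed number for all such functions and points. This makes \<open>time_deriv\<close>
  Borel and bounded on the whole cylinder, and not merely up to null sets.\<close>

lemma deriv_not_differentiable:
  assumes "\<nexists>D. (f has_field_derivative D) (at t)"
  shows "deriv f t = (SOME D. False)"
  using assms by (simp add: deriv_def)

definition punctured :: "nat \<Rightarrow> real set" where
  "punctured k = {q. 0 < \<bar>q\<bar> \<and> \<bar>q\<bar> < 1 / real (Suc k)}"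

text \<open>The Cauchy criterion for difference quotients does not mention the derivative, so it can
  be turned into a description of the differentiability set. Quantifying over all
  \<open>k \<ge> k0\<close> lets finitely many small \<open>k\<close> be ignored, for which the
  increments may leave the domain.\<close>

lemma has_real_derivative_Cauchy_iff:
  fixes f :: "real \<Rightarrow> real"
  shows "(\<exists>D. (f has_field_derivative D) (at t)) \<longleftrightarrow>
    (\<forall>m::nat. \<exists>k0::nat. \<forall>k\<ge>k0. \<forall>q\<in>punctured k. \<forall>r\<in>punctured k.
      \<bar>(f (t + q) - f t) / q - (f (t + r) - f t) / r\<bar> \<le> 1 / real (Suc m))"
    (is "?L \<longleftrightarrow> ?R")
    and "(f has_field_derivative D) (at t) \<Longrightarrow>
      (\<lambda>n. (f (t + 1 / real (Suc n)) - f t) / (1 / real (Suc n))) \<longlonglongrightarrow> D"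
proof -
  define Q where "Q h = (f (t + h) - f t) / h" for h
  have has: "(f has_field_derivative D) (at t) \<longleftrightarrow> (Q \<longlongrightarrow> D) (at 0)" for D
    by (simp add: DERIV_def Q_def[abs_def])
  have seq: "(\<lambda>n. 1 / real (Suc n)) \<longlonglongrightarrow> 0" by (rule LIMSEQ_Suc[OF lim_1_over_n])
  have lim: "(\<lambda>n. Q (1 / real (Suc n))) \<longlonglongrightarrow> D" if "(Q \<longlongrightarrow> D) (at 0)" for D
    by (rule filterlim_compose[OF that]) (use seq in \<open>auto simp: filterlim_at\<close>)
  show "(f has_field_derivative D) (at t) \<Longrightarrow>
      (\<lambda>n. (f (t + 1 / real (Suc n)) - f t) / (1 / real (Suc n))) \<longlonglongrightarrow> D"
    using lim unfolding has Q_def by blast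
  show "?L \<longleftrightarrow> ?R"
    unfolding has Q_def[symmetric]
  proof
    assume "\<exists>D. (Q \<longlongrightarrow> D) (at 0)"
    then obtain D where D: "(Q \<longlongrightarrow> D) (at 0)" ..
    show "\<forall>m::nat. \<exists>k0::nat. \<forall>k\<ge>k0. \<forall>q\<in>punctured k. \<forall>r\<in>punctured k.
      \<bar>Q q - Q r\<bar> \<le> 1 / real (Suc m)"
    proof
      fix m :: nat
      define e where "e = 1 / real (Suc m)"
      have "0 < e / 2" by (simp add: e_def)
      then obtain d where d: "0 < d" "\<And>h. h \<noteq> 0 \<Longrightarrow> \<bar>h\<bar> < d \<Longrightarrow> \<bar>Q h - D\<bar> < e / 2"
        using LIM_D[OF D, of "e / 2"] by auto
      obtain k0 where k0: "1 / real (Suc k0) < d" using nat_approx_posE[OF d(1)] by blast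
      have "\<bar>Q q - Q r\<bar> \<le> 1 / real (Suc m)"
        if k: "k0 \<le> k" and qr': "q \<in> punctured k" "r \<in> punctured k" for k q r
      proof -
        have qr: "0 < \<bar>q\<bar>" "\<bar>q\<bar> < 1 / real (Suc k)" "0 < \<bar>r\<bar>" "\<bar>r\<bar> < 1 / real (Suc k)"
          using qr' by (simp_all add: punctured_def)
        have "1 / real (Suc k) \<le> 1 / real (Suc k0)" using k by (intro divide_left_mono) auto
        then have "\<bar>q\<bar> < d" "\<bar>r\<bar> < d" using qr k0 by linarith+
        then have "\<bar>Q q - D\<bar> < e / 2" "\<bar>Q r - D\<bar> < e / 2"
          using qr by (intro d(2); simp)+
        then show ?thesis unfolding e_def[symmetric] by linarith
      qed
      then show "\<exists>k0. \<forall>k\<ge>k0. \<forall>q\<in>punctured k. \<forall>r\<in>punctured k.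
        \<bar>Q q - Q r\<bar> \<le> 1 / real (Suc m)" by blast
    qed
  next
    assume R: "\<forall>m::nat. \<exists>k0::nat. \<forall>k\<ge>k0. \<forall>q\<in>punctured k. \<forall>r\<in>punctured k.
      \<bar>Q q - Q r\<bar> \<le> 1 / real (Suc m)"
    have est: "\<exists>d>0. \<forall>q r. 0 < \<bar>q\<bar> \<and> \<bar>q\<bar> < d \<and> 0 < \<bar>r\<bar> \<and> \<bar>r\<bar> < d \<longrightarrow> \<bar>Q q - Q r\<bar> < e" if e: "0 < e" for e
    proof -
      obtain m where m: "1 / real (Suc m) < e" using nat_approx_posE[OF e] by blast
      from spec[OF R, of m] obtain k0 where k0: "\<forall>k\<ge>k0. \<forall>q\<in>punctured k. \<forall>r\<in>punctured k.
        \<bar>Q q - Q r\<bar> \<le> 1 / real (Suc m)" by (rule exE)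
      show ?thesis
      proof (intro exI[of _ "1 / real (Suc k0)"] conjI allI impI)
        fix q r assume "0 < \<bar>q\<bar> \<and> \<bar>q\<bar> < 1 / real (Suc k0) \<and> 0 < \<bar>r\<bar> \<and> \<bar>r\<bar> < 1 / real (Suc k0)"
        then have "\<bar>Q q - Q r\<bar> \<le> 1 / real (Suc m)"
          by (intro k0[rule_format, OF order_refl]) (simp_all add: punctured_def)
        then show "\<bar>Q q - Q r\<bar> < e" using m by (rule order.strict_trans1)
      qed simp
    qed
    \<comment> \<open>A Cauchy sequence of quotients supplies the candidate for the
      derivative.\<close>
    define a where "a n = Q (1 / real (Suc n))" for n
    have small: "\<exists>N. \<forall>n\<ge>N. 1 / real (Suc n) < d" if "0 < d" for d
      using order_tendstoD(2)[OF seq that] by (auto simp: eventually_sequentially)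
    have "Cauchy a"
    proof (rule CauchyI)
      fix e :: real assume "0 < e"
      then obtain d where d: "0 < d" "\<And>q r. 0 < \<bar>q\<bar> \<Longrightarrow> \<bar>q\<bar> < d \<Longrightarrow> 0 < \<bar>r\<bar> \<Longrightarrow> \<bar>r\<bar> < d \<Longrightarrow> \<bar>Q q - Q r\<bar> < e"
        using est[OF \<open>0 < e\<close>] by (metis (no_types))
      obtain N where "\<And>n. n \<ge> N \<Longrightarrow> 1 / real (Suc n) < d" using small[OF d(1)] by blast
      then show "\<exists>N. \<forall>m\<ge>N. \<forall>n\<ge>N. norm (a m - a n) < e"
        unfolding a_def real_norm_def by (intro exI[of _ N] allI impI d(2)) auto
    qed
    then obtain D where D: "a \<longlonglongrightarrow> D" by (auto simp: Cauchy_convergent_iff convergent_def)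
    have "(Q \<longlongrightarrow> D) (at 0)"
    proof (rule LIM_I)
      fix e :: real assume e: "0 < e"
      then obtain d where d: "0 < d" "\<And>q r. 0 < \<bar>q\<bar> \<Longrightarrow> \<bar>q\<bar> < d \<Longrightarrow> 0 < \<bar>r\<bar> \<Longrightarrow> \<bar>r\<bar> < d \<Longrightarrow> \<bar>Q q - Q r\<bar> < e/2"
        using est[OF half_gt_zero[OF e]] by (metis (no_types))
      obtain N1 where N1: "\<And>n. n \<ge> N1 \<Longrightarrow> 1 / real (Suc n) < d" using small[OF d(1)] by blast
      obtain N2 where N2: "\<And>n. n \<ge> N2 \<Longrightarrow> \<bar>a n - D\<bar> < e/2" 
        using LIMSEQ_D[OF D, of "e/2"] e by auto
      define n where "n = max N1 N2"
      have n: "1 / real (Suc n) < d" "\<bar>a n - D\<bar> < e/2" using N1[of n] N2[of n] by (auto simp: n_def)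
      have "\<bar>Q h - D\<bar> < e" if "h \<noteq> 0" "\<bar>h\<bar> < d" for h
      proof -
        have "\<bar>Q h - a n\<bar> < e/2" unfolding a_def using that n(1) by (intro d(2)) auto
        with n(2) show ?thesis by linarith
      qed
      then show "\<exists>s>0. \<forall>x. x \<noteq> 0 \<and> norm (x - 0) < s \<longrightarrow> norm (Q x - D) < e"
        using d(1) by auto
    qed
    then show "\<exists>D. (Q \<longlongrightarrow> D) (at 0)" ..
  qed
qed

lemma cylinder_slice_param:
  assumes "(x, t) \<in> cylinder \<Omega> T"
  obtains k0 where "\<And>k. k \<ge> k0 \<Longrightarrow> 1 / real (Suc k) < t \<and> t + 1 / real (Suc k) < T"
proof -
  have "0 < min t (T - t)" using assms by auto
  then obtain k0 where k0: "1 / real (Suc k0) < min t (T - t)" using nat_approx_posE by blast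
  have "1 / real (Suc k) \<le> 1 / real (Suc k0)" if "k \<ge> k0" for k using that by (intro divide_left_mono) auto
  then show thesis using k0 by (intro that[of k0]) fastforce
qed

text \<open>The differentiability set \<open>S\<close> is Borel: each \<open>A m k\<close> is an
  intersection of relatively closed sets, so the uncountably many increments do no harm. On
  \<open>S\<close> the derivative is a limit of Borel difference quotients, elsewhere it is the
  fixed value of \<open>deriv\<close>.\<close>

lemma borel_measurable_time_deriv:
  fixes \<Omega> :: "'x::metric_space set"
  assumes \<Omega>: "open \<Omega>" and \<phi>: "continuous_on (cylinder \<Omega> T) \<phi>"
  shows "(\<lambda>z. time_deriv \<phi> z * indicator (cylinder \<Omega> T) z) \<in> borel_measurable borel"
proof -
  let ?Q = "cylinder \<Omega> T"
  have Q: "open ?Q" using \<Omega> by (intro open_Times) auto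
  define c :: real where "c = (SOME D. False)"
  define D where "D h z = (\<phi> (fst z, snd z + h) - \<phi> z) / h" for h z
  \<comment> \<open>Points from which time increments up to \<open>1 / real (Suc k)\<close> stay in
    the cylinder.\<close>
  define Qk where "Qk k = \<Omega> \<times> {1 / real (Suc k)<..<T - 1 / real (Suc k)}" for k
  have Qk: "open (Qk k)" for k using \<Omega> by (auto simp: Qk_def intro: open_Times)
  have QkQ: "Qk k \<subseteq> ?Q" for k
  proof -
    have pos: "0 < 1 / real (Suc k)" by simp
    have "0 < t \<and> t < T" if "1 / real (Suc k) < t" "t < T - 1 / real (Suc k)" for t
      using that pos by linarith
    then show ?thesis unfolding Qk_def by auto
  qed
  have shift: "(fst z, snd z + h) \<in> ?Q" if "z \<in> Qk k" "\<bar>h\<bar> \<le> 1 / real (Suc k)" for z h k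
    using that by (auto simp: Qk_def)
  have contD: "continuous_on (Qk k) (D h)" if "h \<noteq> 0" "\<bar>h\<bar> \<le> 1 / real (Suc k)" for h k
    unfolding D_def
    by (intro continuous_intros continuous_on_compose2[OF \<phi>] continuous_on_subset[OF \<phi> QkQ])
      (use that shift in auto)
  define A where "A m k = {z \<in> Qk k. \<forall>q\<in>punctured k. \<forall>r\<in>punctured k.
      \<bar>D q z - D r z\<bar> \<le> 1 / real (Suc m)}" for m k
  have A: "A m k \<in> sets borel" for m k
  proof -
    define e where "e = 1 / real (Suc m)"
    have ne: "punctured k \<noteq> {}"
      by (auto simp: punctured_def divide_simps intro!: exI[of _ "1 / real (Suc (Suc k))"])
    define C0 where "C0 qr = Qk k \<inter> (\<lambda>z. D (fst qr) z - D (snd qr) z) -` {- e..e}" for qr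
    have mem: "D q z - D r z \<in> {- e..e} \<longleftrightarrow> \<bar>D q z - D r z\<bar> \<le> e" for q r z
      by (simp add: abs_le_iff) linarith
    have "(z \<in> A m k) = (z \<in> (\<Inter>qr\<in>punctured k \<times> punctured k. C0 qr))" for z
      using ne unfolding A_def C0_def e_def[symmetric] by (auto simp: mem simp del: atLeastAtMost_iff)
    then have "A m k = (\<Inter>qr\<in>punctured k \<times> punctured k. C0 qr)" by blast
    moreover have "closedin (top_of_set (Qk k)) (\<Inter>qr\<in>punctured k \<times> punctured k. C0 qr)"
    proof (rule closedin_INT)
      show "punctured k \<times> punctured k \<noteq> {}" using ne by simp
      fix qr assume "qr \<in> punctured k \<times> punctured k"
      then show "closedin (top_of_set (Qk k)) (C0 qr)"
        unfolding C0_def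
        by (intro continuous_closedin_preimage continuous_on_diff contD) (auto simp: punctured_def)
    qed
    ultimately obtain C where "closed C" "A m k = Qk k \<inter> C" by (auto simp: closedin_closed)
    then show ?thesis using Qk by auto
  qed
  define S where "S = (\<Inter>m. \<Union>k0. \<Inter>k\<in>{k0..}. A m k)"
  have S: "S \<in> sets borel" unfolding S_def using A by (intro sets.countable_INT'' sets.countable_UN'' sets.countable_INT') auto
  have S_iff: "z \<in> S \<longleftrightarrow> (\<exists>d. ((\<lambda>s. \<phi> (fst z, s)) has_field_derivative d) (at (snd z)))" if z: "z \<in> ?Q" for z
  proof -
    obtain x t where xt: "z = (x, t)" by (cases z)
    obtain k0 where k0: "\<And>k. k \<ge> k0 \<Longrightarrow> 1 / real (Suc k) < t \<and> t + 1 / real (Suc k) < T"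
      using cylinder_slice_param z unfolding xt by metis
    have inQ: "z \<in> Qk k" if "k \<ge> k0" for k using k0[OF that] z by (auto simp: xt Qk_def)
    show ?thesis
      unfolding has_real_derivative_Cauchy_iff(1)
    proof
      assume "z \<in> S"
      then show "\<forall>m. \<exists>k0. \<forall>k\<ge>k0. \<forall>q\<in>punctured k. \<forall>r\<in>punctured k.
        \<bar>(\<phi> (fst z, snd z + q) - \<phi> (fst z, snd z)) / q - (\<phi> (fst z, snd z + r) - \<phi> (fst z, snd z)) / r\<bar> \<le> 1 / real (Suc m)"
        unfolding S_def A_def D_def by simp blast
    next
      assume R: "\<forall>m. \<exists>k0. \<forall>k\<ge>k0. \<forall>q\<in>punctured k. \<forall>r\<in>punctured k.
        \<bar>(\<phi> (fst z, snd z + q) - \<phi> (fst z, snd z)) / q - (\<phi> (fst z, snd z + r) - \<phi> (fst z, snd z)) / r\<bar> \<le> 1 / real (Suc m)"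
      have "\<exists>k1. \<forall>k\<in>{k1..}. z \<in> A m k" for m
      proof -
        from spec[OF R, of m] obtain k1 where k1: "\<forall>k\<ge>k1. \<forall>q\<in>punctured k. \<forall>r\<in>punctured k.
        \<bar>(\<phi> (fst z, snd z + q) - \<phi> (fst z, snd z)) / q - (\<phi> (fst z, snd z + r) - \<phi> (fst z, snd z)) / r\<bar> \<le> 1 / real (Suc m)"
          by (rule exE)
        have "z \<in> A m k" if "k \<ge> max k0 k1" for k
          unfolding A_def D_def using inQ[of k] spec[OF k1, of k] that by simp
        then show ?thesis by (intro exI[of _ "max k0 k1"]) simp
      qed
      then show "z \<in> S" unfolding S_def by auto
    qed
  qed
  have \<phi>Q: "(\<lambda>z. \<phi> z * indicator ?Q z) \<in> borel_measurable borel"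
    using Q borel_measurable_continuous_on_indicator[OF _ \<phi>] by (simp add: mult.commute)
  \<comment> \<open>Extension by 0 makes the shifted functions Borel on the whole space; for small
    increments the quotients at a point of the cylinder are those of \<phi>.\<close>
  define \<phi>0 where "\<phi>0 z = \<phi> z * indicator ?Q z" for z
  have \<phi>0[measurable]: "\<phi>0 \<in> borel_measurable borel" unfolding \<phi>0_def by (rule \<phi>Q)
  have sh: "(\<lambda>z. \<phi>0 (fst z, snd z + h)) \<in> borel_measurable borel" for h
    by (rule measurable_compose[OF borel_measurable_continuous_onI \<phi>0]) (intro continuous_intros)
  define E where "E n z = (\<phi>0 (fst z, snd z + 1 / real (Suc n)) - \<phi>0 z) / (1 / real (Suc n))" for n z
  have E: "E n \<in> borel_measurable borel" for n unfolding E_def using sh by measurable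
  have lim: "(\<lambda>n. E n z) \<longlonglongrightarrow> time_deriv \<phi> z" if z: "z \<in> ?Q" "z \<in> S" for z
  proof -
    obtain x t where xt: "z = (x, t)" by (cases z)
    obtain d where d: "((\<lambda>s. \<phi> (x, s)) has_field_derivative d) (at t)" using S_iff[OF z(1)] z(2) by (auto simp: xt)
    then have td: "time_deriv \<phi> z = d" unfolding time_deriv_def xt by (simp add: DERIV_imp_deriv)
    obtain k0 where k0: "\<And>k. k \<ge> k0 \<Longrightarrow> 1 / real (Suc k) < t \<and> t + 1 / real (Suc k) < T"
      using cylinder_slice_param z unfolding xt by metis
    have "eventually (\<lambda>n. (\<phi> (x, t + 1 / real (Suc n)) - \<phi> (x, t)) / (1 / real (Suc n)) = E n z) sequentially"
      unfolding eventually_sequentially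
    proof (intro exI[of _ k0] allI impI)
      fix n assume "k0 \<le> n"
      then have "(x, t + 1 / real (Suc n)) \<in> ?Q" using k0[of n] z(1) by (auto simp: xt add_pos_pos)
      then show "(\<phi> (x, t + 1 / real (Suc n)) - \<phi> (x, t)) / (1 / real (Suc n)) = E n z"
        using z(1) by (simp add: E_def \<phi>0_def xt)
    qed
    with has_real_derivative_Cauchy_iff(2)[OF d] show ?thesis
      unfolding td by (rule Lim_transform_eventually)
  qed
  have "time_deriv \<phi> z * indicator ?Q z = (if z \<in> S then lim (\<lambda>n. E n z) else c) * indicator ?Q z" for z
  proof (cases "z \<in> ?Q")
    case True
    show ?thesis
    proof (cases "z \<in> S")
      case False
      then have "time_deriv \<phi> z = c"
        unfolding time_deriv_def c_def using S_iff[OF True] by (intro deriv_not_differentiable) simp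
      then show ?thesis using False by simp
    next
      case True': True
      have "lim (\<lambda>n. E n z) = time_deriv \<phi> z" by (rule limI[OF lim[OF True True']])
      then show ?thesis using True' by simp
    qed
  qed simp
  moreover have "(\<lambda>z. (if z \<in> S then lim (\<lambda>n. E n z) else c) * indicator ?Q z) \<in> borel_measurable borel"
  proof -
    note [measurable] = S E
    have [measurable]: "?Q \<in> sets borel" using Q by simp
    show ?thesis by measurable
  qed
  ultimately show ?thesis by (simp only:)
qed

text \<open>The second term of the maximum is the value of \<open>deriv\<close> where the derivative
  does not exist.\<close>

lemma time_deriv_bound:
  assumes \<phi>: "L-lipschitz_on (cylinder \<Omega> T) \<phi>" and z: "z \<in> cylinder \<Omega> T"
  shows "\<bar>time_deriv \<phi> z\<bar> \<le> max L \<bar>SOME D. False\<bar>"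
proof -
  obtain x t where xt: "z = (x, t)" by (cases z)
  show ?thesis
  proof (cases "\<exists>d. ((\<lambda>s. \<phi> (x, s)) has_field_derivative d) (at t)")
    case False
    then show ?thesis using deriv_not_differentiable[of "\<lambda>s. \<phi> (x, s)" t] by (simp add: time_deriv_def xt)
  next
    case True
    then obtain d where d: "((\<lambda>s. \<phi> (x, s)) has_field_derivative d) (at t)" ..
    then have td: "time_deriv \<phi> z = d" unfolding time_deriv_def xt by (simp add: DERIV_imp_deriv)
    obtain k0 where k0: "\<And>k. k \<ge> k0 \<Longrightarrow> 1 / real (Suc k) < t \<and> t + 1 / real (Suc k) < T"
      using cylinder_slice_param z unfolding xt by metis
    have "\<bar>(\<phi> (x, t + 1 / real (Suc n)) - \<phi> (x, t)) / (1 / real (Suc n))\<bar> \<le> L" if "n \<ge> k0" for n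
    proof -
      define h where "h = 1 / real (Suc n)"
      have h: "0 < h" by (simp add: h_def)
      have "(x, t + h) \<in> cylinder \<Omega> T" using k0[OF that] z by (auto simp: xt h_def add_pos_pos)
      then have "dist (\<phi> (x, t + h)) (\<phi> (x, t)) \<le> L * dist (x, t + h) (x, t)"
        using z by (intro lipschitz_onD[OF \<phi>]) (auto simp: xt)
      then have "\<bar>\<phi> (x, t + h) - \<phi> (x, t)\<bar> \<le> L * h"
        using h by (simp add: dist_real_def dist_Pair_Pair)
      then show ?thesis unfolding h_def[symmetric] using h by (simp add: pos_divide_le_eq)
    qed
    then have "\<bar>d\<bar> \<le> L"
      by (intro LIMSEQ_le_const2[OF tendsto_rabs[OF has_real_derivative_Cauchy_iff(2)[OF d]]]) blast
    then show ?thesis unfolding td by simp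
  qed
qed

text \<open>Near a zero \<open>t\<close> of a nonnegative Lipschitz function \<open>f\<close> at which \<open>f\<close> is not differentiable with
  derivative \<open>0\<close>, the zero set is porous, so that Vitali coverings apply.\<close>

lemma negligible_zeros_deriv_ne_0:
  fixes f :: "real \<Rightarrow> real"
  assumes lip: "L-lipschitz_on {0<..<T} f" and nn: "\<And>t. t \<in> {0<..<T} \<Longrightarrow> 0 \<le> f t"
  shows "negligible {t \<in> {0<..<T}. f t = 0 \<and> \<not> (f has_field_derivative 0) (at t)}"
proof -
  have L: "0 \<le> L" using lip by (rule lipschitz_on_nonneg)
  \<comment> \<open>Zeros \<open>t\<close> with points \<open>s\<close> arbitrarily close at which
    \<open>f s\<close> exceeds \<open>\<bar>s - t\<bar> / real (Suc k)\<close>. At a zero outside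
    all of these sets the nonnegative \<open>f\<close> has derivative 0.\<close>
  define S where "S k = {t \<in> {0<..<T}. f t = 0 \<and>
    (\<forall>d>0. \<exists>s\<in>{0<..<T}. \<bar>s - t\<bar> < d \<and> \<bar>s - t\<bar> / real (Suc k) < f s)}" for k
  have "t \<in> (\<Union>k. S k)" if t: "t \<in> {0<..<T}" "f t = 0" and nd: "\<not> (f has_field_derivative 0) (at t)" for t
  proof (rule ccontr)
    assume "t \<notin> (\<Union>k. S k)"
    then have ex: "\<exists>d>0. \<forall>s\<in>{0<..<T}. \<bar>s - t\<bar> < d \<longrightarrow> f s \<le> \<bar>s - t\<bar> / real (Suc k)" for k
    proof -
      have "\<not> (\<forall>d>0. \<exists>s\<in>{0<..<T}. \<bar>s - t\<bar> < d \<and> \<bar>s - t\<bar> / real (Suc k) < f s)"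
        using t \<open>t \<notin> (\<Union>k. S k)\<close> unfolding S_def by blast
      then show ?thesis by (meson not_less)
    qed
    have "((\<lambda>h. (f (t + h) - f t) / h) \<longlongrightarrow> 0) (at 0)"
    proof (rule LIM_I)
      fix e :: real assume "0 < e"
      then obtain k where k: "1 / real (Suc k) < e" using nat_approx_posE by blast
      obtain d where d: "0 < d" "\<And>s. s \<in> {0<..<T} \<Longrightarrow> \<bar>s - t\<bar> < d \<Longrightarrow> f s \<le> \<bar>s - t\<bar> / real (Suc k)"
        using ex[of k] by blast
      have "\<bar>(f (t + h) - f t) / h\<bar> < e" if h: "h \<noteq> 0" "\<bar>h\<bar> < min d (min t (T - t))" for h
      proof -
        have in': "t + h \<in> {0<..<T}" using h(2) by (auto simp: abs_less_iff)
        then have "0 \<le> f (t + h)" "f (t + h) \<le> \<bar>h\<bar> * (1 / real (Suc k))"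
          using nn d(2)[OF in'] h(2) by auto
        then have "\<bar>f (t + h)\<bar> / \<bar>h\<bar> \<le> 1 / real (Suc k)"
          using h(1) by (subst pos_divide_le_eq) (auto simp: mult.commute)
        then show ?thesis using t(2) k by simp
      qed
      moreover have "0 < min d (min t (T - t))" using d(1) t(1) by auto
      ultimately show "\<exists>s>0. \<forall>x. x \<noteq> 0 \<and> norm (x - 0) < s \<longrightarrow> norm ((f (t + x) - f t) / x - 0) < e"
        by (intro exI[of _ "min d (min t (T - t))"]) simp
    qed
    then show False using nd by (simp add: DERIV_def)
  qed
  then have sub: "{t \<in> {0<..<T}. f t = 0 \<and> \<not> (f has_field_derivative 0) (at t)} \<subseteq> (\<Union>k. S k)" by blast
  define Z where "Z = {t \<in> {0<..<T}. f t = 0}"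
  have "closedin (top_of_set {0<..<T}) ({0<..<T} \<inter> f -` {0})"
    using lipschitz_on_continuous_on[OF lip] by (intro continuous_closedin_preimage) auto
  moreover have "{0<..<T} \<inter> f -` {0} = Z" by (auto simp: Z_def)
  ultimately obtain C0 where "closed C0" "Z = {0<..<T} \<inter> C0" by (auto simp: closedin_closed)
  then have Z: "Z \<in> sets borel" by auto
  have "negligible (S k)" for k
    unfolding negligible_outer_le
  proof (intro allI impI)
    fix e :: real assume e: "0 < e"
    \<comment> \<open>The constants give \<open>2 * \<eta> \<le> 1\<close> and
      \<open>2 * L * \<eta> \<le> 1 / real (Suc k)\<close>: the first keeps the hole around
      \<open>s\<close> in the ball around \<open>t\<close>, the second keeps \<open>f\<close>
      positive in the hole.\<close>
    define w where "w = (L + 1) * real (Suc k)"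
    define \<eta> where "\<eta> = 1 / (2 * w)"
    have "1 * 1 \<le> w" unfolding w_def using L by (intro mult_mono) auto
    then have w: "1 \<le> w" by simp
    then have \<eta>: "0 < \<eta>" and \<eta>2: "2 * \<eta> \<le> 1" by (simp_all add: \<eta>_def)
    have "2 * L * \<eta> = L / w" by (simp add: \<eta>_def)
    also have "\<dots> \<le> (L + 1) / w" using w by (intro divide_right_mono) auto
    also have "\<dots> = 1 / real (Suc k)" using L by (simp add: w_def)
    finally have \<eta>L: "2 * L * \<eta> \<le> 1 / real (Suc k)" .
    \<comment> \<open>The holes will lie in \<open>U - Z\<close>, so its measure below
      \<open>\<eta> * e\<close> bounds the total length of the balls by \<open>e\<close>.\<close>
    obtain U where U: "open U" "Z \<subseteq> U" "U - Z \<in> lmeasurable" "emeasure lebesgue (U - Z) < ennreal (\<eta> * e)"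
      using sets_lebesgue_outer_open[of Z "\<eta> * e"] Z \<eta> e by (auto intro: sets_completionI_sets)
    define U' where "U' = U \<inter> {0<..<T}"
    \<comment> \<open>Triples describing a ball of radius \<open>r\<close> around \<open>t\<close>
      together with a hole around \<open>s\<close>, smaller by the factor \<eta>, that avoids the
      zero set.\<close>
    define K where "K = {(t, s, r). 0 < r \<and> cball t r \<subseteq> U' \<and> cball s (\<eta> * r) \<subseteq> cball t r - Z}"
    have vit: "\<exists>i\<in>K. t \<in> cball (fst i) (snd (snd i)) \<and> snd (snd i) < d" if t: "t \<in> S k" and d: "0 < d" for t d
    proof -
      have tU: "t \<in> U'" "f t = 0" using t U(2) by (auto simp: S_def Z_def U'_def)
      have "open U'" using U(1) by (auto simp: U'_def)
      then obtain d1 where d1: "0 < d1" "ball t d1 \<subseteq> U'" using tU(1) open_contains_ball by blast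
      obtain s where s: "s \<in> {0<..<T}" "\<bar>s - t\<bar> < min d d1 / 2" "\<bar>s - t\<bar> / real (Suc k) < f s"
        using t d d1(1) unfolding S_def by (auto dest!: spec[of _ "min d d1 / 2"])
      \<comment> \<open>Twice the distance, so that the ball around \<open>t\<close> contains
        \<open>s\<close> with a margin of \<bar>s - t\<bar> for the hole.\<close>
      define r where "r = 2 * \<bar>s - t\<bar>"
      have "s \<noteq> t" using s(3) tU(2) by auto
      then have r: "0 < r" "r < d" "r < d1" using s(2) by (auto simp: r_def)
      have cb: "cball t r \<subseteq> U'" using r(3) d1(2) by (auto simp: subset_iff)
      moreover have "cball s (\<eta> * r) \<subseteq> cball t r - Z"
      proof
        fix y assume "y \<in> cball s (\<eta> * r)"
        then have y: "\<bar>s - y\<bar> \<le> \<eta> * r" by (simp add: dist_real_def)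
        also have "\<eta> * r = (2 * \<eta>) * \<bar>s - t\<bar>" by (simp add: r_def)
        also have "\<dots> \<le> 1 * \<bar>s - t\<bar>" using \<eta>2 by (intro mult_right_mono) auto
        finally have "dist s y \<le> dist t s" by (simp add: dist_real_def abs_minus_commute)
        then have "dist t y \<le> 2 * dist t s" using dist_triangle[of t y s] by linarith
        then have "\<bar>t - y\<bar> \<le> 2 * \<bar>s - t\<bar>" by (simp add: dist_real_def abs_minus_commute)
        then have yt: "y \<in> cball t r" by (simp add: dist_real_def r_def)
        then have "y \<in> {0<..<T}" using cb by (auto simp: U'_def)
        then have "f s - f y \<le> L * \<bar>s - y\<bar>"
          using lipschitz_onD[OF lip s(1), of y] by (simp add: dist_real_def)
        also have "\<dots> \<le> L * (\<eta> * r)" using y L by (intro mult_left_mono)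
        also have "\<dots> = (2 * L * \<eta>) * \<bar>s - t\<bar>" by (simp add: r_def)
        also have "\<dots> \<le> (1 / real (Suc k)) * \<bar>s - t\<bar>" using \<eta>L by (intro mult_right_mono) auto
        also have "\<dots> < f s" using s(3) by simp
        finally have "0 < f y" by simp
        with yt show "y \<in> cball t r - Z" by (auto simp: Z_def)
      qed
      ultimately have "(t, s, r) \<in> K" using r(1) by (simp add: K_def)
      then show ?thesis using r by (intro bexI[of _ "(t, s, r)"]) auto
    qed
    obtain C where C: "countable C" "C \<subseteq> K"
      "pairwise (\<lambda>i j. disjnt (cball (fst i) (snd (snd i))) (cball (fst j) (snd (snd j)))) C"
      "negligible (S k - (\<Union>i\<in>C. cball (fst i) (snd (snd i))))"
    proof (rule Vitali_covering_theorem_cballs[of K "\<lambda>i. snd (snd i)" "S k" fst])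
      show "0 < snd (snd i)" if "i \<in> K" for i using that by (auto simp: K_def)
      show "\<exists>i. i \<in> K \<and> t \<in> cball (fst i) (snd (snd i)) \<and> snd (snd i) < d" if "t \<in> S k" "0 < d" for t d
        using vit[OF that] by blast
    qed
    define B where "B i = cball (fst i) (snd (snd i))" for i :: "real \<times> real \<times> real"
    define J where "J i = cball (fst (snd i)) (\<eta> * snd (snd i))" for i :: "real \<times> real \<times> real"
    have JB: "J i \<subseteq> B i - Z" "B i \<subseteq> U'" "0 < snd (snd i)" if "i \<in> C" for i
      using subsetD[OF C(2) that] unfolding J_def B_def K_def by (cases i; simp)+
    have disjB: "disjoint_family_on B C"
      using C(3) by (auto simp: disjoint_family_on_def pairwise_def disjnt_def B_def)
    then have disjJ: "disjoint_family_on J C"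
      using JB(1) unfolding disjoint_family_on_def by blast
    have len: "emeasure lborel (cball (c::real) q) = ennreal (2 * q)" if "0 < q" for c q
      using that by (simp add: cball_eq_atLeastAtMost)
    \<comment> \<open>Each ball is 1/\<eta> times as long as its hole, and the holes are disjoint
      subsets of \<open>U - Z\<close>.\<close>
    have "emeasure lborel (\<Union>(B ` C)) = (\<integral>\<^sup>+i. emeasure lborel (B i) \<partial>count_space C)"
      by (rule emeasure_UN_countable[OF _ C(1) disjB]) (simp add: B_def)
    also have "\<dots> = (\<integral>\<^sup>+i. ennreal (1 / \<eta>) * emeasure lborel (J i) \<partial>count_space C)"
    proof (rule nn_integral_cong)
      fix i assume "i \<in> space (count_space C)"
      then have "0 < snd (snd i)" using JB(3) by simp
      then show "emeasure lborel (B i) = ennreal (1 / \<eta>) * emeasure lborel (J i)"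
        using \<eta> unfolding B_def J_def by (subst (1 2) len) (auto simp flip: ennreal_mult)
    qed
    also have "\<dots> = ennreal (1 / \<eta>) * (\<integral>\<^sup>+i. emeasure lborel (J i) \<partial>count_space C)"
      by (intro nn_integral_cmult) auto
    also have "(\<integral>\<^sup>+i. emeasure lborel (J i) \<partial>count_space C) = emeasure lborel (\<Union>(J ` C))"
      by (rule emeasure_UN_countable[symmetric, OF _ C(1) disjJ]) (simp add: J_def)
    also have "\<dots> \<le> emeasure lborel (U - Z)"
    proof (rule emeasure_mono)
      show "\<Union>(J ` C) \<subseteq> U - Z" using JB(1,2) unfolding U'_def by blast
      show "U - Z \<in> sets lborel" using U(1) Z by simp
    qed
    also have "\<dots> = emeasure lebesgue (U - Z)" using U(1) Z by simp
    also have "ennreal (1 / \<eta>) * \<dots> \<le> ennreal (1 / \<eta>) * ennreal (\<eta> * e)"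
      using U(4) by (intro mult_left_mono) auto
    also have "\<dots> = ennreal e" using \<eta> e by (simp flip: ennreal_mult)
    finally have em: "emeasure lborel (\<Union>(B ` C)) \<le> ennreal e"
      by (meson mult_left_mono order_trans zero_le)
    have BC: "\<Union>(B ` C) \<in> sets borel" using C(1) by (intro sets.countable_UN'') (auto simp: B_def)
    \<comment> \<open>The selected balls together with the null remainder left by the Vitali
      covering.\<close>
    define T' where "T' = \<Union>(B ` C) \<union> (S k - \<Union>(B ` C))"
    have neg: "negligible (S k - \<Union>(B ` C))" using C(4) by (simp add: B_def)
    have BCm: "\<Union>(B ` C) \<in> lmeasurable"
      using BC em by (intro fmeasurableI) (auto simp: top_unique less_top[symmetric])
    have "measure lebesgue T' = measure lebesgue (\<Union>(B ` C))"
      unfolding T'_def using neg by (intro measure_Un_null_set) (use BC in \<open>auto simp: negligible_iff_null_sets\<close>)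
    also have "\<dots> \<le> e"
      using em e BC by (simp add: measure_def enn2real_leI)
    finally have "measure lebesgue T' \<le> e" .
    moreover have "T' \<in> lmeasurable" unfolding T'_def using BCm negligible_imp_measurable[OF neg] by (rule fmeasurable.Un)
    moreover have "S k \<subseteq> T'" by (auto simp: T'_def)
    ultimately show "\<exists>T. S k \<subseteq> T \<and> T \<in> lmeasurable \<and> measure lebesgue T \<le> e" by blast
  qed
  then have "negligible (\<Union>k. S k)" by (intro negligible_countable_Union) auto
  then show ?thesis using sub by (rule negligible_subset)
qed

section \<open>Jointly measurable minimal upper gradients\<close>

context proper_measure_space
begin

lemma pair_sigma_finite_spacetime: "pair_sigma_finite M lborel"
  by (intro pair_sigma_finite.intro sigma_finite_M lborel.sigma_finite_measure_axioms)

lemma space_spacetime [simp]: "space (spacetime M) = UNIV"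
  by (simp add: space_pair_measure)

text \<open>Fubini for null sets, with the two variables exchanged so that the slices are taken at
  fixed time.\<close>

lemma AE_spacetime_slices:
  assumes "AE z in spacetime M. P z"
  shows "AE t in lborel. AE x in M. P (x, t)"
proof -
  interpret pair_sigma_finite M lborel by (rule pair_sigma_finite_spacetime)
  obtain N where N: "N \<in> null_sets (spacetime M)" "{z. \<not> P z} \<subseteq> N"
    using assms by (auto simp: eventually_ae_filter)
  have "AE z in spacetime M. z \<notin> N" using N(1) by (rule AE_not_in)
  then have "AE x in M. AE t in lborel. (x, t) \<notin> N" by (rule AE_pair)
  moreover have "{z \<in> space (spacetime M). (fst z, snd z) \<notin> N} \<in> sets (spacetime M)"
  proof -
    have "{z \<in> space (spacetime M). (fst z, snd z) \<notin> N} = space (spacetime M) - N" by auto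
    then show ?thesis using N(1) by (simp only:) (rule sets.compl_sets, auto simp: null_sets_def)
  qed
  ultimately have "AE t in lborel. AE x in M. (x, t) \<notin> N"
    by (subst AE_commute[symmetric]) auto
  then show ?thesis
    by eventually_elim (use N(2) in \<open>auto elim!: eventually_mono\<close>)
qed

text \<open>A set measurable for the completion lies between \<open>S\<close> and
  \<open>S \<union> N'\<close>. The latter is measurable for the product and has slices of full
  measure, so Fubini applies to it.\<close>

lemma AE_spacetime_of_slices:
  assumes P: "{z. P z} \<in> sets (completion (spacetime M))"
    and ae: "AE t in lborel. AE x in M. P (x, t)"
  shows "AE z in spacetime M. P z"
proof -
  interpret pair_sigma_finite M lborel by (rule pair_sigma_finite_spacetime)
  obtain S N N' where S: "{z. P z} = S \<union> N" "N \<subseteq> N'" "N' \<in> null_sets (spacetime M)" "S \<in> sets (spacetime M)"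
    using P by (auto elim: sets_completionE)
  have Sm: "{z \<in> space (spacetime M). (fst z, snd z) \<in> S \<union> N'} \<in> sets (spacetime M)"
  proof -
    have "{z \<in> space (spacetime M). (fst z, snd z) \<in> S \<union> N'} = S \<union> N'" by auto
    then show ?thesis using S(3,4) by (simp only:) (intro sets.Un; auto)
  qed
  have "AE t in lborel. AE x in M. (x, t) \<in> S \<union> N'"
    using ae by eventually_elim (use S(1,2) in \<open>auto elim!: eventually_mono\<close>)
  then have "AE x in M. AE t in lborel. (x, t) \<in> S \<union> N'"
    using Sm by (subst AE_commute) auto
  then have "AE z in spacetime M. z \<in> S \<union> N'"
    using Sm by (intro AE_pair_measure) auto
  moreover have "AE z in spacetime M. z \<notin> N'" using S(3) by (rule AE_not_in)
  ultimately show ?thesis by eventually_elim (use S(1) in auto)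
qed

text \<open>Finite intersections of a countable basis: stable under intersection for the uniqueness
  of measures, open so that slice integrals over them are under control, and with the whole space as
  the empty intersection.\<close>

lemma countable_generator:
  obtains \<G> :: "'x set set" where "countable \<G>" "Int_stable \<G>" "UNIV \<in> \<G>" "\<And>A. A \<in> \<G> \<Longrightarrow> open A"
    "sigma_sets UNIV \<G> = sets borel"
proof -
  obtain \<B> :: "'x set set" where \<B>: "countable \<B>" "topological_basis \<B>" by (rule countable_basis_exists)
  define \<G> where "\<G> = Inter ` {F. finite F \<and> F \<subseteq> \<B>}"
  have opn: "open A" if "A \<in> \<G>" for A
    using that topological_basis_open[OF \<B>(2)] by (auto simp: \<G>_def intro!: open_Inter)
  have sub: "\<B> \<subseteq> \<G>"
  proof
    fix A assume "A \<in> \<B>"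
    then have "\<Inter>{A} \<in> \<G>" unfolding \<G>_def by (intro imageI) auto
    then show "A \<in> \<G>" by simp
  qed
  show thesis
  proof (rule that[of \<G>])
    show "countable \<G>" unfolding \<G>_def using \<B>(1) by (intro countable_image countable_Collect_finite_subset)
    show "Int_stable \<G>"
    proof (rule Int_stableI)
      fix A B assume "A \<in> \<G>" "B \<in> \<G>"
      then obtain F F' where F: "finite F" "F \<subseteq> \<B>" "A = \<Inter>F" "finite F'" "F' \<subseteq> \<B>" "B = \<Inter>F'"
        by (auto simp: \<G>_def)
      have "\<Inter>(F \<union> F') \<in> \<G>" unfolding \<G>_def using F by (intro imageI) auto
      then show "A \<inter> B \<in> \<G>" using F by (simp add: Inter_Un_distrib)
    qed
    have "\<Inter>{} \<in> \<G>" unfolding \<G>_def by (intro imageI) auto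
    then show "UNIV \<in> \<G>" by simp
    show "open A" if "A \<in> \<G>" for A using opn[OF that] .
    have "sets borel = sigma_sets UNIV \<B>"
      unfolding borel_eq_countable_basis[OF \<B>] by simp
    also have "\<dots> \<subseteq> sigma_sets UNIV \<G>" using sub by (rule sigma_sets_mono')
    finally have 1: "sets borel \<subseteq> sigma_sets UNIV \<G>" .
    have "\<G> \<subseteq> sets borel" using opn by auto
    from sets.sigma_sets_subset[OF this] have "sigma_sets UNIV \<G> \<subseteq> sets borel" by simp
    with 1 show "sigma_sets UNIV \<G> = sets borel" by blast
  qed
qed

text \<open>A family of densities whose integrals over the sets of a countable generator depend measurably
  on the parameter is given by a jointly measurable function: the Radon-Nikodym derivative of the
  measure on space-time that the family disintegrates.\<close>

lemma jointly_measurable_density: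
  fixes h :: "real \<Rightarrow> 'x \<Rightarrow> ennreal" and f :: "'x set \<Rightarrow> real \<Rightarrow> ennreal"
  assumes \<G>: "countable \<G>" "Int_stable \<G>" "UNIV \<in> \<G>" "\<And>A. A \<in> \<G> \<Longrightarrow> open A"
      "sigma_sets UNIV \<G> = sets (borel :: 'x measure)"
    and I: "I \<in> sets borel"
    and f: "\<And>A. A \<in> \<G> \<Longrightarrow> f A \<in> borel_measurable borel"
    and h: "AE t in lborel. t \<in> I \<longrightarrow> h t \<in> borel_measurable borel \<and> f UNIV t < \<infinity> \<and>
       (\<forall>A\<in>\<G>. (\<integral>\<^sup>+x\<in>A. h t x \<partial>M) = f A t)"
  shows "\<exists>H\<in>borel_measurable (spacetime M). AE t in lborel. t \<in> I \<longrightarrow> (AE x in M. H (x, t) = h t x)"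
proof -
  interpret pair_sigma_finite M lborel by (rule pair_sigma_finite_spacetime)
  note [measurable] = I
  obtain N where N: "N \<in> null_sets lborel"
    "{t. \<not> (t \<in> I \<longrightarrow> h t \<in> borel_measurable borel \<and> f UNIV t < \<infinity> \<and> (\<forall>A\<in>\<G>. (\<integral>\<^sup>+x\<in>A. h t x \<partial>M) = f A t))} \<subseteq> N"
    using h by (auto simp: eventually_ae_filter)
  have [measurable]: "N \<in> sets borel" using N(1) by (auto simp: null_sets_def)
  \<comment> \<open>Outside the null set \<open>N\<close> the hypotheses hold for every
    \<open>t\<close> in \<open>I\<close>; elsewhere the kernel is set to 0.\<close>
  define I' where "I' = I - N"
  have [measurable]: "I' \<in> sets borel" by (simp add: I'_def)
  have hm: "h t \<in> borel_measurable borel" "f UNIV t < \<infinity>" "\<And>A. A \<in> \<G> \<Longrightarrow> (\<integral>\<^sup>+x\<in>A. h t x \<partial>M) = f A t"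
    if "t \<in> I'" for t using that N(2) by (auto simp: I'_def)
  have hm': "h t \<in> borel_measurable M" if "t \<in> I'" for t
    using hm(1)[OF that] by (simp cong: measurable_cong_sets[OF sets_M refl])
  \<comment> \<open>Normalization to sub-probability measures; the factor is removed from the
    density at the end.\<close>
  define s where "s t = (if t \<in> I' then inverse (1 + f UNIV t) else 0)" for t
  have [measurable]: "s \<in> borel_measurable borel"
    unfolding s_def using f[OF \<G>(3)] by measurable
  define K where "K t = density M (\<lambda>x. if t \<in> I' then s t * h t x else 0)" for t
  have Km: "(\<lambda>x. if t \<in> I' then s t * h t x else 0) \<in> borel_measurable M" for t
    using hm'[of t] by (cases "t \<in> I'") auto
  have K_em: "emeasure (K t) A = (if t \<in> I' then s t * (\<integral>\<^sup>+x\<in>A. h t x \<partial>M) else 0)" if "A \<in> sets M" for t A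
    unfolding K_def using that hm'[of t]
    by (subst emeasure_density[OF Km that]) (auto simp: mult.assoc nn_integral_cmult)
  have \<G>M: "A \<in> sets M" if "A \<in> \<G>" for A using \<G>(4)[OF that] by (simp add: sets_M)
  have K_gen: "emeasure (K t) A = (if t \<in> I' then s t * f A t else 0)" if "A \<in> \<G>" for t A
    using hm(3)[of t A] that by (simp add: K_em[OF \<G>M[OF that]])
  have K_sub: "emeasure (K t) UNIV \<le> 1" for t
  proof (cases "t \<in> I'")
    case True
    have fin: "f UNIV t < \<infinity>" by (rule hm(2)[OF True])
    have "f UNIV t * inverse (1 + f UNIV t) \<le> (1 + f UNIV t) * inverse (1 + f UNIV t)"
      by (intro mult_right_mono) auto
    also have "\<dots> = 1" using fin ennreal_divide_self[of "1 + f UNIV t"] by (simp add: divide_ennreal_def less_top)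
    finally show ?thesis using True by (simp add: K_gen[OF \<G>(3)] s_def mult.commute)
  qed (simp add: K_gen[OF \<G>(3)])
  \<comment> \<open>Measurability of the kernel follows from that on the intersection-stable
    generator, where the masses are given by \<open>f\<close>.\<close>
  have K: "K \<in> lborel \<rightarrow>\<^sub>M subprob_algebra M"
  proof (rule measurable_subprob_algebra_generated[where G=\<G> and \<Omega>=UNIV])
    show "sets M = sigma_sets UNIV \<G>" by (simp add: sets_M \<G>(5))
    show "Int_stable \<G>" "\<G> \<subseteq> Pow UNIV" using \<G> by auto
    fix t :: real
    show "subprob_space (K t)"
      by (rule subprob_spaceI) (use K_sub[of t] in \<open>auto simp: K_def\<close>)
    show "sets (K t) = sets M" by (simp add: K_def)
  next
    have m: "(\<lambda>t. emeasure (K t) A) \<in> borel_measurable lborel" if "A \<in> \<G>" for A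
      unfolding K_gen[OF that] using f[OF that] by measurable
    then show "\<And>A. A \<in> \<G> \<Longrightarrow> (\<lambda>t. emeasure (K t) A) \<in> borel_measurable lborel" .
    show "(\<lambda>t. emeasure (K t) UNIV) \<in> borel_measurable lborel" by (rule m[OF \<G>(3)])
  qed
  define q where "q E t = emeasure (K t) {x. (x, t) \<in> E}" for E t
  have slice: "{x. (x, t) \<in> E} \<in> sets M" if "E \<in> sets (spacetime M)" for E t
    using sets_Pair2[OF that, of t] by (simp add: vimage_def)
  have q: "q E \<in> borel_measurable lborel" if E: "E \<in> sets (spacetime M)" for E
    unfolding q_def
  proof (rule emeasure_measurable_subprob_algebra2[OF _ K])
    have "(SIGMA t:space lborel. {x. (x, t) \<in> E}) = (\<lambda>(t, x). (x, t)) -` E \<inter> space (lborel \<Otimes>\<^sub>M M)"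
      by (auto simp: space_pair_measure)
    also have "\<dots> \<in> sets (lborel \<Otimes>\<^sub>M M)" using measurable_pair_swap' E by (rule measurable_sets)
    finally show "(SIGMA t:space lborel. {x. (x, t) \<in> E}) \<in> sets (lborel \<Otimes>\<^sub>M M)" .
  qed
  \<comment> \<open>The measure on space-time with the measures \<open>K t\<close> as time
    slices.\<close>
  define Q where "Q = measure_of UNIV (sets (spacetime M)) (\<lambda>E. \<integral>\<^sup>+t. q E t \<partial>lborel)"
  have sQ: "sets Q = sets (spacetime M)"
    unfolding Q_def using sets.sets_measure_of_eq[of "spacetime M"] by simp
  have Q: "emeasure Q E = (\<integral>\<^sup>+t. q E t \<partial>lborel)" if E: "E \<in> sets (spacetime M)" for E
    unfolding Q_def
  proof (rule emeasure_measure_of_sigma)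
    show "sigma_algebra UNIV (sets (spacetime M))"
      using sets.sigma_algebra_axioms[of "spacetime M"] by simp
    show "positive (sets (spacetime M)) (\<lambda>E. \<integral>\<^sup>+t. q E t \<partial>lborel)"
      by (simp add: positive_def q_def)
    show "countably_additive (sets (spacetime M)) (\<lambda>E. \<integral>\<^sup>+t. q E t \<partial>lborel)"
    proof (rule countably_additiveI)
      fix A :: "nat \<Rightarrow> ('x \<times> real) set"
      assume A: "range A \<subseteq> sets (spacetime M)" "disjoint_family A" "\<Union> (range A) \<in> sets (spacetime M)"
      have "(\<Sum>i. q (A i) t) = q (\<Union> (range A)) t" for t
      proof -
        have eq: "{x. (x, t) \<in> \<Union> (range A)} = (\<Union>i. {x. (x, t) \<in> A i})" by auto
        show ?thesis
          unfolding q_def eq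
        proof (rule suminf_emeasure)
          show "range (\<lambda>i. {x. (x, t) \<in> A i}) \<subseteq> sets (K t)"
            using A(1) slice by (auto simp: K_def)
          show "disjoint_family (\<lambda>i. {x. (x, t) \<in> A i})"
            using A(2) by (fastforce simp: disjoint_family_on_def)
        qed
      qed
      then show "(\<Sum>i. \<integral>\<^sup>+t. q (A i) t \<partial>lborel) = (\<integral>\<^sup>+t. q (\<Union> (range A)) t \<partial>lborel)"
        using A(1) q by (subst nn_integral_suminf[symmetric]) auto
    qed
  qed (rule E)
  have "absolutely_continuous (spacetime M) Q"
    unfolding absolutely_continuous_def
  proof
    fix E assume E: "E \<in> null_sets (spacetime M)"
    then have Es: "E \<in> sets (spacetime M)" by auto
    have "AE t in lborel. AE x in M. (x, t) \<notin> E"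
      using AE_spacetime_slices[OF AE_not_in[OF E]] by simp
    then have "AE t in lborel. q E t = 0"
    proof eventually_elim
      case (elim t)
      have "{x. (x, t) \<in> E} \<in> null_sets M"
        using elim AE_iff_null_sets[OF slice[OF Es, of t]] by simp
      then have "{x. (x, t) \<in> E} \<in> null_sets (K t)"
        unfolding K_def using absolutely_continuousI_density[OF Km[of t]] by (auto simp: absolutely_continuous_def)
      then show ?case by (simp add: q_def null_sets_def)
    qed
    then have "(\<integral>\<^sup>+t. q E t \<partial>lborel) = 0"
      using q[OF Es] by (simp add: nn_integral_0_iff_AE)
    then show "E \<in> null_sets Q" using Es sQ by (simp add: null_sets_def Q)
  qed
  from Radon_Nikodym[OF this sQ] obtain H where H[measurable]: "H \<in> borel_measurable (spacetime M)"
    and HQ: "density (spacetime M) H = Q" by auto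
  have Hswap: "(\<lambda>(t, x). H (x, t)) \<in> borel_measurable (lborel \<Otimes>\<^sub>M M)"
    using measurable_pair_swap[OF H] .
  have Hslice: "(\<lambda>x. H (x, t)) \<in> borel_measurable M" for t
    by (rule measurable_compose[OF _ H]) measurable
  \<comment> \<open>Integration over \<open>A \<times> C\<close> for all Borel sets \<open>C\<close>
    of times identifies the two densities in \<open>t\<close>; countability of the generator then
    gives one null set for all \<open>A\<close>.\<close>
  have eqA: "AE t in lborel. emeasure (K t) A = (\<integral>\<^sup>+x\<in>A. H (x, t) \<partial>M)" if A: "A \<in> \<G>" for A
  proof -
    have Am[measurable]: "A \<in> sets M" by (rule \<G>M[OF A])
    have "(\<lambda>(t, x). H (x, t) * indicator A x) \<in> borel_measurable (lborel \<Otimes>\<^sub>M M)"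
      using Hswap by measurable
    then have m2: "(\<lambda>t. \<integral>\<^sup>+x\<in>A. H (x, t) \<partial>M) \<in> borel_measurable lborel"
      by (intro M1.borel_measurable_nn_integral) (simp add: case_prod_beta')
    have m1: "(\<lambda>t. emeasure (K t) A) \<in> borel_measurable lborel"
      unfolding K_gen[OF A] using f[OF A] by measurable
    have "density lborel (\<lambda>t. emeasure (K t) A) = density lborel (\<lambda>t. \<integral>\<^sup>+x\<in>A. H (x, t) \<partial>M)"
    proof (rule measure_eqI)
      fix C assume "C \<in> sets (density lborel (\<lambda>t. emeasure (K t) A))"
      then have C[measurable]: "C \<in> sets borel" by simp
      have AC: "A \<times> C \<in> sets (spacetime M)" using Am C by simp
      have "emeasure (density lborel (\<lambda>t. emeasure (K t) A)) C = (\<integral>\<^sup>+t. emeasure (K t) A * indicator C t \<partial>lborel)"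
        using m1 by (intro emeasure_density) auto
      also have "\<dots> = (\<integral>\<^sup>+t. q (A \<times> C) t \<partial>lborel)"
        by (intro nn_integral_cong) (auto simp: q_def indicator_def)
      also have "\<dots> = emeasure (density (spacetime M) H) (A \<times> C)" by (simp add: HQ Q[OF AC])
      also have "\<dots> = (\<integral>\<^sup>+z. H z * indicator (A \<times> C) z \<partial>spacetime M)"
        using AC by (intro emeasure_density) auto
      also have "\<dots> = (\<integral>\<^sup>+t. (\<integral>\<^sup>+x. H (x, t) * indicator (A \<times> C) (x, t) \<partial>M) \<partial>lborel)"
        using AC by (intro nn_integral_snd[symmetric]) measurable
      also have "\<dots> = (\<integral>\<^sup>+t. (\<integral>\<^sup>+x\<in>A. H (x, t) \<partial>M) * indicator C t \<partial>lborel)"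
        by (intro nn_integral_cong) (auto simp: indicator_def intro!: nn_integral_cong)
      also have "\<dots> = emeasure (density lborel (\<lambda>t. \<integral>\<^sup>+x\<in>A. H (x, t) \<partial>M)) C"
        using m2 by (intro emeasure_density[symmetric]) auto
      finally show "emeasure (density lborel (\<lambda>t. emeasure (K t) A)) C
        = emeasure (density lborel (\<lambda>t. \<integral>\<^sup>+x\<in>A. H (x, t) \<partial>M)) C" .
    qed simp
    then show ?thesis by (rule sigma_finite_measure.density_unique[OF lborel.sigma_finite_measure_axioms m1 m2])
  qed
  have "AE t in lborel. \<forall>A\<in>\<G>. emeasure (K t) A = (\<integral>\<^sup>+x\<in>A. H (x, t) \<partial>M)"
    using eqA \<G>(1) by (simp add: AE_ball_countable)
  moreover have "AE t in lborel. t \<notin> N" using N(1) by (rule AE_not_in)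
  ultimately have main: "AE t in lborel. t \<in> I \<longrightarrow> (AE x in M. s t * h t x = H (x, t)) \<and> t \<in> I'"
  proof eventually_elim
    case (elim t)
    show ?case
    proof
      assume "t \<in> I"
      then have t: "t \<in> I'" using elim(2) by (simp add: I'_def)
      \<comment> \<open>Measures of finite total mass that agree on the generator are equal, and
        then so are their densities almost everywhere.\<close>
      have "density M (\<lambda>x. s t * h t x) = density M (\<lambda>x. H (x, t))"
      proof (rule measure_eqI_generator_eq[OF \<G>(2), of UNIV])
        show "\<G> \<subseteq> Pow UNIV" by simp
        have Kt: "K t = density M (\<lambda>x. s t * h t x)" using t by (simp add: K_def)
        show "emeasure (density M (\<lambda>x. s t * h t x)) A = emeasure (density M (\<lambda>x. H (x, t))) A" if "A \<in> \<G>" for A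
          using elim(1) that Hslice[of t] by (simp add: Kt[symmetric] emeasure_density \<G>M)
        show "sets (density M (\<lambda>x. s t * h t x)) = sigma_sets UNIV \<G>" "sets (density M (\<lambda>x. H (x, t))) = sigma_sets UNIV \<G>"
          by (simp_all add: sets_M \<G>(5))
        show "range (\<lambda>_::nat. UNIV) \<subseteq> \<G>" "(\<Union>i::nat. UNIV) = (UNIV :: 'x set)" using \<G>(3) by auto
        show "emeasure (density M (\<lambda>x. s t * h t x)) UNIV \<noteq> \<infinity>"
          unfolding Kt[symmetric] using K_sub[of t] by (auto simp: top_unique)
      qed
      then have "AE x in M. s t * h t x = H (x, t)"
        using hm'[OF t] Hslice[of t] by (intro sigma_finite_measure.density_unique[OF sigma_finite_M]) auto
      with t show "(AE x in M. s t * h t x = H (x, t)) \<and> t \<in> I'" by simp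
    qed
  qed
  \<comment> \<open>Undoes the normalization, since \<open>(1 + f UNIV t) * s t = 1\<close> on
    \<open>I'\<close>.\<close>
  define H' where "H' z = (1 + f UNIV (snd z)) * H z" for z
  have "H' \<in> borel_measurable (spacetime M)"
    unfolding H'_def using f[OF \<G>(3)] by measurable
  moreover have "AE t in lborel. t \<in> I \<longrightarrow> (AE x in M. H' (x, t) = h t x)"
    using main
  proof eventually_elim
    case (elim t)
    show ?case
    proof
      assume "t \<in> I"
      with elim have t: "t \<in> I'" and ae: "AE x in M. s t * h t x = H (x, t)" by auto
      have "f UNIV t < top" using hm(2)[OF t] by simp
      then have inv: "(1 + f UNIV t) * s t = 1"
        using t ennreal_divide_self[of "1 + f UNIV t"] by (simp add: s_def divide_ennreal_def less_top)
      show "AE x in M. H' (x, t) = h t x"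
        using ae
      proof eventually_elim
        case (elim x)
        have "H' (x, t) = ((1 + f UNIV t) * s t) * h t x"
          by (simp add: H'_def elim[symmetric] mult.assoc)
        then show ?case using inv by simp
      qed
    qed
  qed
  ultimately show ?thesis by blast
qed

end

lemma compactly_in_subset:
  assumes "compactly_in B \<Omega>" "A \<subseteq> B"
  shows "compactly_in A \<Omega>"
proof -
  have "closure A \<subseteq> closure B" using assms(2) by (rule closure_mono)
  moreover have "compact (closure B \<inter> closure A)"
    using assms(1) unfolding compactly_in_def by (intro compact_Int_closed) auto
  ultimately show ?thesis
    using assms(1) unfolding compactly_in_def by (simp add: Int_absorb1 subset_trans)
qed

lemma compactly_in_Times:
  fixes D :: "'x::metric_space set"
  assumes "compactly_in D \<Omega>" "0 < t1" "t2 < T"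
  shows "compactly_in (D \<times> {t1<..<t2}) (cylinder \<Omega> T)"
proof -
  have "closure {t1<..<t2} \<subseteq> {t1..t2}" by (intro closure_minimal) auto
  then have sub: "closure (D \<times> {t1<..<t2}) \<subseteq> closure D \<times> {t1..t2}"
    by (simp add: closure_Times Sigma_mono)
  have "compact (closure D \<times> {t1..t2})"
    using assms(1) by (intro compact_Times) (auto simp: compactly_in_def)
  then have "compact ((closure D \<times> {t1..t2}) \<inter> closure (D \<times> {t1<..<t2}))"
    by (intro compact_Int_closed) auto
  then have "compact (closure (D \<times> {t1<..<t2}))" using sub by (simp add: Int_absorb1)
  moreover have "closure D \<times> {t1..t2} \<subseteq> cylinder \<Omega> T"
    using assms by (auto simp: compactly_in_def)
  ultimately show ?thesis using sub by (auto simp: compactly_in_def)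
qed

text \<open>The summand 3 keeps T/(k+3) at most T/3 for positive \<open>T\<close>, so that every
  interval is nonempty.\<close>

definition time_step :: "real \<Rightarrow> nat \<Rightarrow> real set" where
  "time_step T k = {T / (real k + 3)<..<T - T / (real k + 3)}"

lemma time_step:
  assumes "0 < T"
  shows "0 < T / (real k + 3)" "T / (real k + 3) < T - T / (real k + 3)" "T - T / (real k + 3) < T"
    "incseq (time_step T)" "t \<in> {0<..<T} \<Longrightarrow> \<exists>k. t \<in> time_step T k"
proof -
  show "0 < T / (real k + 3)" for k using assms by simp
  then show "T - T / (real k + 3) < T" by simp
  have "T / (real k + 3) \<le> T / 3" using assms by (intro divide_left_mono) auto
  then show "T / (real k + 3) < T - T / (real k + 3)" using assms by linarith
  show "incseq (time_step T)"
  proof (rule incseq_SucI)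
    fix k
    have "T / (real (Suc k) + 3) \<le> T / (real k + 3)" using assms by (intro divide_left_mono) auto
    then show "time_step T k \<subseteq> time_step T (Suc k)" by (auto simp: time_step_def)
  qed
  assume t: "t \<in> {0<..<T}"
  define m where "m = min t (T - t)"
  have m: "0 < m" "m \<le> t" "m \<le> T - t" using t by (auto simp: m_def)
  obtain k :: nat where "T / m < real k" using reals_Archimedean2 by blast
  then have "T / m < real k + 3" by simp
  then have "T / (real k + 3) < m"
    using m(1) assms by (simp add: pos_divide_less_eq mult.commute)
  then show "\<exists>k. t \<in> time_step T k" using m by (intro exI[of _ k]) (simp add: time_step_def)
qed

context proper_measure_space
begin

lemma sets_completion_spacetimeI: "A \<in> sets borel \<Longrightarrow> A \<in> sets (completion (spacetime M))"
  by (intro sets_completionI_sets) (simp only: sets_spacetime)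

lemma borel_measurable_restrict_completion_iff:
  fixes f :: "'x \<times> real \<Rightarrow> ennreal"
  assumes "open Q"
  shows "f \<in> borel_measurable (restrict_space (completion (spacetime M)) Q) \<longleftrightarrow>
    (\<lambda>z. f z * indicator Q z) \<in> borel_measurable (completion (spacetime M))"
proof (rule borel_measurable_restrict_space_iff_ennreal)
  have "Q \<inter> space (completion (spacetime M)) = Q" by simp
  then show "Q \<inter> space (completion (spacetime M)) \<in> sets (completion (spacetime M))"
    using assms by (simp only:) (intro sets_completion_spacetimeI borel_open)
qed

section \<open>Time slices and joint measurability of the minimal gradient of u\<close>

context
  fixes \<Omega> :: "'x set" and T :: real and u :: "'x \<times> real \<Rightarrow> ereal"
  assumes o: "open \<Omega>" "bounded \<Omega>" and T: "0 < T"
    and N: "in_Lp_newtonian_loc p M \<Omega> T u"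
    and L: "in_Lp_loc 2 (spacetime M) (cylinder \<Omega> T) u"
begin

lemma newtonian_slices:
  assumes "open D" "compactly_in D \<Omega>" "0 < t1" "t1 < t2" "t2 < T"
  shows "AE t in lborel. t \<in> {t1<..<t2} \<longrightarrow> newtonian p M D (\<lambda>x. u (x, t))"
    "(\<lambda>t. newton_norm p M D (\<lambda>x. u (x, t))) \<in> borel_measurable (lebesgue_on {t1<..<t2})"
proof -
  have "in_Lp_newtonian p M D t1 t2 u" using N assms by (auto simp: in_Lp_newtonian_loc_def)
  then show "AE t in lborel. t \<in> {t1<..<t2} \<longrightarrow> newtonian p M D (\<lambda>x. u (x, t))"
    "(\<lambda>t. newton_norm p M D (\<lambda>x. u (x, t))) \<in> borel_measurable (lebesgue_on {t1<..<t2})"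
    unfolding in_Lp_newtonian_def by blast+
qed

text \<open>For almost every \<open>t\<close> the slice is Newtonian on all sets of an exhaustion at
  once, and \<open>loc_wug_exhaust\<close> joins the gradients.\<close>

lemma loc_wug_slices:
  "AE t in lborel. t \<in> {0<..<T} \<longrightarrow> (\<exists>g. loc_wug p M \<Omega> (\<lambda>x. u (x, t)) g)"
proof -
  obtain B :: "nat \<Rightarrow> 'x set" where B: "\<And>n. open (B n)" "\<And>n. compactly_in (B n) \<Omega>" "incseq B"
    "\<And>K. compact K \<Longrightarrow> K \<subseteq> \<Omega> \<Longrightarrow> \<exists>n. K \<subseteq> B n"
    using exhaustion[OF o] by metis
  have "AE t in lborel. t \<in> time_step T k \<longrightarrow> newtonian p M (B n) (\<lambda>x. u (x, t))" for n k
    unfolding time_step_def using time_step(1-3)[OF T, of k] B(1,2)[of n] by (intro newtonian_slices)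
  then have "AE t in lborel. \<forall>n k. t \<in> time_step T k \<longrightarrow> newtonian p M (B n) (\<lambda>x. u (x, t))"
    unfolding AE_all_countable by blast
  then show ?thesis
  proof eventually_elim
    case (elim t)
    show ?case
    proof
      assume "t \<in> {0<..<T}"
      then obtain k where "t \<in> time_step T k" using time_step(5)[OF T] by blast
      then have "\<exists>g. loc_wug p M (B n) (\<lambda>x. u (x, t)) g" for n
        using elim B(1) by (intro newtonian_loc_wug) auto
      then show "\<exists>g. loc_wug p M \<Omega> (\<lambda>x. u (x, t)) g"
        by (intro loc_wug_exhaust[OF o B])
    qed
  qed
qed

lemma minimal_wug_slices:
  "AE t in lborel. t \<in> {0<..<T} \<longrightarrow> minimal_wug p M \<Omega> (\<lambda>x. u (x, t)) (min_ugrad p M \<Omega> (\<lambda>x. u (x, t)))"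
  using loc_wug_slices by eventually_elim (auto intro: minimal_wug_min_ugrad[OF o])

text \<open>The norm on \<open>D\<close> is formed with the minimal gradient relative to
  \<open>D\<close>; by locality it is replaced by the one relative to \<Omega>, so that integrals
  over different sets \<open>D\<close> concern the same function.\<close>

lemma slice_integral_finite:
  assumes D: "open D" "compactly_in D \<Omega>" and t: "0 < t1" "t1 < t2" "t2 < T"
  shows "AE t in lborel. t \<in> {t1<..<t2} \<longrightarrow> in_Lp p M D (\<lambda>x. u (x, t)) \<and>
     newton_norm p M D (\<lambda>x. u (x, t)) < \<infinity> \<and>
     newton_norm p M D (\<lambda>x. u (x, t)) = Lp_norm p M D (\<lambda>x. u (x, t)) +
       epow (\<integral>\<^sup>+x\<in>D. epow (min_ugrad p M \<Omega> (\<lambda>x. u (x, t)) x) p \<partial>M) (1 / p)"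
  using newtonian_slices(1)[OF D t] minimal_wug_slices
proof eventually_elim
  case (elim t)
  show ?case
  proof
    assume ti: "t \<in> {t1<..<t2}"
    then have nw: "newtonian p M D (\<lambda>x. u (x, t))"
      and g: "minimal_wug p M \<Omega> (\<lambda>x. u (x, t)) (min_ugrad p M \<Omega> (\<lambda>x. u (x, t)))"
      using elim t by auto
    have sub: "D \<subseteq> \<Omega>" using D(2) closure_subset unfolding compactly_in_def by blast
    have bd: "bounded D" using o(2) sub by (rule bounded_subset)
    have h: "minimal_wug p M D (\<lambda>x. u (x, t)) (min_ugrad p M D (\<lambda>x. u (x, t)))"
      by (rule minimal_wug_min_ugrad[OF D(1) bd newtonian_loc_wug[OF nw D(1)]])
    have "AE x in M. x \<in> D \<longrightarrow> min_ugrad p M \<Omega> (\<lambda>x. u (x, t)) x = min_ugrad p M D (\<lambda>x. u (x, t)) x"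
      using D(1) by (intro minimal_wug_agree[OF o D(1) sub g h]) auto
    then have "AE x in M. epow (min_ugrad p M D (\<lambda>x. u (x, t)) x) p * indicator D x =
       epow (min_ugrad p M \<Omega> (\<lambda>x. u (x, t)) x) p * indicator D x"
      by eventually_elim (simp add: indicator_def)
    then have "(\<integral>\<^sup>+x\<in>D. epow (min_ugrad p M D (\<lambda>x. u (x, t)) x) p \<partial>M) =
       (\<integral>\<^sup>+x\<in>D. epow (min_ugrad p M \<Omega> (\<lambda>x. u (x, t)) x) p \<partial>M)"
      by (rule nn_integral_cong_AE)
    then show "in_Lp p M D (\<lambda>x. u (x, t)) \<and> newton_norm p M D (\<lambda>x. u (x, t)) < \<infinity> \<and>
     newton_norm p M D (\<lambda>x. u (x, t)) = Lp_norm p M D (\<lambda>x. u (x, t)) +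
       epow (\<integral>\<^sup>+x\<in>D. epow (min_ugrad p M \<Omega> (\<lambda>x. u (x, t)) x) p \<partial>M) (1 / p)"
      using nw by (simp add: newtonian_def newton_norm_def Lp_norm_ennreal)
  qed
qed

text \<open>The gradient term is the Newtonian norm minus its L^p term. The norm is measurable in
  time by \<open>in_Lp_newtonian\<close>, the L^p term by Fubini, since \<open>in_Lp_loc\<close>
  makes \<open>u\<close> jointly measurable on boxes.\<close>

lemma slice_integral_measurable:
  assumes D: "open D" "compactly_in D \<Omega>" and t: "0 < t1" "t1 < t2" "t2 < T"
  shows "\<exists>f\<in>borel_measurable borel. AE t in lborel. t \<in> {t1<..<t2} \<longrightarrow>
    (\<integral>\<^sup>+x\<in>D. epow (min_ugrad p M \<Omega> (\<lambda>x. u (x, t)) x) p \<partial>M) = f t \<and> f t < \<infinity>"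
proof -
  interpret pair_sigma_finite M lborel by (rule pair_sigma_finite_spacetime)
  let ?I = "{t1<..<t2}"
  let ?DI = "D \<times> ?I"
  have "(\<lambda>t. newton_norm p M D (\<lambda>x. u (x, t)) * indicator ?I t) \<in> borel_measurable lebesgue"
    using newtonian_slices(2)[OF D t] by (subst (asm) borel_measurable_restrict_space_iff_ennreal) auto
  from completion_ex_borel_measurable[OF this] obtain N' where N'[measurable]: "N' \<in> borel_measurable lborel"
    and N'_eq: "AE t in lborel. newton_norm p M D (\<lambda>x. u (x, t)) * indicator ?I t = N' t" by blast
  have DI: "open ?DI" "compactly_in ?DI (cylinder \<Omega> T)"
    using D t compactly_in_Times by (auto intro: open_Times)
  then have "in_Lp 2 (spacetime M) ?DI u" using L by (auto simp: in_Lp_loc_def)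
  then have um: "u \<in> borel_measurable (restrict_space (completion (spacetime M)) ?DI)"
    by (simp add: in_Lp_def)
  have "(\<lambda>z. epow (e2ennreal \<bar>u z\<bar>) p) \<in> borel_measurable (restrict_space (completion (spacetime M)) ?DI)"
    using um by measurable
  then have "(\<lambda>z. epow (e2ennreal \<bar>u z\<bar>) p * indicator ?DI z) \<in> borel_measurable (completion (spacetime M))"
    unfolding borel_measurable_restrict_completion_iff[OF DI(1)] .
  from completion_ex_borel_measurable[OF this] obtain V where V: "V \<in> borel_measurable (spacetime M)"
    and V_eq: "AE z in spacetime M. epow (e2ennreal \<bar>u z\<bar>) p * indicator ?DI z = V z" by blast
  define A where "A t = (\<integral>\<^sup>+x. V (x, t) \<partial>M)" for t
  have [measurable]: "A \<in> borel_measurable lborel"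
    unfolding A_def using measurable_pair_swap[OF V] by (intro M1.borel_measurable_nn_integral) (simp add: case_prod_beta')
  have A_eq: "AE t in lborel. t \<in> ?I \<longrightarrow> Lp_norm p M D (\<lambda>x. u (x, t)) = epow (A t) (1 / p)"
    using AE_spacetime_slices[OF V_eq]
  proof eventually_elim
    case (elim t)
    show ?case
    proof
      assume ti: "t \<in> ?I"
      have "AE x in M. epow (e2ennreal \<bar>u (x, t)\<bar>) p * indicator D x = V (x, t)"
        using elim by eventually_elim (use ti in \<open>simp add: indicator_def\<close>)
      then have "(\<integral>\<^sup>+x\<in>D. epow (e2ennreal \<bar>u (x, t)\<bar>) p \<partial>M) = A t"
        unfolding A_def by (rule nn_integral_cong_AE)
      then show "Lp_norm p M D (\<lambda>x. u (x, t)) = epow (A t) (1 / p)" by (simp add: Lp_norm_def)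
    qed
  qed
  \<comment> \<open>The subtraction recovers the gradient term since the L^p term is finite.\<close>
  define f where "f t = epow (N' t - epow (A t) (1 / p)) p" for t
  have "f \<in> borel_measurable lborel" unfolding f_def by measurable
  moreover have "AE t in lborel. t \<in> ?I \<longrightarrow>
    (\<integral>\<^sup>+x\<in>D. epow (min_ugrad p M \<Omega> (\<lambda>x. u (x, t)) x) p \<partial>M) = f t \<and> f t < \<infinity>"
    using N'_eq A_eq slice_integral_finite[OF D t]
  proof eventually_elim
    case (elim t)
    show ?case
    proof
      assume ti: "t \<in> ?I"
      let ?F = "\<integral>\<^sup>+x\<in>D. epow (min_ugrad p M \<Omega> (\<lambda>x. u (x, t)) x) p \<partial>M"
      let ?a = "Lp_norm p M D (\<lambda>x. u (x, t))"
      have "?a < \<infinity>" "newton_norm p M D (\<lambda>x. u (x, t)) < \<infinity>"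
        "newton_norm p M D (\<lambda>x. u (x, t)) = ?a + epow ?F (1 / p)"
        using elim(3) ti by (auto simp: in_Lp_def)
      moreover then have "N' t = ?a + epow ?F (1 / p)" using elim(1) ti by simp
      ultimately have "N' t - ?a = epow ?F (1 / p)" "epow ?F (1 / p) < \<infinity>" by auto
      moreover have "?a = epow (A t) (1 / p)" using elim(2) ti by simp
      ultimately show "?F = f t \<and> f t < \<infinity>"
        unfolding f_def using epow_epow_inverse(2)[OF p_pos, of ?F] by auto
    qed
  qed
  ultimately show ?thesis by auto
qed

text \<open>\<open>jointly_measurable_density\<close> is applied to the p-th powers of the minimal
  gradients on \<open>B n\<close>, at times in \<open>time_step T n\<close>. Intersections of
  \<open>B n\<close> with generating open sets are again open and compactly contained, so their
  slice integrals depend measurably on time.\<close>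

lemma is_par_ugrad_exists: "\<exists>G. is_par_ugrad p M \<Omega> T u G"
proof -
  obtain B :: "nat \<Rightarrow> 'x set" where B: "\<And>n. open (B n)" "\<And>n. compactly_in (B n) \<Omega>" "incseq B"
    "\<And>K. compact K \<Longrightarrow> K \<subseteq> \<Omega> \<Longrightarrow> \<exists>n. K \<subseteq> B n"
    using exhaustion[OF o] by metis
  have sub: "B n \<subseteq> \<Omega>" for n using B(2)[of n] closure_subset unfolding compactly_in_def by blast
  obtain \<G> :: "'x set set" where \<G>: "countable \<G>" "Int_stable \<G>" "UNIV \<in> \<G>" "\<And>A. A \<in> \<G> \<Longrightarrow> open A"
    "sigma_sets UNIV \<G> = sets borel" by (rule countable_generator) (rule that)
  define g where "g t = min_ugrad p M \<Omega> (\<lambda>x. u (x, t))" for t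
  have g_borel: "(\<lambda>x. g t x * indicator \<Omega> x) \<in> borel_measurable borel"
    if "minimal_wug p M \<Omega> (\<lambda>x. u (x, t)) (g t)" for t
    using that unfolding minimal_wug_iff loc_wug_iff[OF o(1)] by blast
  define R where "R n H \<longleftrightarrow> H \<in> borel_measurable (spacetime M) \<and> (AE t in lborel. t \<in> time_step T n \<longrightarrow>
      (AE x in M. H (x, t) = epow (g t x) p * indicator (B n) x))" for n H
  have "\<exists>H\<in>borel_measurable (spacetime M). AE t in lborel. t \<in> time_step T n \<longrightarrow>
      (AE x in M. H (x, t) = epow (g t x) p * indicator (B n) x)" for n
  proof -
    define P where "P A f \<longleftrightarrow> f \<in> borel_measurable borel \<and> (AE t in lborel. t \<in> time_step T n \<longrightarrow>
      (\<integral>\<^sup>+x\<in>A \<inter> B n. epow (g t x) p \<partial>M) = f t \<and> f t < \<infinity>)" for A f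
    have "\<exists>f\<in>borel_measurable borel. AE t in lborel. t \<in> time_step T n \<longrightarrow>
      (\<integral>\<^sup>+x\<in>A \<inter> B n. epow (g t x) p \<partial>M) = f t \<and> f t < \<infinity>" if "A \<in> \<G>" for A
      unfolding time_step_def g_def
      using \<G>(4)[OF that] B(1,2)[of n] compactly_in_subset[of "B n" \<Omega> "A \<inter> B n"] time_step(1-3)[OF T, of n]
      by (intro slice_integral_measurable) auto
    then have "\<forall>A\<in>\<G>. \<exists>f. P A f" unfolding P_def by blast
    from bchoice[OF this] obtain f where f': "\<forall>A\<in>\<G>. P A (f A)" by blast
    have f: "f A \<in> borel_measurable borel" "AE t in lborel. t \<in> time_step T n \<longrightarrow>
      (\<integral>\<^sup>+x\<in>A \<inter> B n. epow (g t x) p \<partial>M) = f A t \<and> f A t < \<infinity>" if "A \<in> \<G>" for A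
      using f' that unfolding P_def by blast+
    have "AE t in lborel. \<forall>A\<in>\<G>. t \<in> time_step T n \<longrightarrow>
      (\<integral>\<^sup>+x\<in>A \<inter> B n. epow (g t x) p \<partial>M) = f A t \<and> f A t < \<infinity>"
      unfolding AE_ball_countable[OF \<G>(1)] using f(2) by blast
    with minimal_wug_slices
    have h: "AE t in lborel. t \<in> time_step T n \<longrightarrow> (\<lambda>x. epow (g t x) p * indicator (B n) x) \<in> borel_measurable borel \<and>
      f UNIV t < \<infinity> \<and> (\<forall>A\<in>\<G>. (\<integral>\<^sup>+x\<in>A. epow (g t x) p * indicator (B n) x \<partial>M) = f A t)"
    proof eventually_elim
      case (elim t)
      show ?case
      proof
        assume tn: "t \<in> time_step T n"
        then have "t \<in> {0<..<T}"
          using time_step(1,3)[OF T, of n] by (auto simp: time_step_def)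
        then have [measurable]: "(\<lambda>x. g t x * indicator \<Omega> x) \<in> borel_measurable borel"
          using elim(1) by (intro g_borel) (simp add: g_def)
        have [measurable]: "B n \<in> sets borel" using B(1) by simp
        have "(\<lambda>x. epow (g t x * indicator \<Omega> x) p * indicator (B n) x) \<in> borel_measurable borel" by measurable
        also have "(\<lambda>x. epow (g t x * indicator \<Omega> x) p * indicator (B n) x) = (\<lambda>x. epow (g t x) p * indicator (B n) x)"
          using sub[of n] by (auto simp: indicator_def fun_eq_iff)
        finally have "(\<lambda>x. epow (g t x) p * indicator (B n) x) \<in> borel_measurable borel" .
        moreover have "(\<integral>\<^sup>+x\<in>A. epow (g t x) p * indicator (B n) x \<partial>M) = (\<integral>\<^sup>+x\<in>A \<inter> B n. epow (g t x) p \<partial>M)" for A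
          by (intro nn_integral_cong) (auto simp: indicator_def)
        ultimately show "(\<lambda>x. epow (g t x) p * indicator (B n) x) \<in> borel_measurable borel \<and>
          f UNIV t < \<infinity> \<and> (\<forall>A\<in>\<G>. (\<integral>\<^sup>+x\<in>A. epow (g t x) p * indicator (B n) x \<partial>M) = f A t)"
          using elim(2) tn \<G>(3) by simp
      qed
    qed
    show ?thesis
      by (rule jointly_measurable_density[OF \<G> _ f(1) h]) (auto simp: time_step_def)
  qed
  then have "\<forall>n. \<exists>H. R n H" unfolding R_def by blast
  from choice[OF this] obtain H where H': "\<forall>n. R n (H n)" by blast
  have H: "H n \<in> borel_measurable (spacetime M)"
    "AE t in lborel. t \<in> time_step T n \<longrightarrow> (AE x in M. H n (x, t) = epow (g t x) p * indicator (B n) x)" for n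
    using H' unfolding R_def by blast+
  \<comment> \<open>The p-th roots of the densities agree almost everywhere where they overlap; the
    supremum assembles them to one function on the cylinder.\<close>
  define G where "G z = (SUP n. epow (H n z) (1 / p) * indicator (B n \<times> time_step T n) z)" for z
  note [measurable] = H(1)
  have [measurable]: "B n \<times> time_step T n \<in> sets (spacetime M)" for n
    using B(1) by (intro pair_measureI) (auto simp: sets_M time_step_def)
  have "G \<in> borel_measurable (spacetime M)" unfolding G_def by measurable
  then have "G \<in> borel_measurable (restrict_space (completion (spacetime M)) (cylinder \<Omega> T))"
    by (intro measurable_restrict_space1 measurable_completion)
  moreover have "AE t in lborel. \<forall>n. t \<in> time_step T n \<longrightarrow> (AE x in M. H n (x, t) = epow (g t x) p * indicator (B n) x)"
    using H(2) by (simp add: AE_all_countable)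
  then have "AE t in lborel. t \<in> {0<..<T} \<longrightarrow> (AE x in M. x \<in> \<Omega> \<longrightarrow> G (x, t) = g t x)"
  proof eventually_elim
    case (elim t)
    show ?case
    proof
      assume t: "t \<in> {0<..<T}"
      have "AE x in M. \<forall>n. t \<in> time_step T n \<longrightarrow> H n (x, t) = epow (g t x) p * indicator (B n) x"
        using elim by (auto simp: AE_all_countable)
      then show "AE x in M. x \<in> \<Omega> \<longrightarrow> G (x, t) = g t x"
      proof eventually_elim
        case (elim x)
        show ?case
        proof
          assume x: "x \<in> \<Omega>"
          obtain k where k: "t \<in> time_step T k" using time_step(5)[OF T t] by blast
          obtain m where m: "x \<in> B m" using B(4)[of "{x}"] x by auto
          have val: "epow (H n (x, t)) (1 / p) * indicator (B n \<times> time_step T n) (x, t) =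
              (if x \<in> B n \<and> t \<in> time_step T n then g t x else 0)" for n
            using elim epow_epow_inverse(1)[OF p_pos, of "g t x"] by (auto simp: indicator_def)
          have "x \<in> B (max k m)" "t \<in> time_step T (max k m)"
            using k m incseqD[OF B(3), of m "max k m"] incseqD[OF time_step(4)[OF T], of k "max k m"] by auto
          then have "g t x \<le> G (x, t)"
            unfolding G_def val by (intro SUP_upper2[of "max k m"]) auto
          moreover have "G (x, t) \<le> g t x" unfolding G_def val by (intro SUP_least) auto
          ultimately show "G (x, t) = g t x" by (rule antisym[rotated])
        qed
      qed
    qed
  qed
  ultimately show ?thesis unfolding is_par_ugrad_def g_def by blast
qed

end

lemma is_par_ugrad_par_ugrad:
  assumes "\<exists>G. is_par_ugrad p M \<Omega> T u G"
  shows "is_par_ugrad p M \<Omega> T u (par_ugrad p M \<Omega> T u)"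
  using assms unfolding par_ugrad_def by (simp add: someI_ex)

lemma is_par_ugrad_measurable:
  assumes "open \<Omega>" "is_par_ugrad p M \<Omega> T u G"
  shows "(\<lambda>z. G z * indicator (cylinder \<Omega> T) z) \<in> borel_measurable (completion (spacetime M))"
proof -
  have "open (cylinder \<Omega> T)" using assms(1) by (intro open_Times) auto
  then show ?thesis
    using assms(2) unfolding is_par_ugrad_def by (simp only: borel_measurable_restrict_completion_iff)
qed

text \<open>An inequality on almost all slices becomes one almost everywhere in space-time because
  both representatives are jointly measurable. The constant \<open>c\<close> is 0 for equalities and
  the Lipschitz constant for perturbations.\<close>

lemma is_par_ugrad_compare:
  assumes o: "open \<Omega>" and G: "is_par_ugrad p M \<Omega> T u G" and G': "is_par_ugrad p M \<Omega> T w G'"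
    and E: "E \<in> sets borel" "E \<subseteq> cylinder \<Omega> T"
    and le: "AE t in lborel. t \<in> {0<..<T} \<longrightarrow> (AE x in M. (x, t) \<in> E \<longrightarrow>
        min_ugrad p M \<Omega> (\<lambda>x. u (x, t)) x \<le> min_ugrad p M \<Omega> (\<lambda>x. w (x, t)) x + c)"
  shows "AE z in spacetime M. z \<in> E \<longrightarrow> G z \<le> G' z + c"
proof (rule AE_spacetime_of_slices)
  let ?Q = "cylinder \<Omega> T"
  note [measurable] = is_par_ugrad_measurable[OF o G] is_par_ugrad_measurable[OF o G']
  have [measurable]: "E \<in> sets (completion (spacetime M))"
    using E(1) by (rule sets_completion_spacetimeI)
  have "{z. z \<in> E \<longrightarrow> G z \<le> G' z + c} =
    {z \<in> space (completion (spacetime M)). z \<in> E \<longrightarrow> G z * indicator ?Q z \<le> G' z * indicator ?Q z + c}"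
    using E(2) by auto
  also have "\<dots> \<in> sets (completion (spacetime M))" by measurable
  finally show "{z. z \<in> E \<longrightarrow> G z \<le> G' z + c} \<in> sets (completion (spacetime M))" .
  have G1: "AE t in lborel. t \<in> {0<..<T} \<longrightarrow> (AE x in M. x \<in> \<Omega> \<longrightarrow> G (x, t) = min_ugrad p M \<Omega> (\<lambda>y. u (y, t)) x)"
    and G2: "AE t in lborel. t \<in> {0<..<T} \<longrightarrow> (AE x in M. x \<in> \<Omega> \<longrightarrow> G' (x, t) = min_ugrad p M \<Omega> (\<lambda>y. w (y, t)) x)"
    using G G' by (auto simp: is_par_ugrad_def)
  show "AE t in lborel. AE x in M. (x, t) \<in> E \<longrightarrow> G (x, t) \<le> G' (x, t) + c"
    using G1 G2 le
  proof eventually_elim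
    case (elim t)
    show ?case
    proof (cases "t \<in> {0<..<T}")
      case True
      have 1: "AE x in M. x \<in> \<Omega> \<longrightarrow> G (x, t) = min_ugrad p M \<Omega> (\<lambda>y. u (y, t)) x"
        and 2: "AE x in M. x \<in> \<Omega> \<longrightarrow> G' (x, t) = min_ugrad p M \<Omega> (\<lambda>y. w (y, t)) x"
        and 3: "AE x in M. (x, t) \<in> E \<longrightarrow>
          min_ugrad p M \<Omega> (\<lambda>x. u (x, t)) x \<le> min_ugrad p M \<Omega> (\<lambda>x. w (x, t)) x + c"
        using elim True by auto
      from 1 2 3 show ?thesis
      proof eventually_elim
        case (elim x)
        show ?case using elim E(2) by auto
      qed
    next
      case False
      then have "(x, t) \<notin> E" for x using E(2) by auto
      then show ?thesis by simp
    qed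
  qed
qed

lemma is_par_ugrad_agree:
  assumes o: "open \<Omega>" and G: "is_par_ugrad p M \<Omega> T u G" and G': "is_par_ugrad p M \<Omega> T w G'"
    and E: "E \<in> sets borel" "E \<subseteq> cylinder \<Omega> T"
    and eq: "AE t in lborel. t \<in> {0<..<T} \<longrightarrow> (AE x in M. (x, t) \<in> E \<longrightarrow>
        min_ugrad p M \<Omega> (\<lambda>x. u (x, t)) x = min_ugrad p M \<Omega> (\<lambda>x. w (x, t)) x)"
  shows "AE z in spacetime M. z \<in> E \<longrightarrow> G z = G' z"
proof -
  have "AE t in lborel. t \<in> {0<..<T} \<longrightarrow> (AE x in M. (x, t) \<in> E \<longrightarrow>
        min_ugrad p M \<Omega> (\<lambda>x. u (x, t)) x \<le> min_ugrad p M \<Omega> (\<lambda>x. w (x, t)) x + 0)"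
    using eq by eventually_elim (auto elim!: eventually_mono)
  from is_par_ugrad_compare[OF o G G' E this] have 1: "AE z in spacetime M. z \<in> E \<longrightarrow> G z \<le> G' z + 0" .
  have "AE t in lborel. t \<in> {0<..<T} \<longrightarrow> (AE x in M. (x, t) \<in> E \<longrightarrow>
        min_ugrad p M \<Omega> (\<lambda>x. w (x, t)) x \<le> min_ugrad p M \<Omega> (\<lambda>x. u (x, t)) x + 0)"
    using eq by eventually_elim (auto elim!: eventually_mono)
  from is_par_ugrad_compare[OF o G' G E this] have 2: "AE z in spacetime M. z \<in> E \<longrightarrow> G' z \<le> G z + 0" .
  from 1 2 show ?thesis by eventually_elim auto
qed

end

section \<open>Test functions and energies\<close>

lemma lipschitz_slices:
  fixes \<phi> :: "'x::metric_space \<times> real \<Rightarrow> real"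
  assumes "L-lipschitz_on (cylinder \<Omega> T) \<phi>"
  shows "t \<in> {0<..<T} \<Longrightarrow> L-lipschitz_on \<Omega> (\<lambda>x. \<phi> (x, t))"
    and "x \<in> \<Omega> \<Longrightarrow> L-lipschitz_on {0<..<T} (\<lambda>s. \<phi> (x, s))"
proof -
  have L: "0 \<le> L" using assms by (rule lipschitz_on_nonneg)
  show "t \<in> {0<..<T} \<Longrightarrow> L-lipschitz_on \<Omega> (\<lambda>x. \<phi> (x, t))"
    using lipschitz_onD[OF assms, of "(_, t)" "(_, t)"] L
    by (intro lipschitz_onI) (auto simp: dist_Pair_Pair)
  show "x \<in> \<Omega> \<Longrightarrow> L-lipschitz_on {0<..<T} (\<lambda>s. \<phi> (x, s))"
    using lipschitz_onD[OF assms, of "(x, _)" "(x, _)"] L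
    by (intro lipschitz_onI) (auto simp: dist_Pair_Pair)
qed

lemma lipschitz_truncate:
  fixes \<phi> :: "'a::metric_space \<Rightarrow> real"
  assumes "L-lipschitz_on A \<phi>"
  shows "L-lipschitz_on A (\<lambda>z. max (\<phi> z - e) 0)"
proof (rule lipschitz_onI)
  fix x y assume "x \<in> A" "y \<in> A"
  then have "dist (\<phi> x) (\<phi> y) \<le> L * dist x y" by (rule lipschitz_onD[OF assms])
  moreover have "dist (max (\<phi> x - e) 0) (max (\<phi> y - e) 0) \<le> dist (\<phi> x) (\<phi> y)"
    by (simp add: dist_real_def)
  ultimately show "dist (max (\<phi> x - e) 0) (max (\<phi> y - e) 0) \<le> L * dist x y" by linarith
qed (rule lipschitz_on_nonneg[OF assms])

text \<open>With finite energies the inequality is one between real numbers, where limits of sums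
  and products can be taken.\<close>

lemma ereal_energy_iff:
  assumes "b < \<infinity>" "c < \<infinity>"
  shows "ereal a + enn2ereal b \<le> ereal K * enn2ereal c \<longleftrightarrow> a + enn2real b \<le> K * enn2real c"
proof -
  obtain r where r: "b = ennreal r" "0 \<le> r" using assms(1) by (cases b) auto
  obtain s where s: "c = ennreal s" "0 \<le> s" using assms(2) by (cases c) auto
  show ?thesis using r s by simp
qed

lemma borel_continuous_preimage:
  fixes f :: "'a::topological_space \<Rightarrow> 'b::topological_space"
  assumes "open A" "continuous_on A f" "closed C"
  shows "A \<inter> f -` C \<in> sets borel"
proof -
  have "closedin (top_of_set A) (A \<inter> f -` C)" using assms(2,3) by (rule continuous_closedin_preimage)
  then obtain D where "closed D" "A \<inter> f -` C = A \<inter> D" by (auto simp: closedin_closed)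
  then show ?thesis using assms(1) by auto
qed

context proper_measure_space
begin

lemma compact_subset_cylinder:
  fixes \<Omega> :: "'x set"
  assumes o: "open \<Omega>" "bounded \<Omega>" and T: "0 < T" and S: "compact S" "S \<subseteq> cylinder \<Omega> T"
  obtains D t1 t2 where "open D" "compactly_in D \<Omega>" "0 < t1" "t1 < t2" "t2 < T" "S \<subseteq> D \<times> {t1<..<t2}"
proof -
  obtain B :: "nat \<Rightarrow> 'x set" where B: "\<And>n. open (B n)" "\<And>n. compactly_in (B n) \<Omega>" "incseq B"
    "\<And>K. compact K \<Longrightarrow> K \<subseteq> \<Omega> \<Longrightarrow> \<exists>n. K \<subseteq> B n"
    using exhaustion[OF o] by metis
  have "compact (fst ` S)" "compact (snd ` S)"
    using S(1) by (auto intro!: compact_continuous_image continuous_on_fst continuous_on_snd continuous_on_id)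
  moreover have sub: "fst ` S \<subseteq> \<Omega>" "snd ` S \<subseteq> {0<..<T}" using S(2) by auto
  ultimately obtain n where n: "fst ` S \<subseteq> B n" using B(4) by blast
  have "\<exists>k. snd ` S \<subseteq> time_step T k"
  proof (cases "S = {}")
    case False
    obtain a where a: "a \<in> snd ` S" "\<And>t. t \<in> snd ` S \<Longrightarrow> a \<le> t"
      using compact_attains_inf[OF \<open>compact (snd ` S)\<close>] False by blast
    obtain b where b: "b \<in> snd ` S" "\<And>t. t \<in> snd ` S \<Longrightarrow> t \<le> b"
      using compact_attains_sup[OF \<open>compact (snd ` S)\<close>] False by blast
    obtain i j where "a \<in> time_step T i" "b \<in> time_step T j"
      using time_step(5)[OF T] a(1) b(1) sub(2) by blast
    then have "a \<in> time_step T (max i j)" "b \<in> time_step T (max i j)"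
      using incseqD[OF time_step(4)[OF T], of i "max i j"] incseqD[OF time_step(4)[OF T], of j "max i j"] by auto
    then have "t \<in> time_step T (max i j)" if "t \<in> snd ` S" for t
      using a(2)[OF that] b(2)[OF that] by (auto simp: time_step_def)
    then show ?thesis by blast
  qed simp
  then obtain k where k: "snd ` S \<subseteq> time_step T k" ..
  have "S \<subseteq> B n \<times> time_step T k"
  proof
    fix z assume "z \<in> S"
    then have "fst z \<in> B n" "snd z \<in> time_step T k" using n k by blast+
    then show "z \<in> B n \<times> time_step T k" by (cases z) auto
  qed
  then show thesis
    using B(1,2)[of n] time_step(1-3)[OF T, of k] unfolding time_step_def by (intro that)
qed

lemma compact_closed_subset_cylinder:
  fixes \<Omega> :: "'x set"
  assumes "bounded \<Omega>" "closed S" "S \<subseteq> cylinder \<Omega> T"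
  shows "compact S"
proof -
  obtain a R where R: "\<Omega> \<subseteq> cball a R" using assms(1) by (auto simp: bounded_subset_cball)
  have "compact (cball a R)" by (intro proper) auto
  then have "compact (cball a R \<times> {0..T})" by (intro compact_Times) auto
  then have "compact ((cball a R \<times> {0..T}) \<inter> S)" using assms(2) by (rule compact_Int_closed)
  moreover have "S \<subseteq> cball a R \<times> {0..T}" using assms(3) R by auto
  ultimately show ?thesis by (simp add: Int_absorb1)
qed

text \<open>For each \<open>x\<close> the one-dimensional result applies, and Fubini combines the
  null sets because the exceptional set is Borel.\<close>

lemma time_deriv_eq_0:
  assumes o: "open \<Omega>" and \<phi>: "L-lipschitz_on (cylinder \<Omega> T) \<phi>" and nn: "\<And>z. z \<in> cylinder \<Omega> T \<Longrightarrow> 0 \<le> \<phi> z"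
  shows "AE z in spacetime M. z \<in> cylinder \<Omega> T \<and> \<phi> z = 0 \<longrightarrow> time_deriv \<phi> z = 0"
proof -
  interpret pair_sigma_finite M lborel by (rule pair_sigma_finite_spacetime)
  let ?Q = "cylinder \<Omega> T"
  have open_Q: "open ?Q" using o by (intro open_Times) auto
  have cont: "continuous_on ?Q \<phi>" using \<phi> by (rule lipschitz_on_continuous_on)
  have "?Q \<inter> \<phi> -` {0} \<in> sets borel" using open_Q cont by (rule borel_continuous_preimage) simp
  moreover have "(\<lambda>z. time_deriv \<phi> z * indicator ?Q z) -` (- {0}) \<inter> space borel \<in> sets borel"
    using borel_measurable_time_deriv[OF o cont] by (rule measurable_sets) simp
  ultimately have "?Q \<inter> \<phi> -` {0} \<inter> ((\<lambda>z. time_deriv \<phi> z * indicator ?Q z) -` (- {0})) \<in> sets borel"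
    by auto
  also have "?Q \<inter> \<phi> -` {0} \<inter> ((\<lambda>z. time_deriv \<phi> z * indicator ?Q z) -` (- {0})) =
    {z \<in> ?Q. \<phi> z = 0 \<and> time_deriv \<phi> z \<noteq> 0}" by (auto simp: indicator_def)
  finally have A: "{z \<in> ?Q. \<phi> z = 0 \<and> time_deriv \<phi> z \<noteq> 0} \<in> sets (spacetime M)" by (simp only: sets_spacetime)
  have "AE t in lborel. (x, t) \<in> ?Q \<and> \<phi> (x, t) = 0 \<longrightarrow> time_deriv \<phi> (x, t) = 0" for x
  proof (cases "x \<in> \<Omega>")
    case True
    have "negligible {t \<in> {0<..<T}. \<phi> (x, t) = 0 \<and> \<not> ((\<lambda>s. \<phi> (x, s)) has_field_derivative 0) (at t)}"
      using lipschitz_slices(2)[OF \<phi> True] by (rule negligible_zeros_deriv_ne_0) (use nn True in auto)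
    then have "AE t in lebesgue. t \<notin> {t \<in> {0<..<T}. \<phi> (x, t) = 0 \<and> \<not> ((\<lambda>s. \<phi> (x, s)) has_field_derivative 0) (at t)}"
      unfolding negligible_iff_null_sets by (rule AE_not_in)
    then have "AE t in lborel. t \<notin> {t \<in> {0<..<T}. \<phi> (x, t) = 0 \<and> \<not> ((\<lambda>s. \<phi> (x, s)) has_field_derivative 0) (at t)}"
      by (simp only: AE_completion_iff)
    then show ?thesis
      by eventually_elim (auto simp: time_deriv_def dest: DERIV_imp_deriv)
  qed simp
  then have ae: "AE x in M. AE t in lborel. (x, t) \<in> ?Q \<and> \<phi> (x, t) = 0 \<longrightarrow> time_deriv \<phi> (x, t) = 0" by simp
  have "{z \<in> space (spacetime M). z \<in> ?Q \<and> \<phi> z = 0 \<longrightarrow> time_deriv \<phi> z = 0} =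
    space (spacetime M) - {z \<in> ?Q. \<phi> z = 0 \<and> time_deriv \<phi> z \<noteq> 0}" by auto
  then have "{z \<in> space (spacetime M). z \<in> ?Q \<and> \<phi> z = 0 \<longrightarrow> time_deriv \<phi> z = 0} \<in> sets (spacetime M)"
    using A by (simp only:) (rule sets.compl_sets)
  from AE_pair_measure[OF this ae] show ?thesis .
qed

context
  fixes \<Omega> :: "'x set" and T :: real and u :: "'x \<times> real \<Rightarrow> ereal"
  assumes o: "open \<Omega>" "bounded \<Omega>" and T: "0 < T"
    and N: "in_Lp_newtonian_loc p M \<Omega> T u"
    and L2: "in_Lp_loc 2 (spacetime M) (cylinder \<Omega> T) u"
begin

section \<open>Finiteness of energies and integrability of the drift term\<close>

abbreviation "Q \<equiv> cylinder \<Omega> T"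

abbreviation "energy w A \<equiv> (\<integral>\<^sup>+z\<in>A. epow (par_ugrad p M \<Omega> T w z) p \<partial>spacetime M)"

abbreviation "drift \<phi> A \<equiv> (LINT z:A|completion (spacetime M). real_of_ereal (u z) * time_deriv \<phi> z)"

abbreviation "perturb \<phi> \<equiv> (\<lambda>z. u z + ereal (\<phi> z))"

abbreviation "has_ugrad w \<equiv> (\<exists>G. is_par_ugrad p M \<Omega> T w G)"

lemma open_Q: "open Q"
  using o by (intro open_Times) auto

lemma is_par_ugrad_u: "is_par_ugrad p M \<Omega> T u (par_ugrad p M \<Omega> T u)"
  by (intro is_par_ugrad_par_ugrad is_par_ugrad_exists[OF o T N L2])

lemma energy_measurable:
  assumes w: "is_par_ugrad p M \<Omega> T w (par_ugrad p M \<Omega> T w)" and A: "A \<in> sets borel" "A \<subseteq> Q"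
  shows "(\<lambda>z. epow (par_ugrad p M \<Omega> T w z) p * indicator A z) \<in> borel_measurable (completion (spacetime M))"
proof -
  note [measurable] = is_par_ugrad_measurable[OF o(1) w] sets_completion_spacetimeI[OF A(1)]
  have "(\<lambda>z. epow (par_ugrad p M \<Omega> T w z * indicator Q z) p * indicator A z) \<in> borel_measurable (completion (spacetime M))"
    by measurable
  also have "(\<lambda>z. epow (par_ugrad p M \<Omega> T w z * indicator Q z) p * indicator A z) =
      (\<lambda>z. epow (par_ugrad p M \<Omega> T w z) p * indicator A z)"
    using A(2) by (auto simp: indicator_def fun_eq_iff)
  finally show ?thesis .
qed

text \<open>A box around the compact closure of \<open>U\<close> reduces the claim to the time
  integral of the p-th power of the Newtonian norm, which dominates the gradient term.\<close>

lemma energy_u_finite: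
  assumes U: "compactly_in U Q"
  shows "energy u U < \<infinity>"
proof -
  interpret pair_sigma_finite M lborel by (rule pair_sigma_finite_spacetime)
  let ?G = "par_ugrad p M \<Omega> T u"
  have "compact (closure U)" "closure U \<subseteq> Q" using U by (auto simp: compactly_in_def)
  then obtain D t1 t2 where D: "open D" "compactly_in D \<Omega>" and t: "0 < t1" "t1 < t2" "t2 < T"
    and sub: "closure U \<subseteq> D \<times> {t1<..<t2}"
    using compact_subset_cylinder[OF o T] by metis
  let ?I = "{t1<..<t2}"
  let ?DI = "D \<times> ?I"
  have DI: "?DI \<in> sets borel" "?DI \<subseteq> Q"
    using D t closure_subset[of D] unfolding compactly_in_def by (auto intro!: borel_open open_Times)
  from completion_ex_borel_measurable[OF energy_measurable[OF is_par_ugrad_u DI]]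
  obtain V where V: "V \<in> borel_measurable (spacetime M)"
    and V_eq: "AE z in spacetime M. epow (?G z) p * indicator ?DI z = V z" by blast
  have G: "AE t in lborel. t \<in> {0<..<T} \<longrightarrow> (AE x in M. x \<in> \<Omega> \<longrightarrow> ?G (x, t) = min_ugrad p M \<Omega> (\<lambda>y. u (y, t)) x)"
    using is_par_ugrad_u by (simp add: is_par_ugrad_def)
  have "energy u U \<le> energy u ?DI"
    using sub closure_subset[of U] by (intro nn_integral_mono) (auto simp: indicator_def)
  also have "energy u ?DI = (\<integral>\<^sup>+z. V z \<partial>spacetime M)"
    using V_eq by (rule nn_integral_cong_AE)
  also have "\<dots> = (\<integral>\<^sup>+t. (\<integral>\<^sup>+x. V (x, t) \<partial>M) \<partial>lborel)"
    using V by (rule nn_integral_snd[symmetric])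
  also have "\<dots> \<le> (\<integral>\<^sup>+t\<in>?I. epow (newton_norm p M D (\<lambda>x. u (x, t))) p \<partial>lborel)"
  proof (rule nn_integral_mono_AE)
    show "AE t in lborel. (\<integral>\<^sup>+x. V (x, t) \<partial>M) \<le> epow (newton_norm p M D (\<lambda>x. u (x, t))) p * indicator ?I t"
      using AE_spacetime_slices[OF V_eq] G slice_integral_finite[OF o T N L2 D t]
    proof eventually_elim
      case (elim t)
      show ?case
      proof (cases "t \<in> ?I")
        case True
        let ?F = "\<integral>\<^sup>+x\<in>D. epow (min_ugrad p M \<Omega> (\<lambda>x. u (x, t)) x) p \<partial>M"
        have "AE x in M. x \<in> \<Omega> \<longrightarrow> ?G (x, t) = min_ugrad p M \<Omega> (\<lambda>y. u (y, t)) x"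
          using elim(2) True t(1,3) by auto
        with elim(1) have "AE x in M. V (x, t) = epow (min_ugrad p M \<Omega> (\<lambda>x. u (x, t)) x) p * indicator D x"
        proof eventually_elim
          case (elim x)
          have "x \<in> D \<Longrightarrow> x \<in> \<Omega>" using D(2) closure_subset[of D] unfolding compactly_in_def by blast
          then show ?case using elim True by (auto simp: indicator_def)
        qed
        then have "(\<integral>\<^sup>+x. V (x, t) \<partial>M) = ?F" by (rule nn_integral_cong_AE)
        also have "\<dots> = epow (epow ?F (1 / p)) p" by (simp add: epow_epow_inverse(2)[OF p_pos])
        also have "\<dots> \<le> epow (newton_norm p M D (\<lambda>x. u (x, t))) p"
          using elim(3) True p_pos by (intro epow_mono) auto
        finally show ?thesis using True by simp
      next
        case False
        from elim(1) have "AE x in M. V (x, t) = 0" by eventually_elim (use False in auto)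
        then have "(\<integral>\<^sup>+x. V (x, t) \<partial>M) = (\<integral>\<^sup>+x. 0 \<partial>M)" by (rule nn_integral_cong_AE)
        then show ?thesis by simp
      qed
    qed
  qed
  also have "\<dots> < \<infinity>"
    using N D t by (auto simp: in_Lp_newtonian_loc_def in_Lp_newtonian_def)
  finally show ?thesis .
qed

lemma minimal_wug_slices_add:
  assumes \<phi>: "L-lipschitz_on Q \<phi>"
  shows "AE t in lborel. t \<in> {0<..<T} \<longrightarrow>
    minimal_wug p M \<Omega> (\<lambda>x. u (x, t) + ereal (\<phi> (x, t))) (min_ugrad p M \<Omega> (\<lambda>x. u (x, t) + ereal (\<phi> (x, t)))) \<and>
    (AE x in M. x \<in> \<Omega> \<longrightarrow> min_ugrad p M \<Omega> (\<lambda>x. u (x, t) + ereal (\<phi> (x, t))) x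
      \<le> min_ugrad p M \<Omega> (\<lambda>x. u (x, t)) x + ennreal L)"
  using minimal_wug_slices[OF o T N L2]
proof eventually_elim
  case (elim t)
  show ?case
  proof
    assume t: "t \<in> {0<..<T}"
    then have "loc_wug p M \<Omega> (\<lambda>x. u (x, t)) (min_ugrad p M \<Omega> (\<lambda>x. u (x, t)))"
      using elim by (simp add: minimal_wug_iff)
    from loc_wug_add_lipschitz[OF o(1) this lipschitz_slices(1)[OF \<phi> t]]
    have w: "loc_wug p M \<Omega> (\<lambda>x. u (x, t) + ereal (\<phi> (x, t))) (\<lambda>x. min_ugrad p M \<Omega> (\<lambda>x. u (x, t)) x + ennreal L)" .
    then have m: "minimal_wug p M \<Omega> (\<lambda>x. u (x, t) + ereal (\<phi> (x, t))) (min_ugrad p M \<Omega> (\<lambda>x. u (x, t) + ereal (\<phi> (x, t))))"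
      by (intro minimal_wug_min_ugrad[OF o]) blast
    with w show "minimal_wug p M \<Omega> (\<lambda>x. u (x, t) + ereal (\<phi> (x, t))) (min_ugrad p M \<Omega> (\<lambda>x. u (x, t) + ereal (\<phi> (x, t)))) \<and>
    (AE x in M. x \<in> \<Omega> \<longrightarrow> min_ugrad p M \<Omega> (\<lambda>x. u (x, t) + ereal (\<phi> (x, t))) x
      \<le> min_ugrad p M \<Omega> (\<lambda>x. u (x, t)) x + ennreal L)"
      unfolding minimal_wug_iff by blast
  qed
qed

lemma emeasure_spacetime_finite:
  assumes U: "compactly_in U Q"
  shows "emeasure (spacetime M) U < \<infinity>"
proof -
  interpret pair_sigma_finite M lborel by (rule pair_sigma_finite_spacetime)
  have "compact (closure U)" "closure U \<subseteq> Q" using U by (auto simp: compactly_in_def)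
  then obtain D t1 t2 where D: "open D" "compactly_in D \<Omega>" and t: "0 < t1" "t1 < t2" "t2 < T"
    and sub: "closure U \<subseteq> D \<times> {t1<..<t2}"
    using compact_subset_cylinder[OF o T] by metis
  have Dm: "D \<in> sets M" using D(1) by (simp add: sets_M)
  have "D \<subseteq> \<Omega>" using D(2) closure_subset[of D] unfolding compactly_in_def by blast
  then have "bounded D" using o(2) by (rule bounded_subset[rotated])
  then have fD: "emeasure M D < \<infinity>" by (rule finite_bounded)
  have "emeasure (spacetime M) U \<le> emeasure (spacetime M) (D \<times> {t1<..<t2})"
    using sub closure_subset[of U] Dm by (intro emeasure_mono pair_measureI) auto
  also have "\<dots> = emeasure M D * emeasure lborel {t1<..<t2}"
    using Dm by (intro lborel.emeasure_pair_measure_Times) auto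
  also have "\<dots> < \<infinity>" using fD t by (simp add: ennreal_mult_less_top)
  finally show ?thesis .
qed

text \<open>On almost every slice the minimal gradient of \<open>u + \<phi>\<close> exceeds that of
  \<open>u\<close> by at most \<open>L\<close>, and \<open>U\<close> has finite measure.\<close>

lemma energy_add_finite:
  assumes U: "open U" "compactly_in U Q" and \<phi>: "L-lipschitz_on Q \<phi>"
    and v: "is_par_ugrad p M \<Omega> T (\<lambda>z. u z + ereal (\<phi> z)) (par_ugrad p M \<Omega> T (\<lambda>z. u z + ereal (\<phi> z)))"
  shows "energy (\<lambda>z. u z + ereal (\<phi> z)) U < \<infinity>"
proof -
  have UQ: "U \<subseteq> Q" using U(2) closure_subset[of U] unfolding compactly_in_def by blast
  have Um: "U \<in> sets borel" using U(1) by simp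
  have "AE t in lborel. t \<in> {0<..<T} \<longrightarrow> (AE x in M. (x, t) \<in> U \<longrightarrow>
        min_ugrad p M \<Omega> (\<lambda>x. u (x, t) + ereal (\<phi> (x, t))) x \<le> min_ugrad p M \<Omega> (\<lambda>x. u (x, t)) x + ennreal L)"
    using minimal_wug_slices_add[OF \<phi>]
  proof eventually_elim
    case (elim t)
    show ?case
    proof
      assume "t \<in> {0<..<T}"
      with elim have "AE x in M. x \<in> \<Omega> \<longrightarrow> min_ugrad p M \<Omega> (\<lambda>x. u (x, t) + ereal (\<phi> (x, t))) x
        \<le> min_ugrad p M \<Omega> (\<lambda>x. u (x, t)) x + ennreal L" by blast
      then show "AE x in M. (x, t) \<in> U \<longrightarrow> min_ugrad p M \<Omega> (\<lambda>x. u (x, t) + ereal (\<phi> (x, t))) x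
        \<le> min_ugrad p M \<Omega> (\<lambda>x. u (x, t)) x + ennreal L"
        by eventually_elim (use UQ in auto)
    qed
  qed
  from is_par_ugrad_compare[OF o(1) v is_par_ugrad_u Um UQ this]
  have le: "AE z in spacetime M. z \<in> U \<longrightarrow> par_ugrad p M \<Omega> T (\<lambda>z. u z + ereal (\<phi> z)) z \<le> par_ugrad p M \<Omega> T u z + ennreal L" .
  let ?c = "ennreal (2 powr p)"
  have "energy (\<lambda>z. u z + ereal (\<phi> z)) U \<le>
     (\<integral>\<^sup>+z. ?c * (epow (par_ugrad p M \<Omega> T u z) p * indicator U z) + ?c * epow (ennreal L) p * indicator U z \<partial>spacetime M)"
  proof (rule nn_integral_mono_AE)
    show "AE z in spacetime M. epow (par_ugrad p M \<Omega> T (\<lambda>z. u z + ereal (\<phi> z)) z) p * indicator U z \<le>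
      ?c * (epow (par_ugrad p M \<Omega> T u z) p * indicator U z) + ?c * epow (ennreal L) p * indicator U z"
      using le
    proof eventually_elim
      case (elim z)
      show ?case
      proof (cases "z \<in> U")
        case True
        then have "epow (par_ugrad p M \<Omega> T (\<lambda>z. u z + ereal (\<phi> z)) z) p \<le> epow (par_ugrad p M \<Omega> T u z + ennreal L) p"
          using elim p_pos by (intro epow_mono) auto
        also have "\<dots> \<le> ?c * epow (par_ugrad p M \<Omega> T u z) p + ?c * epow (ennreal L) p"
          using p_pos by (rule epow_add_le)
        finally show ?thesis using True by simp
      qed simp
    qed
  qed
  \<comment> \<open>The gradients are measurable with respect to the completion, so the sum is split
    there; the value of the integral is unchanged.\<close>
  also have "\<dots> = (\<integral>\<^sup>+z. ?c * (epow (par_ugrad p M \<Omega> T u z) p * indicator U z) + ?c * epow (ennreal L) p * indicator U z \<partial>completion (spacetime M))"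
    by (simp only: nn_integral_completion)
  also have "\<dots> = ?c * (\<integral>\<^sup>+z. epow (par_ugrad p M \<Omega> T u z) p * indicator U z \<partial>completion (spacetime M))
      + ?c * epow (ennreal L) p * emeasure (completion (spacetime M)) U"
  proof -
    note [measurable] = energy_measurable[OF is_par_ugrad_u Um UQ] sets_completion_spacetimeI[OF Um]
    show ?thesis
      by (subst nn_integral_add, measurable) (simp add: nn_integral_cmult nn_integral_cmult_indicator)
  qed
  also have "\<dots> = ?c * energy u U + ?c * epow (ennreal L) p * emeasure (spacetime M) U"
  proof -
    have "U \<in> sets (spacetime M)" using Um by (simp only: sets_spacetime)
    then have "emeasure (completion (spacetime M)) U = emeasure (spacetime M) U"
      by (metis nn_integral_completion nn_integral_indicator sets_completionI_sets)
    then show ?thesis by (simp only: nn_integral_completion)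
  qed
  also have "\<dots> < \<infinity>"
    using energy_u_finite[OF U(2)] emeasure_spacetime_finite[OF U(2)] by (simp add: ennreal_mult_less_top)
  finally show ?thesis .
qed

text \<open>On a set of finite measure |u| \<le> 1 + u^2 suffices. Infinite values do no harm, as
  \<open>real_of_ereal\<close> sends them to 0.\<close>

lemma set_integrable_u:
  assumes U: "open U" "compactly_in U Q"
  shows "set_integrable (completion (spacetime M)) U (\<lambda>z. real_of_ereal (u z))"
proof -
  let ?C = "completion (spacetime M)"
  have Us: "U \<in> sets ?C" using U(1) by (intro sets_completion_spacetimeI) auto
  have in2: "in_Lp 2 (spacetime M) U u" using L2 U by (auto simp: in_Lp_loc_def)
  then have "u \<in> borel_measurable (restrict_space ?C U)" by (simp add: in_Lp_def)
  then have "(\<lambda>z. real_of_ereal (u z)) \<in> borel_measurable (restrict_space ?C U)" by measurable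
  then have meas: "(\<lambda>z. indicator U z *\<^sub>R real_of_ereal (u z)) \<in> borel_measurable ?C"
    using Us by (subst (asm) borel_measurable_restrict_space_iff) auto
  have le: "ennreal \<bar>real_of_ereal a\<bar> \<le> 1 + epow (e2ennreal \<bar>a\<bar>) 2" for a
  proof (cases a)
    case (real r)
    have "\<bar>r\<bar> \<le> 1 + \<bar>r\<bar> ^ 2"
    proof (cases "\<bar>r\<bar> \<le> 1")
      case False
      then have "\<bar>r\<bar> * 1 \<le> \<bar>r\<bar> * \<bar>r\<bar>" by (intro mult_left_mono) auto
      then show ?thesis by (simp add: power2_eq_square)
    qed (auto intro: add_increasing2)
    then have "ennreal \<bar>r\<bar> \<le> ennreal (1 + \<bar>r\<bar> powr 2)" by (intro ennreal_leI) simp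
    also have "\<dots> = 1 + epow (ennreal \<bar>r\<bar>) 2" by (simp add: epow_ennreal)
    finally show ?thesis using real by simp
  qed auto
  have "(\<integral>\<^sup>+z. ennreal (norm (indicator U z *\<^sub>R real_of_ereal (u z))) \<partial>?C)
    \<le> (\<integral>\<^sup>+z. indicator U z + epow (e2ennreal \<bar>u z\<bar>) 2 * indicator U z \<partial>?C)"
    using le by (intro nn_integral_mono) (auto simp: indicator_def)
  also have "\<dots> = emeasure ?C U + (\<integral>\<^sup>+z\<in>U. epow (e2ennreal \<bar>u z\<bar>) 2 \<partial>?C)"
  proof -
    have "(\<lambda>z. epow (e2ennreal \<bar>u z\<bar>) 2) \<in> borel_measurable (restrict_space ?C U)"
      using \<open>u \<in> _\<close> by measurable
    then have "(\<lambda>z. epow (e2ennreal \<bar>u z\<bar>) 2 * indicator U z) \<in> borel_measurable ?C"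
      unfolding borel_measurable_restrict_completion_iff[OF U(1)] .
    then show ?thesis using Us by (subst nn_integral_add) auto
  qed
  also have "\<dots> < \<infinity>"
  proof -
    have "U \<in> sets (spacetime M)" using U(1) by (simp only: sets_spacetime borel_open)
    then have "emeasure ?C U = emeasure (spacetime M) U"
      by (metis nn_integral_completion nn_integral_indicator sets_completionI_sets)
    moreover have "(\<integral>\<^sup>+z\<in>U. epow (e2ennreal \<bar>u z\<bar>) 2 \<partial>spacetime M) < \<infinity>"
      using in2 by (simp add: in_Lp_def Lp_norm_def)
    ultimately show ?thesis
      using emeasure_spacetime_finite[OF U(2)] by (simp add: nn_integral_completion)
  qed
  finally show ?thesis
    unfolding set_integrable_def using meas by (intro integrableI_bounded)
qed

text \<open>The time derivative is bounded on the cylinder, its default value included, and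
  \<open>u\<close> is integrable over \<open>U\<close>.\<close>

lemma drift_integrable:
  assumes U: "open U" "compactly_in U Q" and \<phi>: "L-lipschitz_on Q \<phi>"
  shows "set_integrable (completion (spacetime M)) U (\<lambda>z. real_of_ereal (u z) * time_deriv \<phi> z)"
proof -
  let ?C = "completion (spacetime M)"
  have UQ: "U \<subseteq> Q" using U(2) closure_subset[of U] unfolding compactly_in_def by blast
  define c where "c = max L \<bar>SOME D::real. False\<bar>"
  have td: "\<bar>time_deriv \<phi> z\<bar> \<le> c" if "z \<in> U" for z
    unfolding c_def using time_deriv_bound[OF \<phi>] that UQ by blast
  have u: "set_integrable ?C U (\<lambda>z. real_of_ereal (u z))" by (rule set_integrable_u[OF U])
  then have um: "(\<lambda>z. indicator U z *\<^sub>R real_of_ereal (u z)) \<in> borel_measurable ?C"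
    unfolding set_integrable_def by (rule borel_measurable_integrable)
  have "(\<lambda>z. time_deriv \<phi> z * indicator Q z) \<in> borel_measurable borel"
    using borel_measurable_time_deriv[OF o(1) lipschitz_on_continuous_on[OF \<phi>]] .
  then have "(\<lambda>z. time_deriv \<phi> z * indicator Q z) \<in> borel_measurable (spacetime M)"
    by (simp only: measurable_cong_sets[OF sets_spacetime refl])
  then have tm: "(\<lambda>z. time_deriv \<phi> z * indicator Q z) \<in> borel_measurable ?C" by (rule measurable_completion)
  have "(\<lambda>z. (indicator U z *\<^sub>R real_of_ereal (u z)) * (time_deriv \<phi> z * indicator Q z)) \<in> borel_measurable ?C"
    using um tm by measurable
  also have "(\<lambda>z. (indicator U z *\<^sub>R real_of_ereal (u z)) * (time_deriv \<phi> z * indicator Q z)) =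
      (\<lambda>z. indicator U z *\<^sub>R (real_of_ereal (u z) * time_deriv \<phi> z))"
    using UQ by (auto simp: indicator_def fun_eq_iff)
  finally have m: "(\<lambda>z. indicator U z *\<^sub>R (real_of_ereal (u z) * time_deriv \<phi> z)) \<in> borel_measurable ?C" .
  have "set_integrable ?C U (\<lambda>z. c * real_of_ereal (u z))" using u by simp
  then show ?thesis
  proof (rule set_integrable_bound)
    show "set_borel_measurable ?C U (\<lambda>z. real_of_ereal (u z) * time_deriv \<phi> z)"
      using m by (simp add: set_borel_measurable_def)
    have "\<bar>real_of_ereal (u z)\<bar> * \<bar>time_deriv \<phi> z\<bar> \<le> \<bar>c\<bar> * \<bar>real_of_ereal (u z)\<bar>" if "z \<in> U" for z
    proof -
      have "\<bar>real_of_ereal (u z)\<bar> * \<bar>time_deriv \<phi> z\<bar> \<le> \<bar>real_of_ereal (u z)\<bar> * \<bar>c\<bar>"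
      proof (rule mult_left_mono[OF _ abs_ge_zero])
        show "\<bar>time_deriv \<phi> z\<bar> \<le> \<bar>c\<bar>" using td[OF that] by linarith
      qed
      then show ?thesis by (simp only: mult.commute)
    qed
    then show "AE z in ?C. z \<in> U \<longrightarrow> norm (real_of_ereal (u z) * time_deriv \<phi> z) \<le> norm (c * real_of_ereal (u z))"
      by (intro AE_I2) (auto simp: abs_mult)
  qed
qed

text \<open>Without a representative \<open>par_ugrad\<close> is \<infinity> everywhere, and a
  nonempty open set contains a product of balls, which has positive measure.\<close>

lemma energy_infinite:
  assumes pos: "\<And>x r. 0 < r \<Longrightarrow> 0 < emeasure M (ball x r)"
    and no: "\<not> has_ugrad w" and V: "open V" "V \<noteq> {}" "V \<subseteq> A"
  shows "energy w A = \<infinity>"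
proof -
  obtain x t where "(x, t) \<in> V" using V(2) by auto
  then obtain X I where XI: "open X" "open I" "x \<in> X" "t \<in> I" "X \<times> I \<subseteq> V"
    using V(1) by (auto elim: open_prod_elim)
  obtain r where r: "0 < r" "ball x r \<subseteq> X" using XI(1,3) open_contains_ball by blast
  obtain e where e: "0 < e" "ball t e \<subseteq> I" using XI(2,4) open_contains_ball by blast
  have "ball x r \<times> ball t e \<in> sets (spacetime M)" by (intro pair_measureI) (auto simp: sets_M)
  then have "(\<integral>\<^sup>+z. \<infinity> * indicator (ball x r \<times> ball t e) z \<partial>spacetime M) = \<infinity> * emeasure (spacetime M) (ball x r \<times> ball t e)"
    by (rule nn_integral_cmult_indicator)
  also have "emeasure (spacetime M) (ball x r \<times> ball t e) = emeasure M (ball x r) * emeasure lborel (ball t e)"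
    by (intro lborel.emeasure_pair_measure_Times) (auto simp: sets_M)
  also have "\<infinity> * \<dots> = \<infinity>"
    using pos[OF r(1), of x] e(1) by (simp add: ennreal_top_mult ball_eq_greaterThanLessThan)
  finally have "\<infinity> = (\<integral>\<^sup>+z. \<infinity> * indicator (ball x r \<times> ball t e) z \<partial>spacetime M)" by simp
  also have "\<dots> \<le> energy w A"
  proof (rule nn_integral_mono)
    fix z
    have "ball x r \<times> ball t e \<subseteq> A" using r(2) e(2) XI(5) V(3) by blast
    then have "z \<in> ball x r \<times> ball t e \<Longrightarrow> z \<in> A" by blast
    moreover have "par_ugrad p M \<Omega> T w = (\<lambda>_. \<infinity>)" using no by (simp add: par_ugrad_def)
    ultimately show "\<infinity> * indicator (ball x r \<times> ball t e) z \<le> epow (par_ugrad p M \<Omega> T w z) p * indicator A z"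
      by (cases "z \<in> ball x r \<times> ball t e") (simp_all add: epow_def)
  qed
  finally show ?thesis by (simp add: top_unique)
qed

lemma open_positive:
  fixes \<phi> :: "'x \<times> real \<Rightarrow> real"
  assumes "L-lipschitz_on Q \<phi>"
  shows "open {z \<in> Q. 0 < \<phi> z}"
proof -
  have "open (Q \<inter> \<phi> -` {0<..})"
    using lipschitz_on_continuous_on[OF assms] open_Q open_greaterThan by (rule continuous_open_preimage)
  moreover have "Q \<inter> \<phi> -` {0<..} = {z \<in> Q. 0 < \<phi> z}" by auto
  ultimately show ?thesis by simp
qed

text \<open>The support is the intersection of open sets \<open>U n\<close> for which the inequality holds.\<close>

lemma supp_inequality:
  assumes pos: "\<And>x r. 0 < r \<Longrightarrow> 0 < emeasure M (ball x r)" and K: "1 \<le> K"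
    and q: "\<And>U. open U \<Longrightarrow> compactly_in U Q \<Longrightarrow> {z \<in> Q. 0 < \<phi> z} \<subseteq> U \<Longrightarrow>
       ereal (\<alpha> * drift \<phi> U) + enn2ereal (energy u U) \<le> ereal K * enn2ereal (energy (perturb \<phi>) U)"
    and \<phi>: "L-lipschitz_on Q \<phi>" and nn: "\<And>z. z \<in> Q \<Longrightarrow> 0 \<le> \<phi> z" and S: "supp Q \<phi> \<subseteq> Q"
  shows "ereal (\<alpha> * drift \<phi> (supp Q \<phi>)) + enn2ereal (energy u (supp Q \<phi>))
    \<le> ereal K * enn2ereal (energy (perturb \<phi>) (supp Q \<phi>))"
proof -
  let ?S = "supp Q \<phi>" and ?C = "completion (spacetime M)"
  have P_supp: "{z \<in> Q. 0 < \<phi> z} \<subseteq> ?S"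
    unfolding supp_def using closure_subset[of "support_on Q \<phi>"] by (auto simp: support_on_def)
  have oP: "open {z \<in> Q. 0 < \<phi> z}" using \<phi> by (rule open_positive)
  consider "?S = {}" | "?S \<noteq> {}" "\<not> has_ugrad (perturb \<phi>)" | "?S \<noteq> {}" "has_ugrad (perturb \<phi>)" by blast
  then show ?thesis
  proof cases
    case 1
    then show ?thesis by (simp add: set_lebesgue_integral_def zero_ennreal.rep_eq)
  next
    \<comment> \<open>A nonempty support contains the nonempty open set {\<phi> > 0}, over which the
      infinite gradient has infinite energy.\<close>
    case 2
    have "{z \<in> Q. 0 < \<phi> z} \<noteq> {}"
    proof
      assume "{z \<in> Q. 0 < \<phi> z} = {}"
      then have "support_on Q \<phi> = {}" using nn by (force simp: support_on_def)
      then show False using 2(1) by (simp add: supp_def)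
    qed
    from energy_infinite[OF pos 2(2) oP this P_supp] show ?thesis using K by simp
  next
    case 3
    have v: "is_par_ugrad p M \<Omega> T (perturb \<phi>) (par_ugrad p M \<Omega> T (perturb \<phi>))"
      using 3(2) by (rule is_par_ugrad_par_ugrad)
    have cl: "closed ?S" by (simp add: supp_def)
    have "compact ?S" using o(2) cl S by (rule compact_closed_subset_cylinder)
    then obtain D t1 t2 where D: "open D" "compactly_in D \<Omega>" "0 < t1" "t1 < t2" "t2 < T"
      and SD: "?S \<subseteq> D \<times> {t1<..<t2}"
      using compact_subset_cylinder[OF o T _ S] by metis
    \<comment> \<open>The box has compact closure in the cylinder, which makes the energies finite;
      the distance condition shrinks to the closed support.\<close>
    define U where "U n = D \<times> {t1<..<t2} \<inter> {z. infdist z ?S < 1 / real (Suc n)}" for n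
    have oU: "open (U n)" for n
      unfolding U_def using D(1) by (intro open_Int open_Times open_Collect_less continuous_intros) auto
    have cU: "compactly_in (U n) Q" for n
      by (rule compactly_in_subset[OF compactly_in_Times[OF D(2,3,5)]]) (auto simp: U_def)
    have UQ: "U n \<subseteq> Q" for n using cU[of n] closure_subset[of "U n"] unfolding compactly_in_def by blast
    have SU: "?S \<subseteq> U n" for n using SD by (auto simp: U_def)
    have dec: "decseq U"
    proof (rule decseq_SucI)
      fix n
      have "1 / real (Suc (Suc n)) \<le> 1 / real (Suc n)" by (intro divide_left_mono) auto
      then show "U (Suc n) \<subseteq> U n" unfolding U_def by auto
    qed
    have Int: "(\<Inter>n. U n) = ?S"
    proof
      show "(\<Inter>n. U n) \<subseteq> ?S"
      proof
        fix z assume z: "z \<in> (\<Inter>n. U n)"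
        have "infdist z ?S \<le> 0"
        proof (rule ccontr)
          assume "\<not> infdist z ?S \<le> 0"
          then obtain n where "1 / real (Suc n) < infdist z ?S" using nat_approx_posE[of "infdist z ?S"] by auto
          moreover have "infdist z ?S < 1 / real (Suc n)" using z by (auto simp: U_def)
          ultimately show False by simp
        qed
        then have "infdist z ?S = 0" using infdist_nonneg[of z ?S] by simp
        then show "z \<in> ?S" using cl 3(1) in_closed_iff_infdist_zero by blast
      qed
    qed (use SU in blast)
    have lim1: "(\<lambda>n. drift \<phi> (U n)) \<longlonglongrightarrow> drift \<phi> ?S"
      unfolding Int[symmetric]
      using oU dec drift_integrable[OF oU cU \<phi>]
      by (intro set_integral_cont_down) (auto intro: sets_completion_spacetimeI)
    \<comment> \<open>Continuity from above, by decreasing monotone convergence starting from the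
      finite energy on \<open>U 0\<close>.\<close>
    have lim2: "(\<lambda>n. enn2real (energy w (U n))) \<longlonglongrightarrow> enn2real (energy w ?S)"
      if w: "is_par_ugrad p M \<Omega> T w (par_ugrad p M \<Omega> T w)" and fin: "\<And>n. energy w (U n) < \<infinity>" for w
    proof -
      let ?f = "\<lambda>n z. epow (par_ugrad p M \<Omega> T w z) p * indicator (U n) z"
      have INF: "(INF n. ?f n z) = epow (par_ugrad p M \<Omega> T w z) p * indicator ?S z" for z
      proof (cases "z \<in> ?S")
        case True
        then have "z \<in> U n" for n using SU by blast
        then show ?thesis using True by simp
      next
        case False
        then obtain n where "z \<notin> U n" using Int by blast
        then have "(INF n. ?f n z) \<le> 0" by (intro INF_lower2[of n]) auto
        then show ?thesis using False by simp
      qed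
      have decf: "decseq ?f"
        using decseq_SucD[OF dec] by (intro decseq_SucI le_funI mult_left_mono) (auto simp: indicator_def)
      have "energy w ?S = (\<integral>\<^sup>+z. (INF n. ?f n z) \<partial>?C)"
        by (simp only: INF nn_integral_completion)
      also have "\<dots> = (INF n. \<integral>\<^sup>+z. ?f n z \<partial>?C)"
      proof (rule nn_integral_monotone_convergence_INF_decseq[OF decf])
        show "?f n \<in> borel_measurable ?C" for n
          using oU UQ by (intro energy_measurable[OF w]) auto
        show "(\<integral>\<^sup>+z. ?f 0 z \<partial>?C) < \<infinity>" using fin[of 0] by (simp only: nn_integral_completion)
      qed
      also have "\<dots> = (INF n. energy w (U n))" by (simp only: nn_integral_completion)
      finally have E: "energy w ?S = (INF n. energy w (U n))" .
      have "decseq (\<lambda>n. energy w (U n))"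
        using decseq_SucD[OF dec] by (intro decseq_SucI nn_integral_mono mult_left_mono) (auto simp: indicator_def)
      then have "(\<lambda>n. energy w (U n)) \<longlonglongrightarrow> energy w ?S" unfolding E by (rule LIMSEQ_INF)
      moreover have "energy w ?S \<noteq> top"
      proof -
        have "energy w ?S \<le> energy w (U 0)" using SU[of 0] by (intro nn_integral_mono) (auto simp: indicator_def)
        then show ?thesis using fin[of 0] by (auto simp: top_unique)
      qed
      ultimately show ?thesis by (intro tendsto_enn2real) (auto simp: less_top)
    qed
    have fin_u: "energy u (U n) < \<infinity>" for n by (rule energy_u_finite[OF cU])
    have fin_v: "energy (perturb \<phi>) (U n) < \<infinity>" for n by (rule energy_add_finite[OF oU cU \<phi> v])
    have ineq: "\<alpha> * drift \<phi> (U n) + enn2real (energy u (U n)) \<le> K * enn2real (energy (perturb \<phi>) (U n))" for n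
      using q[OF oU cU] SU[of n] P_supp ereal_energy_iff[OF fin_u fin_v] by blast
    have "\<alpha> * drift \<phi> ?S + enn2real (energy u ?S) \<le> K * enn2real (energy (perturb \<phi>) ?S)"
    proof (rule LIMSEQ_le)
      show "(\<lambda>n. \<alpha> * drift \<phi> (U n) + enn2real (energy u (U n))) \<longlonglongrightarrow> \<alpha> * drift \<phi> ?S + enn2real (energy u ?S)"
        by (intro tendsto_intros lim1 lim2 fin_u is_par_ugrad_u)
      show "(\<lambda>n. K * enn2real (energy (perturb \<phi>) (U n))) \<longlonglongrightarrow> K * enn2real (energy (perturb \<phi>) ?S)"
        by (intro tendsto_intros lim2 fin_v v)
    qed (use ineq in blast)
    moreover have "energy w ?S < \<infinity>" if "energy w (U 0) < \<infinity>" for w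
    proof -
      have "energy w ?S \<le> energy w (U 0)" using SU[of 0] by (intro nn_integral_mono) (auto simp: indicator_def)
      then show ?thesis using that by (rule order.strict_trans1)
    qed
    ultimately show ?thesis using fin_u[of 0] fin_v[of 0] by (subst ereal_energy_iff) auto
  qed
qed

text \<open>The truncation vanishes where \<phi> \<le> e and equals \<phi> - e where \<phi> \<ge> e.
  Locality applies on both sets, and a constant does not change the minimal gradient.\<close>

lemma truncate_slices:
  fixes \<phi> :: "'x \<times> real \<Rightarrow> real" and e :: real
  assumes \<phi>: "L-lipschitz_on Q \<phi>"
  defines "\<psi> \<equiv> \<lambda>z. max (\<phi> z - e) 0"
  shows "AE t in lborel. t \<in> {0<..<T} \<longrightarrow>
    (AE x in M. x \<in> \<Omega> \<and> \<phi> (x, t) \<le> e \<longrightarrow>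
      min_ugrad p M \<Omega> (\<lambda>x. perturb \<psi> (x, t)) x = min_ugrad p M \<Omega> (\<lambda>x. u (x, t)) x) \<and>
    (AE x in M. x \<in> \<Omega> \<and> e \<le> \<phi> (x, t) \<longrightarrow>
      min_ugrad p M \<Omega> (\<lambda>x. perturb \<psi> (x, t)) x = min_ugrad p M \<Omega> (\<lambda>x. perturb \<phi> (x, t)) x)"
proof -
  have \<psi>: "L-lipschitz_on Q \<psi>" unfolding \<psi>_def using \<phi> by (rule lipschitz_truncate)
  show ?thesis
    using minimal_wug_slices[OF o T N L2] minimal_wug_slices_add[OF \<phi>] minimal_wug_slices_add[OF \<psi>]
  proof eventually_elim
    case (elim t)
    show ?case
    proof
      assume t: "t \<in> {0<..<T}"
      then have mu: "minimal_wug p M \<Omega> (\<lambda>x. u (x, t)) (min_ugrad p M \<Omega> (\<lambda>x. u (x, t)))"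
        and mv: "minimal_wug p M \<Omega> (\<lambda>x. perturb \<phi> (x, t)) (min_ugrad p M \<Omega> (\<lambda>x. perturb \<phi> (x, t)))"
        and mw: "minimal_wug p M \<Omega> (\<lambda>x. perturb \<psi> (x, t)) (min_ugrad p M \<Omega> (\<lambda>x. perturb \<psi> (x, t)))"
        using elim by blast+
      have cont: "continuous_on \<Omega> (\<lambda>x. \<phi> (x, t))"
        using lipschitz_slices(1)[OF \<phi> t] by (rule lipschitz_on_continuous_on)
      have E1: "\<Omega> \<inter> (\<lambda>x. \<phi> (x, t)) -` {..e} \<in> sets borel"
        using o(1) cont by (rule borel_continuous_preimage) simp
      have E2: "\<Omega> \<inter> (\<lambda>x. \<phi> (x, t)) -` {e..} \<in> sets borel"
        using o(1) cont by (rule borel_continuous_preimage) simp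
      have "AE x in M. x \<in> \<Omega> \<inter> (\<lambda>x. \<phi> (x, t)) -` {..e} \<longrightarrow>
        min_ugrad p M \<Omega> (\<lambda>x. perturb \<psi> (x, t)) x = min_ugrad p M \<Omega> (\<lambda>x. u (x, t)) x"
        by (rule minimal_wug_agree[OF o o(1) subset_refl mw mu E1]) (auto simp: \<psi>_def)
      moreover have "AE x in M. x \<in> \<Omega> \<inter> (\<lambda>x. \<phi> (x, t)) -` {e..} \<longrightarrow>
        min_ugrad p M \<Omega> (\<lambda>x. perturb \<psi> (x, t)) x = min_ugrad p M \<Omega> (\<lambda>x. perturb \<phi> (x, t)) x"
      proof (rule minimal_wug_agree[OF o o(1) subset_refl mw _ E2])
        show "minimal_wug p M \<Omega> (\<lambda>x. perturb \<phi> (x, t) + ereal (- e)) (min_ugrad p M \<Omega> (\<lambda>x. perturb \<phi> (x, t)))"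
          using mv by (simp only: minimal_wug_add_const)
        fix x assume "x \<in> \<Omega> \<inter> (\<lambda>x. \<phi> (x, t)) -` {e..}"
        then have "\<psi> (x, t) = \<phi> (x, t) + (- e)" by (simp add: \<psi>_def)
        then show "perturb \<psi> (x, t) = perturb \<phi> (x, t) + ereal (- e)"
          by (cases "u (x, t)") simp_all
      qed auto
      ultimately show "(AE x in M. x \<in> \<Omega> \<and> \<phi> (x, t) \<le> e \<longrightarrow>
          min_ugrad p M \<Omega> (\<lambda>x. perturb \<psi> (x, t)) x = min_ugrad p M \<Omega> (\<lambda>x. u (x, t)) x) \<and>
        (AE x in M. x \<in> \<Omega> \<and> e \<le> \<phi> (x, t) \<longrightarrow>
          min_ugrad p M \<Omega> (\<lambda>x. perturb \<psi> (x, t)) x = min_ugrad p M \<Omega> (\<lambda>x. perturb \<phi> (x, t)) x)"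
        by simp
    qed
  qed
qed

text \<open>Finite energies of the truncated functions presuppose a jointly measurable
  representative of their gradients. It is patched from those of \<open>u\<close> and
  \<open>u + \<phi>\<close> along the level \<open>e\<close> of \<phi>.\<close>

lemma has_ugrad_truncate:
  assumes \<phi>: "L-lipschitz_on Q \<phi>" and v: "has_ugrad (perturb \<phi>)"
  shows "has_ugrad (perturb (\<lambda>z. max (\<phi> z - e) 0))"
proof -
  let ?Gu = "par_ugrad p M \<Omega> T u" and ?Gv = "par_ugrad p M \<Omega> T (perturb \<phi>)"
  have Gu: "is_par_ugrad p M \<Omega> T u ?Gu" by (rule is_par_ugrad_u)
  have Gv: "is_par_ugrad p M \<Omega> T (perturb \<phi>) ?Gv" using v by (rule is_par_ugrad_par_ugrad)
  define G where "G z = (if \<phi> z \<le> e then ?Gu z else ?Gv z)" for z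
  define A where "A = Q \<inter> \<phi> -` {..e}"
  have A: "A \<in> sets borel"
    unfolding A_def using open_Q lipschitz_on_continuous_on[OF \<phi>] by (rule borel_continuous_preimage) simp
  note [measurable] = is_par_ugrad_measurable[OF o(1) Gu] is_par_ugrad_measurable[OF o(1) Gv]
    sets_completion_spacetimeI[OF A]
  have "(\<lambda>z. if z \<in> A then ?Gu z * indicator Q z else ?Gv z * indicator Q z) \<in> borel_measurable (completion (spacetime M))"
    by measurable
  also have "(\<lambda>z. if z \<in> A then ?Gu z * indicator Q z else ?Gv z * indicator Q z) = (\<lambda>z. G z * indicator Q z)"
    by (auto simp: G_def A_def indicator_def fun_eq_iff)
  finally have m: "G \<in> borel_measurable (restrict_space (completion (spacetime M)) Q)"
    unfolding borel_measurable_restrict_completion_iff[OF open_Q] .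
  have G1: "AE t in lborel. t \<in> {0<..<T} \<longrightarrow> (AE x in M. x \<in> \<Omega> \<longrightarrow> ?Gu (x, t) = min_ugrad p M \<Omega> (\<lambda>y. u (y, t)) x)"
    and G2: "AE t in lborel. t \<in> {0<..<T} \<longrightarrow> (AE x in M. x \<in> \<Omega> \<longrightarrow> ?Gv (x, t) = min_ugrad p M \<Omega> (\<lambda>y. perturb \<phi> (y, t)) x)"
    using Gu Gv by (auto simp: is_par_ugrad_def)
  have "AE t in lborel. t \<in> {0<..<T} \<longrightarrow> (AE x in M. x \<in> \<Omega> \<longrightarrow>
      G (x, t) = min_ugrad p M \<Omega> (\<lambda>y. perturb (\<lambda>z. max (\<phi> z - e) 0) (y, t)) x)"
    using G1 G2 truncate_slices[OF \<phi>, of e]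
  proof eventually_elim
    case (elim t)
    show ?case
    proof
      assume t: "t \<in> {0<..<T}"
      have 1: "AE x in M. x \<in> \<Omega> \<longrightarrow> ?Gu (x, t) = min_ugrad p M \<Omega> (\<lambda>y. u (y, t)) x"
        and 2: "AE x in M. x \<in> \<Omega> \<longrightarrow> ?Gv (x, t) = min_ugrad p M \<Omega> (\<lambda>y. perturb \<phi> (y, t)) x"
        and 3: "AE x in M. x \<in> \<Omega> \<and> \<phi> (x, t) \<le> e \<longrightarrow>
          min_ugrad p M \<Omega> (\<lambda>x. perturb (\<lambda>z. max (\<phi> z - e) 0) (x, t)) x = min_ugrad p M \<Omega> (\<lambda>x. u (x, t)) x"
        and 4: "AE x in M. x \<in> \<Omega> \<and> e \<le> \<phi> (x, t) \<longrightarrow>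
          min_ugrad p M \<Omega> (\<lambda>x. perturb (\<lambda>z. max (\<phi> z - e) 0) (x, t)) x = min_ugrad p M \<Omega> (\<lambda>x. perturb \<phi> (x, t)) x"
        using elim t by blast+
      from 1 2 3 4 show "AE x in M. x \<in> \<Omega> \<longrightarrow>
        G (x, t) = min_ugrad p M \<Omega> (\<lambda>y. perturb (\<lambda>z. max (\<phi> z - e) 0) (y, t)) x"
      proof eventually_elim
        case (elim x)
        show ?case
        proof
          assume x: "x \<in> \<Omega>"
          show "G (x, t) = min_ugrad p M \<Omega> (\<lambda>y. perturb (\<lambda>z. max (\<phi> z - e) 0) (y, t)) x"
          proof (cases "\<phi> (x, t) \<le> e")
            case True
            have "G (x, t) = ?Gu (x, t)" using True by (simp add: G_def)
            also have "\<dots> = min_ugrad p M \<Omega> (\<lambda>y. u (y, t)) x" using elim(1) x by blast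
            finally show ?thesis using elim(3) x True by metis
          next
            case False
            then have "e \<le> \<phi> (x, t)" by simp
            have "G (x, t) = ?Gv (x, t)" using False by (simp add: G_def)
            also have "\<dots> = min_ugrad p M \<Omega> (\<lambda>y. perturb \<phi> (y, t)) x" using elim(2) x by blast
            finally show ?thesis using elim(4) x \<open>e \<le> _\<close> by metis
          qed
        qed
      qed
    qed
  qed
  with m show ?thesis unfolding is_par_ugrad_def by blast
qed

text \<open>The truncations \<open>max (\<phi> - \<epsilon>) 0\<close> are supported in \<open>{\<phi> \<ge> \<epsilon>} \<subseteq> U\<close>; letting \<open>\<epsilon>\<close> tend to \<open>0\<close> gives
  the inequality on \<open>{\<phi> > 0}\<close>, and the rest of \<open>U\<close> contributes the same energy to both sides.\<close>

lemma open_inequality: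
  assumes pos: "\<And>x r. 0 < r \<Longrightarrow> 0 < emeasure M (ball x r)" and K: "1 \<le> K"
    and s: "\<And>\<psi>. nonneg_Lip Q \<psi> \<Longrightarrow> supp Q \<psi> \<subseteq> Q \<Longrightarrow>
      ereal (\<alpha> * drift \<psi> (supp Q \<psi>)) + enn2ereal (energy u (supp Q \<psi>))
        \<le> ereal K * enn2ereal (energy (perturb \<psi>) (supp Q \<psi>))"
    and \<phi>: "L-lipschitz_on Q \<phi>" and nn: "\<And>z. z \<in> Q \<Longrightarrow> 0 \<le> \<phi> z"
    and U: "open U" "compactly_in U Q" "{z \<in> Q. 0 < \<phi> z} \<subseteq> U"
  shows "ereal (\<alpha> * drift \<phi> U) + enn2ereal (energy u U) \<le> ereal K * enn2ereal (energy (perturb \<phi>) U)"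
proof -
  let ?C = "completion (spacetime M)"
  consider "U = {}" | "U \<noteq> {}" "\<not> has_ugrad (perturb \<phi>)" | "has_ugrad (perturb \<phi>)" by blast
  then show ?thesis
  proof cases
    case 1
    then show ?thesis by (simp add: set_lebesgue_integral_def zero_ennreal.rep_eq)
  next
    case 2
    from energy_infinite[OF pos 2(2) U(1) 2(1) subset_refl] show ?thesis using K by simp
  next
    case 3
    have v: "is_par_ugrad p M \<Omega> T (perturb \<phi>) (par_ugrad p M \<Omega> T (perturb \<phi>))"
      using 3 by (rule is_par_ugrad_par_ugrad)
    define P where "P = {z \<in> Q. 0 < \<phi> z}"
    have P: "open P" "P \<subseteq> U" using open_positive[OF \<phi>] U(3) by (auto simp: P_def)
    have UQ: "U \<subseteq> Q" "closure U \<subseteq> Q"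
      using U(2) closure_subset[of U] unfolding compactly_in_def by blast+
    have Um: "U \<in> sets borel" and Pm: "P \<in> sets borel" using U(1) P(1) by auto
    define e where "e n = 1 / real (Suc n)" for n
    have e: "0 < e n" "e (Suc n) < e n" for n by (auto simp: e_def divide_simps)
    define \<psi> where "\<psi> n z = max (\<phi> z - e n) 0" for n z
    have \<psi>: "L-lipschitz_on Q (\<psi> n)" for n unfolding \<psi>_def using \<phi> by (rule lipschitz_truncate)
    define S where "S n = supp Q (\<psi> n)" for n
    have supp_eq: "support_on Q (\<psi> n) = {z \<in> Q. e n < \<phi> z}" for n
      by (auto simp: support_on_def \<psi>_def max_def)
    have S_sup: "{z \<in> Q. e n < \<phi> z} \<subseteq> S n" for n
      unfolding S_def supp_def supp_eq by (rule closure_subset)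
    \<comment> \<open>The closure defining the support is taken in all of space-time; it stays in
      the closure of \<open>U\<close>, which lies in the cylinder, where \<phi> is
      continuous.\<close>
    have S_sub: "S n \<subseteq> {z \<in> Q. e n \<le> \<phi> z}" for n
    proof -
      have "closed (closure U \<inter> \<phi> -` {e n..})"
        using continuous_on_subset[OF lipschitz_on_continuous_on[OF \<phi>] UQ(2)]
        by (rule continuous_closed_preimage) auto
      moreover have "{z \<in> Q. e n < \<phi> z} \<subseteq> closure U \<inter> \<phi> -` {e n..}"
      proof
        fix z assume z: "z \<in> {z \<in> Q. e n < \<phi> z}"
        then have "z \<in> U" using U(3) e(1)[of n] by auto
        then show "z \<in> closure U \<inter> \<phi> -` {e n..}" using z closure_subset[of U] by auto
      qed
      ultimately have "S n \<subseteq> closure U \<inter> \<phi> -` {e n..}"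
        unfolding S_def supp_def supp_eq by (intro closure_minimal)
      then show ?thesis using UQ(2) by auto
    qed
    have SP: "S n \<subseteq> P" for n
    proof
      fix z assume "z \<in> S n"
      then have "z \<in> Q" "e n \<le> \<phi> z" using S_sub by auto
      then show "z \<in> P" using e(1)[of n] by (simp add: P_def)
    qed
    have SQ: "S n \<subseteq> Q" for n using S_sub by blast
    have Sm: "S n \<in> sets borel" for n by (simp add: S_def supp_def)
    \<comment> \<open>Strict decrease of \<open>e\<close> puts {\<phi> \<ge> e n} inside {\<phi> > e
      (n+1)}, which the next support contains.\<close>
    have inc: "incseq S"
    proof (rule incseq_SucI)
      fix n
      have "{z \<in> Q. e n \<le> \<phi> z} \<subseteq> {z \<in> Q. e (Suc n) < \<phi> z}" using e(2)[of n] by auto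
      then show "S n \<subseteq> S (Suc n)" using S_sub[of n] S_sup[of "Suc n"] by blast
    qed
    have ev: "\<exists>n0. \<forall>n\<ge>n0. e n < \<phi> z" if "z \<in> P" for z
    proof -
      have "0 < \<phi> z" using that by (simp add: P_def)
      then obtain n0 where n0: "e n0 < \<phi> z"
        unfolding e_def by (rule nat_approx_posE)
      have "e n \<le> e n0" if "n \<ge> n0" for n unfolding e_def using that by (intro divide_left_mono) auto
      then show ?thesis using n0 by (meson order.strict_trans1)
    qed
    have UN: "(\<Union>n. S n) = P"
    proof
      show "P \<subseteq> (\<Union>n. S n)"
      proof
        fix z assume z: "z \<in> P"
        then obtain n where "e n < \<phi> z" using ev by blast
        then show "z \<in> (\<Union>n. S n)" using S_sup[of n] z by (auto simp: P_def)
      qed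
    qed (use SP in blast)
    have fin_u: "energy u A < \<infinity>" and fin_v: "energy (perturb \<phi>) A < \<infinity>" if "A \<subseteq> U" for A
    proof -
      have le: "energy w A \<le> energy w U" for w
        using that by (intro nn_integral_mono) (auto simp: indicator_def)
      show "energy u A < \<infinity>" by (rule order.strict_trans1[OF le energy_u_finite[OF U(2)]])
      show "energy (perturb \<phi>) A < \<infinity>" by (rule order.strict_trans1[OF le energy_add_finite[OF U(1,2) \<phi> v]])
    qed
    have SU: "S n \<subseteq> U" for n using SP P(2) by blast
    \<comment> \<open>On this support \<phi> \<ge> e n, so the two perturbed functions differ by a
      constant there.\<close>
    have energy_S: "energy (perturb (\<psi> n)) (S n) = energy (perturb \<phi>) (S n)" for n
    proof -
      have "has_ugrad (perturb (\<psi> n))" unfolding \<psi>_def using \<phi> 3 by (rule has_ugrad_truncate)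
      then have w: "is_par_ugrad p M \<Omega> T (perturb (\<psi> n)) (par_ugrad p M \<Omega> T (perturb (\<psi> n)))"
        by (rule is_par_ugrad_par_ugrad)
      have "AE t in lborel. t \<in> {0<..<T} \<longrightarrow> (AE x in M. (x, t) \<in> S n \<longrightarrow>
        min_ugrad p M \<Omega> (\<lambda>x. perturb (\<psi> n) (x, t)) x = min_ugrad p M \<Omega> (\<lambda>x. perturb \<phi> (x, t)) x)"
        using truncate_slices[OF \<phi>, of "e n", folded \<psi>_def]
      proof eventually_elim
        case (elim t)
        show ?case
        proof
          assume "t \<in> {0<..<T}"
          with elim have "AE x in M. x \<in> \<Omega> \<and> e n \<le> \<phi> (x, t) \<longrightarrow>
            min_ugrad p M \<Omega> (\<lambda>x. perturb (\<psi> n) (x, t)) x = min_ugrad p M \<Omega> (\<lambda>x. perturb \<phi> (x, t)) x" by blast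
          then show "AE x in M. (x, t) \<in> S n \<longrightarrow>
            min_ugrad p M \<Omega> (\<lambda>x. perturb (\<psi> n) (x, t)) x = min_ugrad p M \<Omega> (\<lambda>x. perturb \<phi> (x, t)) x"
          proof eventually_elim
            case (elim x)
            have "(x, t) \<in> S n \<Longrightarrow> x \<in> \<Omega> \<and> e n \<le> \<phi> (x, t)" using S_sub[of n] by auto
            with elim show ?case by blast
          qed
        qed
      qed
      from is_par_ugrad_agree[OF o(1) w v Sm SQ this]
      have "AE z in spacetime M. z \<in> S n \<longrightarrow> par_ugrad p M \<Omega> T (perturb (\<psi> n)) z = par_ugrad p M \<Omega> T (perturb \<phi>) z" .
      then have "AE z in spacetime M. epow (par_ugrad p M \<Omega> T (perturb (\<psi> n)) z) p * indicator (S n) z =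
        epow (par_ugrad p M \<Omega> T (perturb \<phi>) z) p * indicator (S n) z"
        by eventually_elim (auto simp: indicator_def)
      then show ?thesis by (rule nn_integral_cong_AE)
    qed
    \<comment> \<open>The right-hand side is enlarged to \<open>P\<close> and thereby independent of
      \<open>n\<close>, so that the limit concerns the left-hand side.\<close>
    have ineq: "\<alpha> * drift (\<psi> n) (S n) + enn2real (energy u (S n)) \<le> K * enn2real (energy (perturb \<phi>) P)" for n
    proof -
      have "nonneg_Lip Q (\<psi> n)" using \<psi>[of n] by (auto simp: nonneg_Lip_def \<psi>_def)
      from s[OF this] have "ereal (\<alpha> * drift (\<psi> n) (S n)) + enn2ereal (energy u (S n))
        \<le> ereal K * enn2ereal (energy (perturb \<phi>) (S n))"
        using SQ[of n] unfolding S_def[symmetric] energy_S by blast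
      then have "\<alpha> * drift (\<psi> n) (S n) + enn2real (energy u (S n)) \<le> K * enn2real (energy (perturb \<phi>) (S n))"
        using ereal_energy_iff[OF fin_u[OF SU] fin_v[OF SU]] by blast
      also have "\<dots> \<le> K * enn2real (energy (perturb \<phi>) P)"
      proof (intro mult_left_mono enn2real_mono)
        show "energy (perturb \<phi>) (S n) \<le> energy (perturb \<phi>) P"
          using SP[of n] by (intro nn_integral_mono) (auto simp: indicator_def)
        show "energy (perturb \<phi>) P < top" using fin_v[OF P(2)] by simp
      qed (use K in simp)
      finally show ?thesis .
    qed
    have lim_energy: "(\<lambda>n. enn2real (energy u (S n))) \<longlonglongrightarrow> enn2real (energy u P)"
    proof -
      let ?f = "\<lambda>n z. epow (par_ugrad p M \<Omega> T u z) p * indicator (S n) z"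
      have incf: "incseq ?f"
        using incseq_SucD[OF inc] by (intro incseq_SucI le_funI mult_left_mono) (auto simp: indicator_def)
      have SUP: "(SUP n. ?f n z) = epow (par_ugrad p M \<Omega> T u z) p * indicator P z" for z
      proof (cases "z \<in> P")
        case True
        then obtain n where n: "z \<in> S n" using UN by blast
        show ?thesis
        proof (rule antisym)
          show "(SUP n. ?f n z) \<le> epow (par_ugrad p M \<Omega> T u z) p * indicator P z"
            using True by (intro SUP_least) (auto simp: indicator_def)
          show "epow (par_ugrad p M \<Omega> T u z) p * indicator P z \<le> (SUP n. ?f n z)"
            using True n by (intro SUP_upper2[of n]) auto
        qed
      next
        case False
        then have "z \<notin> S n" for n using SP by blast
        then show ?thesis using False by simp
      qed
      have "energy u P = (\<integral>\<^sup>+z. (SUP n. ?f n z) \<partial>?C)"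
        by (simp only: SUP nn_integral_completion)
      also have "\<dots> = (SUP n. \<integral>\<^sup>+z. ?f n z \<partial>?C)"
        using incf by (intro nn_integral_monotone_convergence_SUP energy_measurable[OF is_par_ugrad_u Sm SQ])
      also have "\<dots> = (SUP n. energy u (S n))" by (simp only: nn_integral_completion)
      finally have E: "energy u P = (SUP n. energy u (S n))" .
      have "incseq (\<lambda>n. energy u (S n))"
        using incseq_SucD[OF inc] by (intro incseq_SucI nn_integral_mono mult_left_mono) (auto simp: indicator_def)
      then have "(\<lambda>n. energy u (S n)) \<longlonglongrightarrow> energy u P" unfolding E by (rule LIMSEQ_SUP)
      then show ?thesis using fin_u[OF P(2)] by (intro tendsto_enn2real) auto
    qed
    \<comment> \<open>Dominated convergence: the time derivatives of all truncations share the bound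
      \<open>c\<close>, and each point of \<open>P\<close> satisfies \<phi> > e n from some
      \<open>n\<close> on.\<close>
    have lim_drift: "(\<lambda>n. drift (\<psi> n) (S n)) \<longlonglongrightarrow> drift \<phi> P"
      unfolding set_lebesgue_integral_def
    proof (rule integral_dominated_convergence)
      define c where "c = max L \<bar>SOME D::real. False\<bar>"
      have "0 \<le> c" by (simp add: c_def max.coboundedI2)
      let ?w = "\<lambda>z. c * (indicator U z *\<^sub>R \<bar>real_of_ereal (u z)\<bar>)"
      show "integrable ?C ?w"
        using set_integrable_abs[OF set_integrable_u[OF U(1,2)]] unfolding set_integrable_def
        by (rule integrable_mult_right)
      show "(\<lambda>z. indicator (S n) z *\<^sub>R (real_of_ereal (u z) * time_deriv (\<psi> n) z)) \<in> borel_measurable ?C" for n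
        using set_integrable_subset[OF drift_integrable[OF U(1,2) \<psi>] sets_completion_spacetimeI[OF Sm] SU]
        unfolding set_integrable_def by (rule borel_measurable_integrable)
      show "(\<lambda>z. indicator P z *\<^sub>R (real_of_ereal (u z) * time_deriv \<phi> z)) \<in> borel_measurable ?C"
        using set_integrable_subset[OF drift_integrable[OF U(1,2) \<phi>] sets_completion_spacetimeI[OF Pm] P(2)]
        unfolding set_integrable_def by (rule borel_measurable_integrable)
      \<comment> \<open>For nearby times the truncation equals \<phi> - e n, so both functions have
        the same derivatives at \<open>z\<close>; by the definition of \<open>deriv\<close> the
        values agree even where there is none.\<close>
      have td: "time_deriv (\<psi> n) z = time_deriv \<phi> z" if z: "z \<in> Q" "e n < \<phi> z" for n z
      proof -
        obtain x t where xt: "z = (x, t)" by (cases z)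
        have t: "t \<in> {0<..<T}" and x: "x \<in> \<Omega>" using z(1) by (auto simp: xt)
        have c1: "continuous_on {0<..<T} (\<lambda>s. \<phi> (x, s))"
          using lipschitz_slices(2)[OF \<phi> x] by (rule lipschitz_on_continuous_on)
        have "open ({0<..<T} \<inter> (\<lambda>s. \<phi> (x, s)) -` {e n<..})"
          using c1 by (intro continuous_open_preimage) auto
        moreover have "t \<in> {0<..<T} \<inter> (\<lambda>s. \<phi> (x, s)) -` {e n<..}" using t z(2) by (auto simp: xt)
        ultimately have evt: "eventually (\<lambda>s. s \<in> {0<..<T} \<inter> (\<lambda>s. \<phi> (x, s)) -` {e n<..}) (nhds t)"
          by (rule eventually_nhds_in_open)
        have "eventually (\<lambda>s. \<psi> n (x, s) = \<phi> (x, s) - e n) (nhds t)"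
          using evt by eventually_elim (auto simp: \<psi>_def)
        then have D: "((\<lambda>s. \<psi> n (x, s)) has_field_derivative d) (at t) \<longleftrightarrow>
            ((\<lambda>s. \<phi> (x, s) - e n) has_field_derivative d) (at t)" for d
          by (intro DERIV_cong_ev refl)
        have "((\<lambda>s. \<phi> (x, s) - e n) has_field_derivative d) (at t) \<longleftrightarrow>
            ((\<lambda>s. \<phi> (x, s)) has_field_derivative d) (at t)" for d
        proof
          assume "((\<lambda>s. \<phi> (x, s) - e n) has_field_derivative d) (at t)"
          from DERIV_add[OF this DERIV_const[of "e n"]]
          show "((\<lambda>s. \<phi> (x, s)) has_field_derivative d) (at t)" by simp
        next
          assume "((\<lambda>s. \<phi> (x, s)) has_field_derivative d) (at t)"
          from DERIV_diff[OF this DERIV_const[of "e n"]]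
          show "((\<lambda>s. \<phi> (x, s) - e n) has_field_derivative d) (at t)" by simp
        qed
        with D show ?thesis by (simp add: time_deriv_def deriv_def xt)
      qed
      have "(\<lambda>n. indicator (S n) z *\<^sub>R (real_of_ereal (u z) * time_deriv (\<psi> n) z))
        \<longlonglongrightarrow> indicator P z *\<^sub>R (real_of_ereal (u z) * time_deriv \<phi> z)" for z
      proof (cases "z \<in> P")
        case True
        obtain n0 where n0: "\<forall>n\<ge>n0. e n < \<phi> z" using ev[OF True] by blast
        have "eventually (\<lambda>n. indicator P z *\<^sub>R (real_of_ereal (u z) * time_deriv \<phi> z) =
           indicator (S n) z *\<^sub>R (real_of_ereal (u z) * time_deriv (\<psi> n) z)) sequentially"
          unfolding eventually_sequentially
        proof (intro exI[of _ n0] allI impI)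
          fix n assume "n0 \<le> n"
          then have "e n < \<phi> z" "z \<in> Q" using n0 True by (auto simp: P_def)
          moreover then have "z \<in> S n" using S_sup[of n] by blast
          ultimately show "indicator P z *\<^sub>R (real_of_ereal (u z) * time_deriv \<phi> z) =
           indicator (S n) z *\<^sub>R (real_of_ereal (u z) * time_deriv (\<psi> n) z)"
            using True td by simp
        qed
        then show ?thesis by (rule Lim_transform_eventually[OF tendsto_const])
      next
        case False
        then have "z \<notin> S n" for n using SP by blast
        then show ?thesis using False by simp
      qed
      then show "AE z in ?C. (\<lambda>n. indicator (S n) z *\<^sub>R (real_of_ereal (u z) * time_deriv (\<psi> n) z))
        \<longlonglongrightarrow> indicator P z *\<^sub>R (real_of_ereal (u z) * time_deriv \<phi> z)" by simp
      have "norm (indicator (S n) z *\<^sub>R (real_of_ereal (u z) * time_deriv (\<psi> n) z)) \<le> ?w z" for n z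
      proof (cases "z \<in> S n")
        case True
        then have zU: "z \<in> U" "z \<in> Q" using SU UQ(1) by blast+
        have "\<bar>real_of_ereal (u z)\<bar> * \<bar>time_deriv (\<psi> n) z\<bar> \<le> \<bar>real_of_ereal (u z)\<bar> * c"
          unfolding c_def by (rule mult_left_mono[OF time_deriv_bound[OF \<psi> zU(2)] abs_ge_zero])
        then have "\<bar>real_of_ereal (u z) * time_deriv (\<psi> n) z\<bar> \<le> c * \<bar>real_of_ereal (u z)\<bar>"
          by (simp only: abs_mult mult.commute)
        then show ?thesis using True zU(1) by simp
      next
        case False
        have "0 \<le> c * (indicator U z *\<^sub>R \<bar>real_of_ereal (u z)\<bar>)"
          by (intro mult_nonneg_nonneg scaleR_nonneg_nonneg abs_ge_zero \<open>0 \<le> c\<close>) simp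
        then show ?thesis using False by simp
      qed
      then show "AE z in ?C. norm (indicator (S n) z *\<^sub>R (real_of_ereal (u z) * time_deriv (\<psi> n) z)) \<le> ?w z" for n
        by simp
    qed
    have main: "\<alpha> * drift \<phi> P + enn2real (energy u P) \<le> K * enn2real (energy (perturb \<phi>) P)"
    proof (rule LIMSEQ_le_const2)
      show "(\<lambda>n. \<alpha> * drift (\<psi> n) (S n) + enn2real (energy u (S n))) \<longlonglongrightarrow> \<alpha> * drift \<phi> P + enn2real (energy u P)"
        by (intro tendsto_intros lim_drift lim_energy)
    qed (use ineq in blast)
    have td0: "AE z in spacetime M. z \<in> Q \<and> \<phi> z = 0 \<longrightarrow> time_deriv \<phi> z = 0"
      using o(1) \<phi> nn by (rule time_deriv_eq_0)
    have drift_eq: "drift \<phi> U = drift \<phi> P"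
      unfolding set_lebesgue_integral_def
    proof (rule integral_cong_AE)
      show "(\<lambda>z. indicator U z *\<^sub>R (real_of_ereal (u z) * time_deriv \<phi> z)) \<in> borel_measurable ?C"
        using drift_integrable[OF U(1,2) \<phi>] unfolding set_integrable_def by (rule borel_measurable_integrable)
      show "(\<lambda>z. indicator P z *\<^sub>R (real_of_ereal (u z) * time_deriv \<phi> z)) \<in> borel_measurable ?C"
        using set_integrable_subset[OF drift_integrable[OF U(1,2) \<phi>] sets_completion_spacetimeI[OF Pm] P(2)]
        unfolding set_integrable_def by (rule borel_measurable_integrable)
      show "AE z in ?C. indicator U z *\<^sub>R (real_of_ereal (u z) * time_deriv \<phi> z) =
          indicator P z *\<^sub>R (real_of_ereal (u z) * time_deriv \<phi> z)"
        unfolding AE_completion_iff using td0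
      proof eventually_elim
        case (elim z)
        show ?case
        proof (cases "z \<in> U \<and> z \<notin> P")
          case True
          then have "z \<in> Q" using UQ(1) by blast
          then have "\<phi> z = 0" using True nn[of z] by (simp add: P_def)
          then have "time_deriv \<phi> z = 0" using elim \<open>z \<in> Q\<close> by blast
          then show ?thesis by simp
        next
          case False
          then have "z \<in> U \<longleftrightarrow> z \<in> P" using P(2) by blast
          then show ?thesis by (simp add: indicator_def)
        qed
      qed
    qed
    have split: "energy w U = energy w P + energy w (U - P)"
      if w: "is_par_ugrad p M \<Omega> T w (par_ugrad p M \<Omega> T w)" for w
    proof -
      have m1: "(\<lambda>z. epow (par_ugrad p M \<Omega> T w z) p * indicator P z) \<in> borel_measurable ?C"
        using P(2) UQ(1) by (intro energy_measurable[OF w Pm]) auto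
      have m2: "(\<lambda>z. epow (par_ugrad p M \<Omega> T w z) p * indicator (U - P) z) \<in> borel_measurable ?C"
        using UQ(1) Um Pm by (intro energy_measurable[OF w]) auto
      have "energy w U = (\<integral>\<^sup>+z. epow (par_ugrad p M \<Omega> T w z) p * indicator P z
          + epow (par_ugrad p M \<Omega> T w z) p * indicator (U - P) z \<partial>?C)"
        unfolding nn_integral_completion using P(2) by (intro nn_integral_cong) (auto simp: indicator_def)
      also have "\<dots> = (\<integral>\<^sup>+z. epow (par_ugrad p M \<Omega> T w z) p * indicator P z \<partial>?C)
          + (\<integral>\<^sup>+z. epow (par_ugrad p M \<Omega> T w z) p * indicator (U - P) z \<partial>?C)"
        by (rule nn_integral_add[OF m1 m2])
      finally show ?thesis by (simp only: nn_integral_completion)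
    qed
    have energy_Z: "energy u (U - P) = energy (perturb \<phi>) (U - P)"
    proof -
      have Zm: "U - P \<in> sets borel" "U - P \<subseteq> Q" using Um Pm UQ(1) by auto
      have "AE t in lborel. t \<in> {0<..<T} \<longrightarrow> (AE x in M. (x, t) \<in> U - P \<longrightarrow>
        min_ugrad p M \<Omega> (\<lambda>x. u (x, t)) x = min_ugrad p M \<Omega> (\<lambda>x. perturb \<phi> (x, t)) x)"
        using minimal_wug_slices[OF o T N L2] minimal_wug_slices_add[OF \<phi>]
      proof eventually_elim
        case (elim t)
        show ?case
        proof
          assume t: "t \<in> {0<..<T}"
          then have mu: "minimal_wug p M \<Omega> (\<lambda>x. u (x, t)) (min_ugrad p M \<Omega> (\<lambda>x. u (x, t)))"
            and mv: "minimal_wug p M \<Omega> (\<lambda>x. perturb \<phi> (x, t)) (min_ugrad p M \<Omega> (\<lambda>x. perturb \<phi> (x, t)))"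
            using elim by blast+
          have E: "\<Omega> \<inter> (\<lambda>x. \<phi> (x, t)) -` {0} \<in> sets borel"
            using o(1) lipschitz_on_continuous_on[OF lipschitz_slices(1)[OF \<phi> t]]
            by (rule borel_continuous_preimage) simp
          have "AE x in M. x \<in> \<Omega> \<inter> (\<lambda>x. \<phi> (x, t)) -` {0} \<longrightarrow>
            min_ugrad p M \<Omega> (\<lambda>x. u (x, t)) x = min_ugrad p M \<Omega> (\<lambda>x. perturb \<phi> (x, t)) x"
            by (rule minimal_wug_agree[OF o o(1) subset_refl mu mv E]) auto
          then show "AE x in M. (x, t) \<in> U - P \<longrightarrow>
            min_ugrad p M \<Omega> (\<lambda>x. u (x, t)) x = min_ugrad p M \<Omega> (\<lambda>x. perturb \<phi> (x, t)) x"
          proof eventually_elim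
            case (elim x)
            have "x \<in> \<Omega> \<inter> (\<lambda>x. \<phi> (x, t)) -` {0}" if "(x, t) \<in> U - P"
            proof -
              have "(x, t) \<in> Q" using that UQ(1) by blast
              then show ?thesis using that nn[of "(x, t)"] by (auto simp: P_def)
            qed
            with elim show ?case by blast
          qed
        qed
      qed
      from is_par_ugrad_agree[OF o(1) is_par_ugrad_u v Zm this]
      have "AE z in spacetime M. epow (par_ugrad p M \<Omega> T u z) p * indicator (U - P) z =
        epow (par_ugrad p M \<Omega> T (perturb \<phi>) z) p * indicator (U - P) z"
        by eventually_elim (auto simp: indicator_def)
      then show ?thesis by (rule nn_integral_cong_AE)
    qed
    have fins: "energy u P < \<infinity>" "energy (perturb \<phi>) P < \<infinity>" "energy (perturb \<phi>) (U - P) < \<infinity>"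
      using fin_u[OF P(2)] fin_v[OF P(2)] fin_v[of "U - P"] by auto
    have "\<alpha> * drift \<phi> U + enn2real (energy u U) \<le> K * enn2real (energy (perturb \<phi>) U)"
    proof -
      have "enn2real (energy u U) = enn2real (energy u P) + enn2real (energy (perturb \<phi>) (U - P))"
        unfolding split[OF is_par_ugrad_u] energy_Z using fins by (intro enn2real_plus) auto
      moreover have "enn2real (energy (perturb \<phi>) U) = enn2real (energy (perturb \<phi>) P) + enn2real (energy (perturb \<phi>) (U - P))"
        unfolding split[OF v] using fins by (intro enn2real_plus) auto
      \<comment> \<open>Here \<open>1 \<le> K\<close> enters: the energy on \<open>U - P\<close>
        carries the factor 1 on the left and \<open>K\<close> on the right.\<close>
      moreover have "1 * enn2real (energy (perturb \<phi>) (U - P)) \<le> K * enn2real (energy (perturb \<phi>) (U - P))"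
        using K by (intro mult_right_mono) auto
      ultimately show ?thesis using main unfolding drift_eq by (simp add: distrib_left)
    qed
    then show ?thesis using ereal_energy_iff[OF fin_u[OF subset_refl] fin_v[OF subset_refl]] by blast
  qed
qed

end

end

theorem lemma3p5:
  fixes M :: "'x::complete_space measure"
    and \<Omega> :: "'x set"
    and p T \<alpha> K :: real
    and u :: "'x \<times> real \<Rightarrow> ereal"
  assumes "1 < p"
    and "doubling_measure M"
    and "weak_poincare p M"
    and "open \<Omega>" and "bounded \<Omega>"
    and "0 < T" and "0 < \<alpha>" and "1 \<le> K"
    and "in_Lp_newtonian_loc p M \<Omega> T u"
    and "in_Lp_loc 2 (spacetime M) (cylinder \<Omega> T) u"
  shows "quasisuperminimizer p M \<Omega> T \<alpha> K u \<longleftrightarrow>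
    (\<forall>\<phi>. nonneg_Lip (cylinder \<Omega> T) \<phi> \<and> supp (cylinder \<Omega> T) \<phi> \<subseteq> cylinder \<Omega> T \<longrightarrow>
      ereal (\<alpha> * (LINT z:supp (cylinder \<Omega> T) \<phi>|completion (spacetime M).
                     real_of_ereal (u z) * time_deriv \<phi> z))
        + enn2ereal (\<integral>\<^sup>+z\<in>supp (cylinder \<Omega> T) \<phi>. epow (par_ugrad p M \<Omega> T u z) p \<partial>spacetime M)
      \<le> ereal K *
        enn2ereal (\<integral>\<^sup>+z\<in>supp (cylinder \<Omega> T) \<phi>.
          epow (par_ugrad p M \<Omega> T (\<lambda>z. u z + ereal (\<phi> z)) z) p \<partial>spacetime M))"
proof -
  interpret proper_measure_space M p
    using assms(1,2) by (intro doubling_proper_measure_space) auto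
  note hyps = assms(4-6,9,10)
  have pos: "0 < emeasure M (ball x r)" if "0 < r" for x r
    using assms(2) that by (simp add: doubling_measure_def)
  show ?thesis
  proof (intro iffI allI impI)
    fix \<phi> assume q: "quasisuperminimizer p M \<Omega> T \<alpha> K u"
      and \<phi>: "nonneg_Lip (cylinder \<Omega> T) \<phi> \<and> supp (cylinder \<Omega> T) \<phi> \<subseteq> cylinder \<Omega> T"
    then obtain L where L: "L-lipschitz_on (cylinder \<Omega> T) \<phi>" and nn: "\<And>z. z \<in> cylinder \<Omega> T \<Longrightarrow> 0 \<le> \<phi> z"
      by (auto simp: nonneg_Lip_def)
    show "ereal (\<alpha> * (LINT z:supp (cylinder \<Omega> T) \<phi>|completion (spacetime M).
                     real_of_ereal (u z) * time_deriv \<phi> z))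
        + enn2ereal (\<integral>\<^sup>+z\<in>supp (cylinder \<Omega> T) \<phi>. epow (par_ugrad p M \<Omega> T u z) p \<partial>spacetime M)
      \<le> ereal K *
        enn2ereal (\<integral>\<^sup>+z\<in>supp (cylinder \<Omega> T) \<phi>.
          epow (par_ugrad p M \<Omega> T (\<lambda>z. u z + ereal (\<phi> z)) z) p \<partial>spacetime M)"
    proof (rule supp_inequality[OF hyps pos assms(8) _ L nn])
      show "supp (cylinder \<Omega> T) \<phi> \<subseteq> cylinder \<Omega> T" using \<phi> by blast
    qed (use q \<phi> in \<open>auto simp: quasisuperminimizer_def\<close>)
  next
    assume s: "\<forall>\<phi>. nonneg_Lip (cylinder \<Omega> T) \<phi> \<and> supp (cylinder \<Omega> T) \<phi> \<subseteq> cylinder \<Omega> T \<longrightarrow>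
      ereal (\<alpha> * (LINT z:supp (cylinder \<Omega> T) \<phi>|completion (spacetime M).
                     real_of_ereal (u z) * time_deriv \<phi> z))
        + enn2ereal (\<integral>\<^sup>+z\<in>supp (cylinder \<Omega> T) \<phi>. epow (par_ugrad p M \<Omega> T u z) p \<partial>spacetime M)
      \<le> ereal K *
        enn2ereal (\<integral>\<^sup>+z\<in>supp (cylinder \<Omega> T) \<phi>.
          epow (par_ugrad p M \<Omega> T (\<lambda>z. u z + ereal (\<phi> z)) z) p \<partial>spacetime M)"
    show "quasisuperminimizer p M \<Omega> T \<alpha> K u"
      unfolding quasisuperminimizer_def
    proof (intro conjI allI impI assms(9,10))
      fix U \<phi> assume U: "open U \<and> compactly_in U (cylinder \<Omega> T) \<and> nonneg_Lip (cylinder \<Omega> T) \<phi> \<and>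
        {z \<in> cylinder \<Omega> T. 0 < \<phi> z} \<subseteq> U"
      then obtain L where L: "L-lipschitz_on (cylinder \<Omega> T) \<phi>" and nn: "\<And>z. z \<in> cylinder \<Omega> T \<Longrightarrow> 0 \<le> \<phi> z"
        by (auto simp: nonneg_Lip_def)
      show "ereal (\<alpha> * (LINT z:U|completion (spacetime M). real_of_ereal (u z) * time_deriv \<phi> z))
          + enn2ereal (\<integral>\<^sup>+z\<in>U. epow (par_ugrad p M \<Omega> T u z) p \<partial>spacetime M)
        \<le> ereal K *
          enn2ereal (\<integral>\<^sup>+z\<in>U. epow (par_ugrad p M \<Omega> T (\<lambda>z. u z + ereal (\<phi> z)) z) p \<partial>spacetime M)"
        by (rule open_inequality[OF hyps pos assms(8) _ L nn]) (use s U in blast)+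
    qed
  qed
qed

end
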